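(* Let $0<p<1$ and $r\in\mathbb{N}$. There is a constant $C$, independent of $f$ and $n$, such that the following holds. Let $f$ be a function on $\mathbb{T}$ such that $f^{(r-1)}\in AC(\mathbb{T})$ and $$\sum_{\nu=1}^\infty \nu^{-p}E_\nu(f^{(r)})_p^p<\infty ,$$ and let $T_n\in\mathcal{T}_n$, $n\in\mathbb{N}$, be such that $\|f-T_n\|_p=E_n(f)_p$. Then for any $n\in\mathbb{N}$, $$\|f^{(r)}-T_n^{(r)}\|_p\le C\left(E_n(f^{(r)})_p+n^{1-\frac1p}\left(\sum_{\nu=n+1}^\infty \nu^{-p}E_\nu(f^{(r)})_p^p\right)^{\frac1p}\right).$$
   Context: $\mathbb{T}\cong[0,2\pi)$ is the unit circle, and functions on $\mathbb{T}$ are identified with $2\pi$-periodic functions. $L_p(\mathbb{T})$ is the space of measurable $f$ with $\|f\|_p=\left(\int_{\mathbb{T}}|f(x)|^p\,dx\right)^{1/p}<\infty$. $AC(\mathbb{T})$ is the set of absolutely continuous ($2\pi$-periodic) functions; when $f^{(r-1)}\in AC(\mathbb{T})$, $f^{(r)}$ denotes the (a.e. defined, integrable) derivative of $f^{(r-1)}$. $\mathcal{T}_n$ is the set of all trigonometric polynomials of degree at most $n$, and $E_n(f)_p=\inf_{T\in\mathcal{T}_n}\|f-T\|_p$. *)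

theory Defs
  imports "HOL-Analysis.Analysis"
begin

(* Functions on the circle are 2 pi-periodic functions on the real line.  They are
   complex-valued; real functions are the special case of values in the real axis. *)

definition circle_fun :: "(real \<Rightarrow> complex) \<Rightarrow> bool" where
  "circle_fun f \<longleftrightarrow> (\<forall>x. f (x + 2 * pi) = f x)"

(* By periodicity, absolute continuity over one period is absolute continuity on every
   bounded interval. *)

definition AC_circle :: "(real \<Rightarrow> complex) set" where
  "AC_circle = {f. circle_fun f \<and>
     (\<forall>\<epsilon>>0. \<exists>\<delta>>0. \<forall>N. \<forall>a b :: nat \<Rightarrow> real.
        (\<forall>i<N. 0 \<le> a i \<and> a i \<le> b i \<and> b i \<le> 2 * pi) \<and>
        disjoint_family_on (\<lambda>i. {a i<..<b i}) {..<N} \<and>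
        (\<Sum>i<N. b i - a i) < \<delta>
        \<longrightarrow> (\<Sum>i<N. norm (f (b i) - f (a i))) < \<epsilon>)}"

(* Where the k-th derivative does not exist the value is an arbitrary one chosen by
   vector_derivative.  If the (k-1)-st derivative is absolutely continuous, this happens
   on a Lebesgue null set only. *)

definition nderiv :: "nat \<Rightarrow> (real \<Rightarrow> complex) \<Rightarrow> real \<Rightarrow> complex" where
  "nderiv k f = ((\<lambda>g x. vector_derivative g (at x)) ^^ k) f"

definition deriv_in_AC :: "nat \<Rightarrow> (real \<Rightarrow> complex) \<Rightarrow> bool" where
  "deriv_in_AC k f \<longleftrightarrow>
     (\<forall>j<k. \<forall>x. nderiv j f differentiable at x) \<and> nderiv k f \<in> AC_circle"

(* The integral is over the complete measure lebesgue, so that values on null sets are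
   irrelevant even for measurability.  The Bochner integral is 0 for non-integrable
   functions; thus this is the L_p quasi-norm only for f in L_p. *)

definition Lp_norm :: "real \<Rightarrow> (real \<Rightarrow> complex) \<Rightarrow> real" where
  "Lp_norm p f = (LINT x:{0..<2 * pi}|lebesgue. norm (f x) powr p) powr (1 / p)"

definition trig_polys :: "nat \<Rightarrow> (real \<Rightarrow> complex) set" where
  "trig_polys n =
     {T. \<exists>c :: int \<Rightarrow> complex. \<forall>x. T x = (\<Sum>k = - int n..int n. c k * cis (of_int k * x))}"

definition best_approx :: "nat \<Rightarrow> real \<Rightarrow> (real \<Rightarrow> complex) \<Rightarrow> real" where
  "best_approx n p f = (INF T\<in>trig_polys n. Lp_norm p (\<lambda>x. f x - T x))"

end

theory Submission
  imports Defs
begin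

text \<open>
  Write \<open>g\<close> for the \<open>r\<close>-th derivative of \<open>f\<close>. All estimates are for \<open>p\<close>-th powers of \<open>L\<^sub>p\<close> quasi-norms,
  which satisfy the triangle inequality because \<open>p < 1\<close>.

  If some \<open>V\<close> in \<open>\<T>\<^sub>n\<close> approximates \<open>f\<close> with error of order \<open>n\<^sup>-\<^sup>r E\<close> and its \<open>r\<close>-th derivative
  approximates \<open>g\<close> with error of order \<open>E\<close>, then so does the \<open>r\<close>-th derivative of the best
  approximant \<open>T\<^sub>n\<close>: the distance of \<open>V\<close> and \<open>T\<^sub>n\<close> is at most of order \<open>n\<^sup>-\<^sup>r E\<close>, and Bernstein's
  inequality, which also holds in \<open>L\<^sub>p\<close> for \<open>p < 1\<close>, turns this into a bound of order \<open>E\<close> for the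
  derivatives. So it suffices to construct \<open>V\<close>.

  The difficulty is that integration does not respect the \<open>L\<^sub>p\<close> quasi-norm: the primitive of \<open>h\<close> depends
  on integrals of \<open>h\<close>, and these cannot be bounded by an \<open>L\<^sub>p\<close> quasi-norm with \<open>p < 1\<close>. Passing to
  the \<open>L\<^sub>1\<close> norm would lose a power of \<open>n\<close>. The quantity that behaves well is local: replace \<open>h\<close> by
  its integrals of absolute values over windows of length \<open>1 / n\<close> and take the \<open>L\<^sub>p\<close> quasi-norm of the
  result (\<open>amalgam\<close> below). It has three properties.

  First, if \<open>H' = h\<close>, then the increment of \<open>H\<close> by \<open>t\<close> is controlled in \<open>L\<^sub>p\<close> by \<open>1 + n \<bar>t\<bar>\<close> times the
  amalgam of \<open>h\<close> (\<open>pint_increment_le\<close>). Averaging against a kernel concentrated at scale \<open>1 / n\<close>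
  then gives a Jackson inequality for one primitive (\<open>quasi_interpolation\<close>, \<open>primitive_step\<close>), which
  is iterated \<open>r\<close> times (\<open>simultaneous_approx\<close>). Before integrating, the mean of the approximant of
  the derivative is removed by a multiple of a concentrated kernel (\<open>mean_correction\<close>).

  Secondly, on \<open>\<T>\<^sub>n\<close> it is at most of the order of the \<open>L\<^sub>p\<close> quasi-norm times \<open>n\<^sup>-\<^sup>1\<close>, the length of the
  windows (\<open>amalgam_trig_le\<close>), and for polynomials of degree \<open>k n\<close> the \<open>p\<close>-th powers lose only a
  factor \<open>k\<^sup>1\<^sup>-\<^sup>p\<close> (\<open>amalgam_trig_coarse\<close>).

  Thirdly, it satisfies a Fatou lemma (\<open>amalgam_Fatou\<close>). Hence, if \<open>U\<^sub>j\<close> is a near-best \<open>L\<^sub>p\<close>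
  approximant of \<open>g\<close> of degree \<open>2\<^sup>j n\<close>, the telescoping series of the differences shows that the
  \<open>p\<close>-th power of the amalgam of \<open>g - U\<^sub>0\<close> is at most of the order of \<open>n\<^sup>-\<^sup>p\<close> times the sum over \<open>j\<close> of
  \<open>2\<^sup>j\<^sup>(\<^sup>1\<^sup>-\<^sup>p\<^sup>)\<close> times the \<open>p\<close>-th power of the error of best approximation of \<open>g\<close> of degree \<open>2\<^sup>j n\<close>. By
  dyadic condensation this sum is at most of the order of the \<open>p\<close>-th power of the right-hand side of
  the theorem (\<open>near_best_amalgam\<close>).

  All of this needs \<open>g\<close> to be the almost everywhere derivative of an absolutely continuous function
  of which this function is the integral. This is obtained from the Radon-Nikodym theorem, applied to the sum and
  the difference of the variation function and the given function (\<open>abs_cont_density\<close>), and the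
  differentiation theorem for integrals (\<open>primitive_AE_derivative\<close>).
\<close>

section \<open>Quasi-norms and integrals over a period\<close>

text \<open>Both fractions of \<open>a + b\<close> lie in \<open>[0, 1]\<close>, where \<open>t \<le> t powr p\<close>. This replaces
  Minkowski's inequality throughout.\<close>

lemma powr_add_le:
  fixes a b p :: real
  assumes "0 \<le> a" "0 \<le> b" "0 < p" "p \<le> 1"
  shows "(a + b) powr p \<le> a powr p + b powr p"
proof (cases "a + b = 0")
  case True
  then show ?thesis using assms by simp
next
  case False
  define s where "s = a + b"
  have s: "s > 0" using False assms by (auto simp: s_def)
  have le: "t \<le> t powr p" if "0 \<le> t" "t \<le> 1" for t
  proof (cases "t = 0")
    case False
    then show ?thesis using powr_mono'[of p 1 t] that assms by simp
  qed simp
  have "1 = a / s + b / s"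
    using s by (simp add: s_def add_divide_distrib[symmetric])
  also have "\<dots> \<le> (a / s) powr p + (b / s) powr p"
    using s assms by (intro add_mono le) (auto simp: s_def)
  also have "\<dots> = (a powr p + b powr p) / s powr p"
    using s assms by (simp add: powr_divide add_divide_distrib)
  finally show ?thesis using s by (simp add: s_def field_simps)
qed

lemma powr_sum_le:
  fixes f :: "'i \<Rightarrow> real"
  assumes "finite A" "\<And>i. i \<in> A \<Longrightarrow> 0 \<le> f i" "0 < p" "p \<le> 1"
  shows "(\<Sum>i\<in>A. f i) powr p \<le> (\<Sum>i\<in>A. f i powr p)"
  using assms(1,2)
proof (induction A rule: finite_induct)
  case (insert x A)
  have "(\<Sum>i\<in>insert x A. f i) powr p \<le> f x powr p + (\<Sum>i\<in>A. f i) powr p"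
    using insert assms by (simp add: powr_add_le sum_nonneg)
  then show ?case using insert by auto
qed simp

lemma norm_add_powr_le:
  fixes a b :: "'a :: real_normed_vector"
  assumes "0 < p" "p \<le> 1"
  shows "norm (a + b) powr p \<le> norm a powr p + norm b powr p"
  using powr_add_le[of "norm a" "norm b" p] powr_mono2[of p "norm (a + b)" "norm a + norm b"]
    norm_triangle_ineq[of a b] assms by auto

lemma norm_sum_powr_le:
  fixes f :: "'i \<Rightarrow> 'a :: real_normed_vector"
  assumes "finite A" "0 < p" "p \<le> 1"
  shows "norm (\<Sum>i\<in>A. f i) powr p \<le> (\<Sum>i\<in>A. norm (f i) powr p)"
proof -
  have "norm (\<Sum>i\<in>A. f i) powr p \<le> (\<Sum>i\<in>A. norm (f i)) powr p"
    using assms by (intro powr_mono2 norm_sum) auto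
  also have "\<dots> \<le> (\<Sum>i\<in>A. norm (f i) powr p)"
    using assms by (intro powr_sum_le) auto
  finally show ?thesis .
qed

definition periodic :: "(real \<Rightarrow> 'a) \<Rightarrow> bool" where
  "periodic f \<longleftrightarrow> (\<forall>x. f (x + 2 * pi) = f x)"

lemma circle_fun_eq: "circle_fun = periodic"
  by (simp add: circle_fun_def periodic_def fun_eq_iff)

lemma periodicD: "periodic f \<Longrightarrow> f (x + 2 * pi) = f x"
  by (simp add: periodic_def)

lemma periodic_int:
  assumes "periodic f"
  shows "f (x + of_int k * (2 * pi)) = f x"
proof (induction k rule: int_induct[where k = 0])
  case base
  show ?case by simp
next
  case (step1 i)
  then show ?case using periodicD[OF assms, of "x + of_int i * (2*pi)"] by (simp add: algebra_simps)
next
  case (step2 i)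
  then show ?case using periodicD[OF assms, of "x + of_int (i-1) * (2*pi)"] by (simp add: algebra_simps)
qed

lemma ennreal_mult_assoc: "0 \<le> a \<Longrightarrow> ennreal a * (ennreal b * X) = ennreal (a * b) * X"
  by (simp add: ennreal_mult' mult.assoc)

definition circ_int :: "(real \<Rightarrow> real) \<Rightarrow> ennreal" where
  "circ_int \<phi> = (\<integral>\<^sup>+x\<in>{0..<2*pi}. ennreal (\<phi> x) \<partial>lborel)"

lemma circ_int_mono:
  assumes "\<And>x. \<phi> x \<le> \<psi> x"
  shows "circ_int \<phi> \<le> circ_int \<psi>"
  unfolding circ_int_def using assms by (intro nn_integral_mono mult_right_mono) (auto intro: ennreal_leI)

lemma circ_int_add:
  assumes "\<phi> \<in> borel_measurable borel" "\<psi> \<in> borel_measurable borel"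
    "\<And>x. 0 \<le> \<phi> x" "\<And>x. 0 \<le> \<psi> x"
  shows "circ_int (\<lambda>x. \<phi> x + \<psi> x) = circ_int \<phi> + circ_int \<psi>"
  unfolding circ_int_def using assms by (simp add: ennreal_plus distrib_right nn_integral_add)

lemma circ_int_cmult:
  assumes "\<phi> \<in> borel_measurable borel" "0 \<le> c"
  shows "circ_int (\<lambda>x. c * \<phi> x) = ennreal c * circ_int \<phi>"
  unfolding circ_int_def using assms by (simp add: ennreal_mult' nn_integral_cmult mult.assoc)

lemma circ_int_sum:
  assumes "\<And>i. i \<in> A \<Longrightarrow> \<phi> i \<in> borel_measurable borel" "\<And>i x. i \<in> A \<Longrightarrow> 0 \<le> \<phi> i x"
  shows "circ_int (\<lambda>x. \<Sum>i\<in>A. \<phi> i x) = (\<Sum>i\<in>A. circ_int (\<phi> i))"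
proof -
  have "circ_int (\<lambda>x. \<Sum>i\<in>A. \<phi> i x)
      = (\<integral>\<^sup>+x. (\<Sum>i\<in>A. ennreal (\<phi> i x) * indicator {0..<2*pi} x) \<partial>lborel)"
    unfolding circ_int_def using assms(2)
    by (intro nn_integral_cong) (simp add: sum_ennreal sum_distrib_right[symmetric])
  also have "\<dots> = (\<Sum>i\<in>A. circ_int (\<phi> i))"
    unfolding circ_int_def using assms(1) by (intro nn_integral_sum) auto
  finally show ?thesis .
qed

lemma circ_int_const: "0 \<le> c \<Longrightarrow> circ_int (\<lambda>x. c) = ennreal (2 * pi * c)"
  unfolding circ_int_def by (simp add: nn_integral_cmult ennreal_mult'[symmetric] mult.commute)

lemma nn_integral_shift:
  fixes f :: "real \<Rightarrow> ennreal"
  assumes "f \<in> borel_measurable borel"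
  shows "(\<integral>\<^sup>+x. f (x + a) \<partial>lborel) = (\<integral>\<^sup>+x. f x \<partial>lborel)"
  using nn_integral_real_affine[OF assms, of 1 a] by (simp add: add.commute)

lemma nn_integral_period_shift:
  fixes f :: "real \<Rightarrow> ennreal"
  assumes [measurable]: "f \<in> borel_measurable borel" and per: "periodic f"
  shows "(\<integral>\<^sup>+x\<in>{0..<2*pi}. f (x + a) \<partial>lborel) = (\<integral>\<^sup>+x\<in>{0..<2*pi}. f x \<partial>lborel)"
proof -
  define k where "k = \<lfloor>a / (2 * pi)\<rfloor>"
  define b where "b = a - of_int k * (2 * pi)"
  have b: "0 \<le> b" "b < 2 * pi"
    using floor_divide_lower[of "2*pi" a] floor_divide_upper[of "2*pi" a]
    by (auto simp: b_def k_def algebra_simps)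
  have ab: "f (x + a) = f (x + b)" for x
    using periodic_int[OF per, of "x + b" k] by (simp add: b_def algebra_simps)
  have "(\<integral>\<^sup>+x\<in>{0..<2*pi}. f (x + a) \<partial>lborel)
      = (\<integral>\<^sup>+x. (\<lambda>y. f y * indicator {b..<2*pi+b} y) (x + b) \<partial>lborel)"
    unfolding ab by (intro nn_integral_cong) (auto simp: indicator_def)
  also have "\<dots> = (\<integral>\<^sup>+y. f y * indicator {b..<2*pi+b} y \<partial>lborel)"
    by (rule nn_integral_shift) measurable
  also have "\<dots> = (\<integral>\<^sup>+y. f y * indicator {b..<2*pi} y + f y * indicator {2*pi..<2*pi+b} y \<partial>lborel)"
    using b by (intro nn_integral_cong) (auto simp: indicator_def)
  also have "\<dots> = (\<integral>\<^sup>+y. f y * indicator {b..<2*pi} y \<partial>lborel)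
      + (\<integral>\<^sup>+y. f y * indicator {2*pi..<2*pi+b} y \<partial>lborel)"
    by (intro nn_integral_add) measurable
  also have "(\<integral>\<^sup>+y. f y * indicator {2*pi..<2*pi+b} y \<partial>lborel)
      = (\<integral>\<^sup>+x. (\<lambda>y. f y * indicator {2*pi..<2*pi+b} y) (x + 2 * pi) \<partial>lborel)"
    by (rule nn_integral_shift[symmetric]) measurable
  also have "\<dots> = (\<integral>\<^sup>+x. f x * indicator {0..<b} x \<partial>lborel)"
    by (intro nn_integral_cong) (auto simp: indicator_def periodicD[OF per])
  also have "(\<integral>\<^sup>+y. f y * indicator {b..<2*pi} y \<partial>lborel) + (\<integral>\<^sup>+x. f x * indicator {0..<b} x \<partial>lborel)
      = (\<integral>\<^sup>+y. f y * indicator {b..<2*pi} y + f y * indicator {0..<b} y \<partial>lborel)"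
    by (intro nn_integral_add[symmetric]) measurable
  also have "\<dots> = (\<integral>\<^sup>+x\<in>{0..<2*pi}. f x \<partial>lborel)"
    using b by (intro nn_integral_cong) (auto simp: indicator_def)
  finally show ?thesis .
qed

lemma circ_int_shift:
  assumes "\<phi> \<in> borel_measurable borel" "periodic \<phi>"
  shows "circ_int (\<lambda>x. \<phi> (x + a)) = circ_int \<phi>"
  unfolding circ_int_def
  using nn_integral_period_shift[of "\<lambda>x. ennreal (\<phi> x)" a] assms by (simp add: periodic_def)

text \<open>The \<open>p\<close>-th power of the \<open>L\<^sub>p\<close> quasi-norm. Extended values make sums, limits and exchanges of integrals free of integrability
  conditions.\<close>

definition pint :: "real \<Rightarrow> (real \<Rightarrow> complex) \<Rightarrow> ennreal" where
  "pint p w = circ_int (\<lambda>x. norm (w x) powr p)"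

abbreviation pdist :: "real \<Rightarrow> (real \<Rightarrow> complex) \<Rightarrow> (real \<Rightarrow> complex) \<Rightarrow> ennreal" where
  "pdist p v w \<equiv> pint p (\<lambda>x. v x - w x)"

lemma pint_add_le:
  assumes "0 < p" "p \<le> 1" and [measurable]: "v \<in> borel_measurable borel" "w \<in> borel_measurable borel"
  shows "pint p (\<lambda>x. v x + w x) \<le> pint p v + pint p w"
proof -
  have "pint p (\<lambda>x. v x + w x) \<le> circ_int (\<lambda>x. norm (v x) powr p + norm (w x) powr p)"
    unfolding pint_def using assms by (intro circ_int_mono norm_add_powr_le) auto
  also have "\<dots> = pint p v + pint p w"
    unfolding pint_def by (intro circ_int_add) auto
  finally show ?thesis .
qed

lemma pint_cmult:
  assumes [measurable]: "w \<in> borel_measurable borel"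
  shows "pint p (\<lambda>x. c * w x) = ennreal (norm c powr p) * pint p w"
  unfolding pint_def by (simp add: norm_mult powr_mult circ_int_cmult)

lemma pint_commute: "pdist p v w = pdist p w v"
  by (simp add: pint_def norm_minus_commute)

lemma pint_diff_le:
  assumes "0 < p" "p \<le> 1" and [measurable]: "u \<in> borel_measurable borel"
    "v \<in> borel_measurable borel" "w \<in> borel_measurable borel"
  shows "pdist p u w \<le> pdist p u v + pdist p v w"
  using pint_add_le[of p "\<lambda>x. u x - v x" "\<lambda>x. v x - w x"] assms by simp

lemma pint_sum_le:
  assumes "finite A" "0 < p" "p \<le> 1" and "\<And>i. i \<in> A \<Longrightarrow> w i \<in> borel_measurable borel"
  shows "pint p (\<lambda>x. \<Sum>i\<in>A. w i x) \<le> (\<Sum>i\<in>A. pint p (w i))"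
proof -
  have "pint p (\<lambda>x. \<Sum>i\<in>A. w i x) \<le> circ_int (\<lambda>x. \<Sum>i\<in>A. norm (w i x) powr p)"
    unfolding pint_def using assms by (intro circ_int_mono norm_sum_powr_le) auto
  also have "\<dots> = (\<Sum>i\<in>A. pint p (w i))"
    unfolding pint_def using assms(4) by (intro circ_int_sum) auto
  finally show ?thesis .
qed

lemma pint_shift:
  assumes [measurable]: "w \<in> borel_measurable borel" and "periodic w"
  shows "pint p (\<lambda>x. w (x + a)) = pint p w"
  unfolding pint_def
  using circ_int_shift[of "\<lambda>x. norm (w x) powr p" a] assms by (simp add: periodic_def)

section \<open>Trigonometric polynomials\<close>

lemma trig_polysI:
  "(\<And>x. T x = (\<Sum>k = - int n..int n. c k * cis (of_int k * x))) \<Longrightarrow> T \<in> trig_polys n"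
  unfolding trig_polys_def by blast

lemma trig_polysE:
  assumes "T \<in> trig_polys n"
  obtains c where "T = (\<lambda>x. \<Sum>k = - int n..int n. c k * cis (of_int k * x))"
  using assms unfolding trig_polys_def by blast

lemma trig_poly_mono:
  assumes "T \<in> trig_polys m" "m \<le> n"
  shows "T \<in> trig_polys n"
proof -
  obtain c where c: "T = (\<lambda>x. \<Sum>k = - int m..int m. c k * cis (of_int k * x))"
    using assms(1) by (rule trig_polysE)
  show ?thesis
  proof (rule trig_polysI)
    fix x
    show "T x = (\<Sum>k = - int n..int n. (if \<bar>k\<bar> \<le> int m then c k else 0) * cis (of_int k * x))"
      unfolding c using assms(2) by (intro sum.mono_neutral_cong_left) auto
  qed
qed

lemma trig_poly_cis: "\<bar>k\<bar> \<le> int n \<Longrightarrow> (\<lambda>x. cis (of_int k * x)) \<in> trig_polys n"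
  by (rule trig_polysI[where c = "\<lambda>j. if j = k then 1 else 0"])
    (auto simp: if_distrib[of "\<lambda>z. z * _"] sum.delta' cong: if_cong)

lemma trig_poly_const: "(\<lambda>x. c) \<in> trig_polys n"
  by (rule trig_polysI[where c = "\<lambda>j. if j = 0 then c else 0"])
    (auto simp: if_distrib[of "\<lambda>z. z * _"] sum.delta' cong: if_cong)

lemma trig_poly_add:
  assumes "S \<in> trig_polys n" "T \<in> trig_polys n"
  shows "(\<lambda>x. S x + T x) \<in> trig_polys n"
proof -
  obtain c where c: "S = (\<lambda>x. \<Sum>k = - int n..int n. c k * cis (of_int k * x))"
    using assms(1) by (rule trig_polysE)
  obtain d where d: "T = (\<lambda>x. \<Sum>k = - int n..int n. d k * cis (of_int k * x))"
    using assms(2) by (rule trig_polysE)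
  show ?thesis
    unfolding c d by (rule trig_polysI[where c = "\<lambda>k. c k + d k"])
      (simp add: sum.distrib distrib_right)
qed

lemma trig_poly_cmult:
  assumes "T \<in> trig_polys n"
  shows "(\<lambda>x. a * T x) \<in> trig_polys n"
proof -
  obtain c where c: "T = (\<lambda>x. \<Sum>k = - int n..int n. c k * cis (of_int k * x))"
    using assms by (rule trig_polysE)
  show ?thesis
    unfolding c by (rule trig_polysI[where c = "\<lambda>k. a * c k"])
      (simp add: sum_distrib_left mult.assoc)
qed

lemma trig_poly_diff:
  assumes "S \<in> trig_polys n" "T \<in> trig_polys n"
  shows "(\<lambda>x. S x - T x) \<in> trig_polys n"
  using trig_poly_add[OF assms(1) trig_poly_cmult[OF assms(2), of "-1"]] by simp

lemma trig_poly_sum: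
  assumes "\<And>i. i \<in> A \<Longrightarrow> T i \<in> trig_polys n"
  shows "(\<lambda>x. \<Sum>i\<in>A. T i x) \<in> trig_polys n"
proof (cases "finite A")
  case True
  then show ?thesis using assms
    by (induction A rule: finite_induct) (auto intro: trig_poly_add trig_poly_const[of 0])
next
  case False
  then show ?thesis using trig_poly_const[of 0] by simp
qed

lemma trig_poly_mult:
  assumes "S \<in> trig_polys m" "T \<in> trig_polys n"
  shows "(\<lambda>x. S x * T x) \<in> trig_polys (m + n)"
proof -
  obtain c where c: "S = (\<lambda>x. \<Sum>k = - int m..int m. c k * cis (of_int k * x))"
    using assms(1) by (rule trig_polysE)
  obtain d where d: "T = (\<lambda>x. \<Sum>k = - int n..int n. d k * cis (of_int k * x))"
    using assms(2) by (rule trig_polysE)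
  have "(\<lambda>x. S x * T x) = (\<lambda>x. \<Sum>j = - int m..int m. \<Sum>k = - int n..int n.
      (c j * d k) * cis (of_int (j + k) * x))"
    unfolding c d sum_product
    by (intro ext sum.cong refl) (simp add: cis_mult[symmetric] algebra_simps)
  also have "\<dots> \<in> trig_polys (m + n)"
    by (intro trig_poly_sum trig_poly_cmult trig_poly_cis) auto
  finally show ?thesis .
qed

lemma trig_poly_power:
  assumes "T \<in> trig_polys n"
  shows "(\<lambda>x. T x ^ k) \<in> trig_polys (k * n)"
proof (induction k)
  case 0
  show ?case using trig_poly_const[of 1] by simp
next
  case (Suc k)
  then show ?case using trig_poly_mult[OF assms Suc] by simp
qed

lemma trig_poly_shift:
  assumes "T \<in> trig_polys n"
  shows "(\<lambda>x. T (x + a)) \<in> trig_polys n"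
proof -
  obtain c where c: "T = (\<lambda>x. \<Sum>k = - int n..int n. c k * cis (of_int k * x))"
    using assms by (rule trig_polysE)
  show ?thesis
    unfolding c by (rule trig_polysI[where c = "\<lambda>k. c k * cis (of_int k * a)"])
      (simp add: distrib_left cis_mult[symmetric] mult_ac)
qed

lemma trig_poly_continuous:
  assumes "T \<in> trig_polys n"
  shows "continuous_on A T"
proof -
  obtain c where c: "T = (\<lambda>x. \<Sum>k = - int n..int n. c k * cis (of_int k * x))"
    using assms by (rule trig_polysE)
  show ?thesis unfolding c by (intro continuous_intros)
qed

lemma trig_poly_measurable: "T \<in> trig_polys n \<Longrightarrow> T \<in> borel_measurable borel"
  by (intro borel_measurable_continuous_onI trig_poly_continuous)

lemma cis_2pi_int: "cis (pi * (real_of_int k * 2)) = 1"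
  using cis_multiple_2pi[of "of_int k"] by (simp add: mult_ac)

lemma trig_poly_periodic:
  assumes "T \<in> trig_polys n"
  shows "periodic T"
proof -
  obtain c where c: "T = (\<lambda>x. \<Sum>k = - int n..int n. c k * cis (of_int k * x))"
    using assms by (rule trig_polysE)
  have "cis (of_int k * (x + 2 * pi)) = cis (of_int k * x)" for k x
    by (simp add: distrib_left cis_mult[symmetric] cis_2pi_int mult_ac)
  then show ?thesis unfolding c periodic_def by simp
qed

definition dv :: "(real \<Rightarrow> complex) \<Rightarrow> real \<Rightarrow> complex" where
  "dv w = (\<lambda>x. vector_derivative w (at x))"

lemma nderiv_dv: "nderiv k w = (dv ^^ k) w"
  by (simp add: nderiv_def dv_def[abs_def])

lemma cis_has_vector_derivative:
  "((\<lambda>x. cis (a * x)) has_vector_derivative (\<i> * of_real a * cis (a * x))) (at x)"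
proof -
  have "((\<lambda>z. exp (\<i> * of_real a * z)) has_field_derivative
      (\<i> * of_real a * exp (\<i> * of_real a * of_real x))) (at (of_real x))"
    by (auto intro!: derivative_eq_intros)
  from has_vector_derivative_real_field[OF this]
  show ?thesis by (simp add: cis_conv_exp mult.assoc)
qed

lemma trig_sum_has_vector_derivative:
  "((\<lambda>x. \<Sum>k = - int n..int n. c k * cis (of_int k * x)) has_vector_derivative
    (\<Sum>k = - int n..int n. (c k * \<i> * of_int k) * cis (of_int k * x))) (at x)"
proof (intro has_vector_derivative_sum)
  fix k :: int
  show "((\<lambda>x. c k * cis (of_int k * x)) has_vector_derivative
      (c k * \<i> * of_int k) * cis (of_int k * x)) (at x)"
    using has_vector_derivative_mult_right[OF cis_has_vector_derivative[of "of_int k" x], of "c k"]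
    by (simp add: mult_ac)
qed

lemma trig_poly_dv:
  assumes "T \<in> trig_polys n"
  shows "dv T \<in> trig_polys n" "(T has_vector_derivative dv T x) (at x)"
proof -
  obtain c where c: "T = (\<lambda>x. \<Sum>k = - int n..int n. c k * cis (of_int k * x))"
    using assms by (rule trig_polysE)
  have "dv T = (\<lambda>x. \<Sum>k = - int n..int n. (c k * \<i> * of_int k) * cis (of_int k * x))"
    unfolding dv_def c using trig_sum_has_vector_derivative[where n = n and c = c]
    by (intro ext vector_derivative_at) auto
  then show "dv T \<in> trig_polys n" "(T has_vector_derivative dv T x) (at x)"
    using trig_sum_has_vector_derivative[where n = n and c = c and x = x]
    by (auto intro: trig_polysI[where c = "\<lambda>k. c k * \<i> * of_int k"] simp: c)
qed

lemma dv_trig_diff: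
  assumes "S \<in> trig_polys n" "T \<in> trig_polys n"
  shows "dv (\<lambda>x. S x - T x) = (\<lambda>x. dv S x - dv T x)"
  unfolding dv_def[of "\<lambda>x. S x - T x"]
  by (intro ext vector_derivative_at has_vector_derivative_diff)
    (rule trig_poly_dv[OF assms(1)] trig_poly_dv[OF assms(2)])+

lemma trig_poly_dv_iter: "T \<in> trig_polys n \<Longrightarrow> (dv ^^ k) T \<in> trig_polys n"
  by (induction k) (auto intro: trig_poly_dv)

lemma dv_iter_trig_diff:
  assumes "S \<in> trig_polys n" "T \<in> trig_polys n"
  shows "(dv ^^ k) (\<lambda>x. S x - T x) = (\<lambda>x. (dv ^^ k) S x - (dv ^^ k) T x)"
  by (induction k) (simp_all add: dv_trig_diff[OF trig_poly_dv_iter trig_poly_dv_iter, OF assms])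

lemma sum_cis_roots:
  assumes "0 < \<bar>m\<bar>" "\<bar>m\<bar> < int L"
  shows "(\<Sum>k<L. cis (of_int m * (x + 2 * pi * real k / real L))) = 0"
proof -
  define z where "z = cis (of_int m * (2 * pi / real L))"
  have L: "L > 0" using assms by auto
  have "z ^ k = cis (of_int m * (2 * pi * real k / real L))" for k
    unfolding z_def Complex.DeMoivre by (rule arg_cong[where f = cis]) (simp add: mult_ac)
  then have "cis (of_int m * (x + 2 * pi * real k / real L)) = cis (of_int m * x) * z ^ k" for k
    by (simp add: cis_mult distrib_left)
  then have *: "(\<Sum>k<L. cis (of_int m * (x + 2 * pi * real k / real L)))
      = cis (of_int m * x) * (\<Sum>k<L. z ^ k)"
    by (simp add: sum_distrib_left)
  have zL: "z ^ L = 1"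
    unfolding z_def Complex.DeMoivre using L
    by (simp add: cis_2pi_int mult_ac)
  have "z \<noteq> 1"
  proof
    assume "z = 1"
    then have "cos (of_int m * (2 * pi / real L)) = 1"
      by (metis cis.simps(1) one_complex.simps(1) z_def)
    then obtain j :: int where "of_int m * (2 * pi / real L) = of_int j * 2 * pi"
      unfolding cos_one_2pi_int by auto
    then have "real_of_int m = of_int j * real L"
      using L by (simp add: field_simps)
    then have "m = j * int L" by (metis of_int_eq_iff of_int_mult of_int_of_nat_eq)
    then show False using assms
      by (metis abs_mult abs_of_nat dvd_triv_right mult_zero_left not_less_iff_gr_or_eq
          zdvd_imp_le zdvd_not_zless abs_dvd_iff dvd_abs_iff)
  qed
  then have "(\<Sum>k<L. z ^ k) = 0" using geometric_sum[of z L] zL by simp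
  then show ?thesis using * by simp
qed

text \<open>The mean value of a trigonometric polynomial, once as the value of every sufficiently fine
  equidistant quadrature and once as the obstruction to a periodic primitive.\<close>

lemma trig_poly_mean:
  assumes "T \<in> trig_polys n"
  shows "\<exists>c. (\<forall>L>n. \<forall>x. (\<Sum>k<L. T (x + 2 * pi * real k / real L)) = of_nat L * c) \<and>
    (\<exists>V\<in>trig_polys n. \<forall>x. (V has_vector_derivative T x - c) (at x))"
proof -
  obtain a where a: "T = (\<lambda>x. \<Sum>k = - int n..int n. a k * cis (of_int k * x))"
    using assms by (rule trig_polysE)
  define d where "d k = (if k = 0 then 0 else a k / (\<i> * of_int k))" for k
  define V where "V = (\<lambda>x. \<Sum>k = - int n..int n. d k * cis (of_int k * x))"
  have 1: "(\<Sum>k<L. T (x + 2 * pi * real k / real L)) = of_nat L * a 0" if "n < L" for L x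
  proof -
    have "(\<Sum>k<L. T (x + 2 * pi * real k / real L))
      = (\<Sum>m = - int n..int n. a m * (\<Sum>k<L. cis (of_int m * (x + 2 * pi * real k / real L))))"
      unfolding a by (subst sum.swap) (simp add: sum_distrib_left)
    also have "\<dots> = (\<Sum>m\<in>- {x. x \<noteq> 0} \<inter> {- int n..int n}. a m * of_nat L)"
      using that by (intro sum.mono_neutral_cong_right) (auto intro!: sum_cis_roots)
    also have "- {x. x \<noteq> 0} \<inter> {- int n..int n} = {0}" by auto
    finally show ?thesis by simp
  qed
  have 2: "(V has_vector_derivative T x - a 0) (at x)" for x
  proof -
    have "(\<Sum>k = - int n..int n. (d k * \<i> * of_int k) * cis (of_int k * x))
       = (\<Sum>k = - int n..int n. a k * cis (of_int k * x) - (if k = 0 then a 0 else 0))"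
      by (intro sum.cong) (auto simp: d_def)
    also have "\<dots> = T x - a 0" unfolding a sum_subtractf by (simp add: sum.delta)
    finally show ?thesis
      using trig_sum_has_vector_derivative[where n = n and c = d and x = x] by (simp add: V_def)
  qed
  have "V \<in> trig_polys n" unfolding V_def by (rule trig_polysI) simp
  with 1 2 show ?thesis by blast
qed

text \<open>The equidistant rule with \<open>2 * d + 1\<close> nodes is orthogonal on frequencies up to \<open>2 * d\<close>, so
  the Fourier coefficients of \<open>S\<close>, and hence its derivative, are determined by the nodal values. The
  nodes are centred at the origin: later the values far from it are damped by a kernel.\<close>

lemma trig_poly_derivative_quadrature:
  assumes "S \<in> trig_polys d"
  defines "L \<equiv> 2 * d + 1"
  defines "\<theta> \<equiv> \<lambda>k::nat. 2 * pi * (real k - real d) / real L"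
  shows "dv S 0 = (\<Sum>k<L. (\<Sum>j = - int d..int d. \<i> * of_int j * cis (- of_int j * \<theta> k)) / of_nat L
      * S (\<theta> k))"
proof -
  obtain c where c: "S = (\<lambda>x. \<Sum>k = - int d..int d. c k * cis (of_int k * x))"
    using assms(1) by (rule trig_polysE)
  have \<theta>: "\<theta> k = - (2 * pi * real d / real L) + 2 * pi * real k / real L" for k
    by (simp add: \<theta>_def diff_divide_distrib[symmetric] right_diff_distrib)
  have L: "L > 0" by (simp add: L_def)
  have orth: "(\<Sum>k<L. cis (of_int m * \<theta> k)) = (if m = 0 then of_nat L else 0)"
    if "\<bar>m\<bar> \<le> 2 * int d" for m
  proof -
    have "\<bar>m\<bar> < int L" using that by (simp add: L_def)
    then show ?thesis
      using sum_cis_roots[of m L "- (2 * pi * real d / real L)"] unfolding \<theta> by auto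
  qed
  have "(\<Sum>k<L. (\<Sum>j = - int d..int d. \<i> * of_int j * cis (- of_int j * \<theta> k)) / of_nat L * S (\<theta> k))
     = (\<Sum>k<L. \<Sum>j = - int d..int d. \<Sum>l = - int d..int d.
          \<i> * of_int j * c l / of_nat L * cis (of_int (l - j) * \<theta> k))"
    unfolding c sum_divide_distrib sum_product
    by (intro sum.cong refl) (simp add: cis_mult[symmetric] algebra_simps diff_conv_add_uminus del: add_uminus_conv_diff)
  also have "\<dots> = (\<Sum>j = - int d..int d. \<Sum>l = - int d..int d. \<Sum>k<L.
          \<i> * of_int j * c l / of_nat L * cis (of_int (l - j) * \<theta> k))"
    by (subst sum.swap) (intro sum.cong refl sum.swap)
  also have "\<dots> = (\<Sum>j = - int d..int d. \<Sum>l = - int d..int d.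
          \<i> * of_int j * c l / of_nat L * (if l = j then of_nat L else 0))"
    unfolding sum_distrib_left[symmetric] by (intro sum.cong refl arg_cong2[where f = "(*)"])
      (subst orth, auto)
  also have "\<dots> = (\<Sum>j = - int d..int d. \<i> * of_int j * c j)"
    using L by (intro sum.cong refl) (auto simp: if_distrib[of "\<lambda>z. _ * z"] sum.delta cong: if_cong)
  also have "\<dots> = dv S 0"
    unfolding dv_def c using trig_sum_has_vector_derivative[where n = d and c = c and x = 0]
    by (auto dest!: vector_derivative_at simp: mult_ac)
  finally show ?thesis ..
qed

section \<open>Localised kernels and the Bernstein inequality in \<open>L\<^sub>p\<close>\<close>

lemma sin_ge_linear:
  assumes "0 \<le> x" "x \<le> pi / 2"
  shows "2 * x / pi \<le> sin x"
proof -
  have "concave_on {0..pi/2} sin"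
  proof (rule f''_le0_imp_concave)
    show "convex {0..pi/2}" by (rule convex_closed_interval)
    fix x :: real assume x: "x \<in> {0..pi/2}"
    show "(sin has_real_derivative cos x) (at x)" by (rule DERIV_sin)
    show "(cos has_real_derivative - sin x) (at x)" by (rule DERIV_cos)
    show "- sin x \<le> 0" using x sin_ge_zero[of x] by auto
  qed
  from concave_onD[OF this, of "2 * x / pi" 0 "pi / 2"] show ?thesis
    using assms by (simp add: field_simps)
qed

lemma norm_one_minus_cis:
  assumes "\<bar>t\<bar> \<le> pi"
  shows "2 * \<bar>t\<bar> / pi \<le> norm (1 - cis t)"
proof -
  have "(norm (1 - cis t))\<^sup>2 = (1 - cos t)\<^sup>2 + (sin t)\<^sup>2"
    by (simp add: cmod_power2)
  also have "\<dots> = 2 - 2 * cos t"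
    using sin_cos_squared_add2[of t] by (simp add: power2_eq_square algebra_simps)
  also have "\<dots> = 4 * (sin (t / 2))\<^sup>2"
    using cos_double_sin[of "t / 2"] by simp
  also have "\<dots> = (2 * sin (\<bar>t\<bar> / 2))\<^sup>2"
    by (cases "0 \<le> t") (simp_all add: power_mult_distrib)
  finally have sq: "(norm (1 - cis t))\<^sup>2 = (2 * sin (\<bar>t\<bar> / 2))\<^sup>2" .
  have "0 \<le> sin (\<bar>t\<bar> / 2)"
    using assms by (intro sin_ge_zero) auto
  then have "norm (1 - cis t) = 2 * sin (\<bar>t\<bar> / 2)"
    by (intro power2_eq_imp_eq[OF sq]) auto
  moreover have "2 * (\<bar>t\<bar> / 2) / pi \<le> sin (\<bar>t\<bar> / 2)"
    using assms by (intro sin_ge_linear) auto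
  ultimately show ?thesis by simp
qed

text \<open>The second bound comes from the geometric sum: multiplication by \<open>1 - cis t\<close>, whose modulus is
  comparable to \<open>\<bar>t\<bar>\<close>, leaves \<open>1 - cis (M * t)\<close>. Powers of \<open>D\<close> with even exponent will serve as kernels.\<close>

lemma dirichlet_sum_bounds:
  fixes M :: nat
  assumes "M > 0"
  defines "D \<equiv> \<lambda>t. norm (\<Sum>j<M. cis (real j * t)) / M"
  shows "D t \<le> 1" "\<bar>t\<bar> \<le> pi \<Longrightarrow> \<bar>t\<bar> * D t \<le> pi / M"
proof -
  have "norm (\<Sum>j<M. cis (real j * t)) \<le> (\<Sum>j<M. norm (cis (real j * t)))"
    by (rule norm_sum)
  then show "D t \<le> 1" using assms by (simp add: D_def)
  assume t: "\<bar>t\<bar> \<le> pi"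
  have "(1 - cis t) * (\<Sum>j<M. cis (real j * t)) = 1 - cis t ^ M"
    using one_diff_power_eq[of "cis t" M] by (simp add: Complex.DeMoivre)
  then have "norm (1 - cis t) * norm (\<Sum>j<M. cis (real j * t)) = norm (1 - cis t ^ M)"
    by (simp add: norm_mult[symmetric])
  also have "\<dots> \<le> 2"
    using norm_triangle_ineq4[of 1 "cis t ^ M"] by (simp add: norm_power)
  finally have "norm (1 - cis t) * norm (\<Sum>j<M. cis (real j * t)) \<le> 2" .
  moreover have "2 * \<bar>t\<bar> / pi * norm (\<Sum>j<M. cis (real j * t))
      \<le> norm (1 - cis t) * norm (\<Sum>j<M. cis (real j * t))"
    using norm_one_minus_cis[OF t] by (intro mult_right_mono) auto
  ultimately have "2 * \<bar>t\<bar> / pi * norm (\<Sum>j<M. cis (real j * t)) \<le> 2" by linarith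
  then show "\<bar>t\<bar> * D t \<le> pi / M"
    using assms by (simp add: D_def field_simps)
qed

lemma dirichlet_square_trig_poly:
  assumes "M > 0"
  shows "(\<lambda>t. of_real ((norm (\<Sum>j<M. cis (real j * t)))\<^sup>2)) \<in> trig_polys (M - 1)"
proof -
  have eq: "of_real ((norm (\<Sum>j<M. cis (real j * t)))\<^sup>2)
      = (\<Sum>j<M. \<Sum>k<M. cis (of_int (int j - int k) * t))" for t
    unfolding complex_norm_square sum_product cnj_sum
    by (simp add: cis_cnj cis_mult algebra_simps)
  show ?thesis
    unfolding eq using assms by (intro trig_poly_sum trig_poly_cis) auto
qed

text \<open>Decay of order three in the scaled variable \<open>n * \<bar>t\<bar>\<close> leaves \<open>F powr p * (1 + n * \<bar>t\<bar>)\<close>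
  summable over a grid of mesh \<open>1 / n\<close> and gives it an integral of order \<open>1 / n\<close>.\<close>

definition localised_kernel :: "real \<Rightarrow> real \<Rightarrow> nat \<Rightarrow> (real \<Rightarrow> real) \<Rightarrow> bool" where
  "localised_kernel p C n F \<longleftrightarrow> (\<lambda>t. of_real (F t)) \<in> trig_polys n \<and> F 0 = 1 \<and>
     (\<forall>t. 0 \<le> F t \<and> F t \<le> 1) \<and>
     (\<forall>t. \<bar>t\<bar> \<le> pi \<longrightarrow> F t powr p * (1 + real n * \<bar>t\<bar>) \<le> C / (1 + real n * \<bar>t\<bar>)\<^sup>2)"

text \<open>The kernels are even powers of the modulus of a normalised Dirichlet sum; taking the power
  large in terms of \<open>1 / p\<close> yields any prescribed decay.\<close>

lemma trig_kernel:
  assumes "0 < (p::real)"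
  shows "\<exists>C>0. \<forall>n. \<exists>F. localised_kernel p C n F"
proof -
  (* The exponent 2 * m satisfies 2 * m * p >= 3. *)
  define m where "m = nat \<lceil>3 / (2 * p)\<rceil> + 1"
  have m: "m \<ge> 1" by (simp add: m_def)
  have "3 / (2 * p) \<le> real m" unfolding m_def by linarith
  then have mp: "3 \<le> real (2 * m) * p" using assms by (simp add: field_simps)
  define C where "C = (1 + real m * pi) powr (real (2 * m) * p)"
  have Cpos: "0 < C" unfolding C_def by (subst powr_gt_zero) (metis add_pos_nonneg less_irrefl mult_nonneg_nonneg of_nat_0_le_iff pi_ge_zero zero_less_one)
  have "\<exists>F. localised_kernel p C n F" for n
  proof -
    (* The m-th power of the squared sum has degree m * (M - 1) <= n, while m * M > n. *)
    define M where "M = n div m + 1"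
    have M: "M > 0" by (simp add: M_def)
    have Mn: "m * (M - 1) \<le> n" by (simp add: M_def)
    have nM: "real n \<le> real m * real M"
    proof -
      have "n < m * M" using m dividend_less_times_div[of m n] by (simp add: M_def algebra_simps)
      then show ?thesis by (metis of_nat_mult of_nat_le_iff less_imp_le)
    qed
    define D where "D t = norm (\<Sum>j<M. cis (real j * t)) / M" for t
    have D0: "0 \<le> D t" for t by (simp add: D_def)
    have D1: "D t \<le> 1" for t using dirichlet_sum_bounds(1)[OF M] by (simp add: D_def)
    define F where "F t = D t ^ (2 * m)" for t
    have eq: "of_real (F t) = (of_real (1 / real M) ^ (2 * m)) *
        (of_real ((norm (\<Sum>j<M. cis (real j * t)))\<^sup>2) :: complex) ^ m" for t
      by (simp add: F_def D_def power_divide power_mult)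
    have "(\<lambda>t. of_real (F t)) \<in> trig_polys (m * (M - 1))"
      unfolding eq by (intro trig_poly_cmult trig_poly_power dirichlet_square_trig_poly M)
    then have 1: "(\<lambda>t. of_real (F t)) \<in> trig_polys n"
      using Mn by (rule trig_poly_mono)
    have 2: "F 0 = 1" using M by (simp add: F_def D_def)
    have 3: "0 \<le> F t \<and> F t \<le> 1" for t using D0 D1 by (simp add: F_def power_le_one)
    have 4: "F t powr p * (1 + real n * \<bar>t\<bar>) \<le> C / (1 + real n * \<bar>t\<bar>)\<^sup>2" if t: "\<bar>t\<bar> \<le> pi" for t
    proof -
      define y where "y = 1 + real n * \<bar>t\<bar>"
      have y: "y \<ge> 1" by (simp add: y_def)
      have "D t * y = D t + real n * (\<bar>t\<bar> * D t)" by (simp add: y_def algebra_simps)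
      also have "\<dots> \<le> 1 + (real m * real M) * (pi / M)"
        using dirichlet_sum_bounds(2)[OF M t] D0[of t] nM
        by (intro add_mono D1 mult_mono) (auto simp: D_def)
      also have "\<dots> = 1 + real m * pi" using M by simp
      finally have Dy: "D t * y \<le> 1 + real m * pi" .
      have "F t powr p = D t powr (real (2 * m) * p)"
      proof -
        have "F t = D t powr real (2 * m)"
          unfolding F_def using D0[of t] m by (subst powr_realpow') auto
        then show ?thesis by (simp add: powr_powr)
      qed
      then have "F t powr p * y powr (real (2 * m) * p) = (D t * y) powr (real (2 * m) * p)"
        using D0 y by (simp add: powr_mult)
      also have "\<dots> \<le> C" unfolding C_def using Dy D0 y assms by (intro powr_mono2) auto
      finally have *: "F t powr p * y powr (real (2 * m) * p) \<le> C" .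
      have "F t powr p * y ^ 3 \<le> F t powr p * y powr (real (2 * m) * p)"
        using mp y powr_mono[of 3 "real (2 * m) * p" y] by (intro mult_left_mono) (auto simp flip: powr_numeral)
      then have "F t powr p * y * y\<^sup>2 \<le> C" using * by (simp add: power3_eq_cube power2_eq_square mult.assoc)
      moreover have "0 < y\<^sup>2" using y by simp
      ultimately show ?thesis unfolding y_def[symmetric] by (subst pos_le_divide_eq)
    qed
    show ?thesis using 1 2 3 4 unfolding localised_kernel_def by blast
  qed
  then show ?thesis using Cpos by blast
qed

text \<open>A real function has a critical point at its maximum. Thus multiplying by \<open>F\<close> does not
  change first derivatives at the origin.\<close>

lemma dv_kernel_zero:
  assumes F: "(\<lambda>t. of_real (F t)) \<in> trig_polys n" and "F 0 = 1" "\<And>t. F t \<le> (1::real)"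
  shows "dv (\<lambda>t. of_real (F t)) 0 = 0"
proof -
  define d where "d = dv (\<lambda>t. of_real (F t)) 0"
  have d: "((\<lambda>t. complex_of_real (F t)) has_vector_derivative d) (at 0)"
    unfolding d_def using F by (rule trig_poly_dv)
  have "((\<lambda>t. Re (of_real (F t))) has_vector_derivative Re d) (at 0)"
    by (rule bounded_linear.has_vector_derivative[OF bounded_linear_Re d])
  then have "(F has_real_derivative Re d) (at 0)"
    by (simp add: has_real_derivative_iff_has_vector_derivative)
  then have "Re d = 0"
    by (rule DERIV_local_max[where d = 1]) (use assms in auto)
  moreover have "((\<lambda>t. Im (of_real (F t))) has_vector_derivative Im d) (at 0)"
    by (rule bounded_linear.has_vector_derivative[OF bounded_linear_Im d])
  then have "Im d = 0"
    using has_vector_derivative_const[of 0 "at (0::real)"] vector_derivative_unique_at[of "\<lambda>_. 0" "Im d" 0 0]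
    by simp
  ultimately show ?thesis unfolding d_def by (simp add: complex_eq_iff)
qed

lemma sum_inverse_squares_centred:
  "(\<Sum>k<2 * d + 1. 1 / (1 + \<bar>real k - real d\<bar>)\<^sup>2) \<le> 2 * (\<Sum>i. 1 / (real i + 1)\<^sup>2)"
proof -
  define g where "g i = 1 / (real i + 1)\<^sup>2" for i :: nat
  have "summable g"
    using sums_summable[OF inverse_squares_sums] unfolding g_def by (simp add: add.commute)
  then have le: "(\<Sum>i\<in>I. g i) \<le> suminf g" if "finite I" for I
    using that \<open>summable g\<close> by (intro sum_le_suminf) (auto simp: g_def[abs_def])
  have "(\<Sum>k<2 * d + 1. 1 / (1 + \<bar>real k - real d\<bar>)\<^sup>2)
      = (\<Sum>k\<in>{..<d} \<union> {d..<2 * d + 1}. 1 / (1 + \<bar>real k - real d\<bar>)\<^sup>2)"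
    by (intro sum.cong) auto
  also have "\<dots> = (\<Sum>k<d. 1 / (1 + \<bar>real k - real d\<bar>)\<^sup>2)
      + (\<Sum>k = d..<2 * d + 1. 1 / (1 + \<bar>real k - real d\<bar>)\<^sup>2)"
    by (intro sum.union_disjoint) auto
  also have "(\<Sum>k<d. 1 / (1 + \<bar>real k - real d\<bar>)\<^sup>2) = (\<Sum>i\<in>(\<lambda>k. d - k) ` {..<d}. g i)"
    by (subst sum.reindex) (auto simp: inj_on_def g_def abs_if of_nat_diff algebra_simps intro!: sum.cong)
  also have "(\<Sum>k = d..<2 * d + 1. 1 / (1 + \<bar>real k - real d\<bar>)\<^sup>2) = (\<Sum>i\<in>(\<lambda>k. k - d) ` {d..<2 * d + 1}. g i)"
    by (subst sum.reindex) (auto simp: inj_on_def g_def abs_if of_nat_diff algebra_simps intro!: sum.cong)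
  finally show ?thesis
    using le[of "(\<lambda>k. d - k) ` {..<d}"] le[of "(\<lambda>k. k - d) ` {d..<2 * d + 1}"] unfolding g_def by simp
qed

text \<open>The moment with weight \<open>1 + n * \<bar>\<theta> k\<bar>\<close> is kept because the rule will also be applied to
  increments of functions, which grow linearly with the step.\<close>

definition derivative_rule :: "real \<Rightarrow> real \<Rightarrow> nat \<Rightarrow> nat \<Rightarrow> (nat \<Rightarrow> complex) \<Rightarrow> (nat \<Rightarrow> real) \<Rightarrow> bool" where
  "derivative_rule p C n N a \<theta> \<longleftrightarrow>
     (\<forall>T\<in>trig_polys n. \<forall>x. dv T x = (\<Sum>k<N. a k * T (x + \<theta> k))) \<and>
     (\<Sum>k<N. norm (a k) powr p * (1 + real n * \<bar>\<theta> k\<bar>)) \<le> C * real n powr p"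

text \<open>The derivative of \<open>T\<close> at \<open>x\<close> equals that of \<open>t \<mapsto> T (x + t) * F t\<close> at \<open>0\<close> for a localised
  kernel \<open>F\<close>. The quadrature rule for the latter has weights of size \<open>n\<close> times the values of \<open>F\<close> at
  the nodes, and so their \<open>p\<close>-th powers are summable however small \<open>p\<close> is. Without the kernel (as in
  the interpolation formula of M. Riesz) the decay would be quadratic, which yields Bernstein's
  inequality only for \<open>p > 1/2\<close>.\<close>

lemma bernstein_weights:
  assumes "0 < (p::real)"
  shows "\<exists>C>0. \<forall>n\<ge>1. \<exists>N a \<theta>. derivative_rule p C n N a \<theta>"
proof -
  obtain C where C: "0 < C" and ker: "\<forall>n. \<exists>F. localised_kernel p C n F"
    using trig_kernel[OF assms] by blast
  define Z where "Z = (\<Sum>i. 1 / (real i + 1)\<^sup>2)"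
  have Z: "0 \<le> Z" unfolding Z_def
    using sums_summable[OF inverse_squares_sums] by (intro suminf_nonneg) (auto simp: add.commute)
  have main: "\<exists>N a \<theta>. derivative_rule p (2 powr p * C * 2 * Z + 1) n N a \<theta>"
    if n: "1 \<le> n" for n
  proof -
    obtain F :: "real \<Rightarrow> real" where F: "(\<lambda>t. complex_of_real (F t)) \<in> trig_polys n" "F 0 = 1"
      "\<And>t. 0 \<le> F t" "\<And>t. F t \<le> 1"
      "\<And>t. \<bar>t\<bar> \<le> pi \<Longrightarrow> F t powr p * (1 + real n * \<bar>t\<bar>) \<le> C / (1 + real n * \<bar>t\<bar>)\<^sup>2"
      using ker unfolding localised_kernel_def by blast
    (* T and F contribute degree n each. *)
    define d where "d = 2 * n"
    define L where "L = 2 * d + 1"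
    define \<theta> where "\<theta> k = 2 * pi * (real k - real d) / real L" for k :: nat
    define q where "q k = (\<Sum>j = - int d..int d. \<i> * of_int j * cis (- of_int j * \<theta> k)) / of_nat L" for k
    define a where "a k = q k * of_real (F (\<theta> k))" for k
    have rep: "dv T x = (\<Sum>k<L. a k * T (x + \<theta> k))" if T: "T \<in> trig_polys n" for T x
    proof -
      define Tx where "Tx = (\<lambda>t. T (t + x))"
      have Tx: "Tx \<in> trig_polys n" unfolding Tx_def using T by (rule trig_poly_shift)
      define S where "S = (\<lambda>t. of_real (F t) * Tx t)"
      have S: "S \<in> trig_polys d"
        unfolding S_def d_def mult_2 by (rule trig_poly_mult[OF F(1) Tx])
      have dx: "(Tx has_vector_derivative dv T x) (at 0)"
      proof -
        have "((\<lambda>t. t + x) has_vector_derivative 1) (at 0)"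
          by (auto simp: has_vector_derivative_def intro!: derivative_eq_intros)
        then show ?thesis
          using vector_diff_chain_at[of "\<lambda>t. t + x" 1 0 T "dv T x"] trig_poly_dv(2)[OF T, of x]
          by (simp add: o_def Tx_def)
      qed
      have "(S has_vector_derivative of_real (F 0) * dv T x + dv (\<lambda>t. of_real (F t)) 0 * Tx 0) (at 0)"
        unfolding S_def by (intro has_vector_derivative_mult dx trig_poly_dv(2)[OF F(1)])
      then have "dv S 0 = dv T x"
        unfolding dv_kernel_zero[OF F(1,2,4)] F(2) dv_def[of S] by (simp add: vector_derivative_at)
      moreover have "dv S 0 = (\<Sum>k<L. q k * S (\<theta> k))"
        using trig_poly_derivative_quadrature[OF S] unfolding q_def \<theta>_def L_def by simp
      ultimately show ?thesis by (simp add: S_def a_def Tx_def mult_ac add.commute)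
    qed
    have q: "norm (q k) \<le> 2 * real n" for k
    proof -
      have "norm (\<Sum>j = - int d..int d. \<i> * of_int j * cis (- of_int j * \<theta> k))
         \<le> (\<Sum>j = - int d..int d. real d)"
        by (intro sum_norm_le) (auto simp: norm_mult abs_le_iff)
      also have "\<dots> = real d * real L" by (simp add: L_def)
      finally have "norm (\<Sum>j = - int d..int d. \<i> * of_int j * cis (- of_int j * \<theta> k)) \<le> real d * real L" .
      moreover have "0 < real L" by (simp add: L_def)
      ultimately have "norm (q k) \<le> real d"
        unfolding q_def norm_divide norm_of_nat by (subst pos_divide_le_eq)
      then show ?thesis by (simp add: d_def)
    qed
    have weight: "norm (a k) powr p * (1 + real n * \<bar>\<theta> k\<bar>)
        \<le> (2 * real n) powr p * C * (1 / (1 + \<bar>real k - real d\<bar>)\<^sup>2)" if k: "k < L" for k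
    proof -
      have kd: "\<bar>real k - real d\<bar> \<le> real d" using k by (simp add: L_def abs_if)
      have "2 * \<bar>real k - real d\<bar> \<le> real L" using kd by (simp add: L_def)
      then have "\<bar>\<theta> k\<bar> \<le> pi"
        by (simp add: \<theta>_def abs_mult abs_divide divide_le_eq L_def mult_left_mono)
      then have 1: "F (\<theta> k) powr p * (1 + real n * \<bar>\<theta> k\<bar>) \<le> C / (1 + real n * \<bar>\<theta> k\<bar>)\<^sup>2"
        by (rule F(5))
      have "real n * 6 \<le> real n * (2 * pi)"
        using pi_gt3 by (intro mult_left_mono) auto
      moreover have "real L \<le> real n * 6" using n by (simp add: L_def d_def)
      ultimately have "real L \<le> real n * (2 * pi)" by linarith
      then have "\<bar>real k - real d\<bar> * real L \<le> \<bar>real k - real d\<bar> * (real n * (2 * pi))"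
        by (rule mult_left_mono) simp
      moreover have "\<bar>\<theta> k\<bar> = 2 * pi * \<bar>real k - real d\<bar> / real L"
        unfolding \<theta>_def abs_divide abs_mult by simp
      moreover have "0 < real L" by (simp add: L_def)
      ultimately have "\<bar>real k - real d\<bar> \<le> real n * \<bar>\<theta> k\<bar>"
        by (simp add: pos_le_divide_eq mult_ac)
      then have "C / (1 + real n * \<bar>\<theta> k\<bar>)\<^sup>2 \<le> C / (1 + \<bar>real k - real d\<bar>)\<^sup>2"
        using C by (intro divide_left_mono power_mono) auto
      with 1 have 2: "F (\<theta> k) powr p * (1 + real n * \<bar>\<theta> k\<bar>) \<le> C * (1 / (1 + \<bar>real k - real d\<bar>)\<^sup>2)"
        by simp
      have "norm (a k) powr p * (1 + real n * \<bar>\<theta> k\<bar>)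
          = norm (q k) powr p * (F (\<theta> k) powr p * (1 + real n * \<bar>\<theta> k\<bar>))"
        using F(3) by (simp add: a_def norm_mult powr_mult)
      also have "\<dots> \<le> (2 * real n) powr p * (C * (1 / (1 + \<bar>real k - real d\<bar>)\<^sup>2))"
        using q[of k] assms F(3) by (intro mult_mono 2 powr_mono2) auto
      finally show ?thesis by (simp add: mult_ac)
    qed
    have "(\<Sum>k<L. norm (a k) powr p * (1 + real n * \<bar>\<theta> k\<bar>))
        \<le> (\<Sum>k<L. (2 * real n) powr p * C * (1 / (1 + \<bar>real k - real d\<bar>)\<^sup>2))"
      by (intro sum_mono weight) auto
    also have "\<dots> = (2 * real n) powr p * C * (\<Sum>k<L. 1 / (1 + \<bar>real k - real d\<bar>)\<^sup>2)"
      by (simp add: sum_distrib_left)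
    also have "\<dots> \<le> (2 * real n) powr p * C * (2 * Z)"
      using sum_inverse_squares_centred[of d] C unfolding L_def Z_def by (intro mult_left_mono) auto
    also have "\<dots> \<le> (2 powr p * C * 2 * Z + 1) * real n powr p"
      by (simp add: powr_mult algebra_simps)
    finally show ?thesis using rep unfolding derivative_rule_def by blast
  qed
  show ?thesis
    by (rule exI[of _ "2 powr p * C * 2 * Z + 1"])
      (use C Z main in \<open>auto intro!: add_nonneg_pos mult_nonneg_nonneg\<close>)
qed

text \<open>Bernstein's inequality: a derivative is a combination of shifts, and shifts preserve
  integrals over a period.\<close>

lemma bernstein:
  assumes "0 < p" "p \<le> 1"
  shows "\<exists>C>0. \<forall>n\<ge>1. \<forall>T\<in>trig_polys n. pint p (dv T) \<le> ennreal (C * real n powr p) * pint p T"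
proof -
  obtain C where C: "0 < C" and wts: "\<forall>n\<ge>1. \<exists>N a \<theta>. derivative_rule p C n N a \<theta>"
    using bernstein_weights[OF assms(1)] by blast
  show ?thesis
  proof (intro exI[of _ C] conjI C allI ballI impI)
    fix n :: nat and T assume n: "1 \<le> n" and T: "T \<in> trig_polys n"
    obtain N :: nat and a :: "nat \<Rightarrow> complex" and \<theta> where
      rep: "\<forall>T\<in>trig_polys n. \<forall>x. dv T x = (\<Sum>k<N. a k * T (x + \<theta> k))"
      and sum: "(\<Sum>k<N. norm (a k) powr p * (1 + real n * \<bar>\<theta> k\<bar>)) \<le> C * real n powr p"
      using wts n unfolding derivative_rule_def by blast
    have meas: "(\<lambda>x. T (x + b)) \<in> borel_measurable borel" for b
      by (rule trig_poly_measurable[OF trig_poly_shift[OF T]])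
    have "dv T = (\<lambda>x. \<Sum>k<N. a k * T (x + \<theta> k))"
      using rep T by (intro ext) blast
    then have "pint p (dv T) = pint p (\<lambda>x. \<Sum>k<N. a k * T (x + \<theta> k))" by metis
    also have "\<dots> \<le> (\<Sum>k<N. pint p (\<lambda>x. a k * T (x + \<theta> k)))"
      using assms meas by (intro pint_sum_le) auto
    also have "\<dots> = (\<Sum>k<N. ennreal (norm (a k) powr p) * pint p T)"
      using pint_shift[OF trig_poly_measurable[OF T] trig_poly_periodic[OF T]] meas
      by (intro sum.cong refl) (simp add: pint_cmult)
    also have "\<dots> = ennreal (\<Sum>k<N. norm (a k) powr p) * pint p T"
      by (simp add: sum_distrib_right[symmetric] sum_ennreal)
    also have "(\<Sum>k<N. norm (a k) powr p) \<le> (\<Sum>k<N. norm (a k) powr p * (1 + real n * \<bar>\<theta> k\<bar>))"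
      by (intro sum_mono mult_le_cancel_left1[THEN iffD2]) auto
    then have "ennreal (\<Sum>k<N. norm (a k) powr p) * pint p T \<le> ennreal (C * real n powr p) * pint p T"
      using sum by (intro mult_right_mono ennreal_leI) auto
    finally show "pint p (dv T) \<le> ennreal (C * real n powr p) * pint p T" .
  qed
qed

lemma bernstein_iter:
  assumes "0 < p" "p \<le> 1"
  shows "\<exists>C>0. \<forall>n\<ge>1. \<forall>T\<in>trig_polys n. \<forall>k.
      pint p ((dv ^^ k) T) \<le> ennreal ((C * real n powr p) ^ k) * pint p T"
proof -
  obtain C where C: "0 < C" and B:
    "\<forall>n\<ge>1. \<forall>T\<in>trig_polys n. pint p (dv T) \<le> ennreal (C * real n powr p) * pint p T"
    using bernstein[OF assms] by blast
  have "pint p ((dv ^^ k) T) \<le> ennreal ((C * real n powr p) ^ k) * pint p T"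
    if n: "1 \<le> n" and T: "T \<in> trig_polys n" for n T k
  proof (induction k)
    case (Suc k)
    have "pint p ((dv ^^ Suc k) T) \<le> ennreal (C * real n powr p) * pint p ((dv ^^ k) T)"
      using B n trig_poly_dv_iter[OF T] by simp
    also have "\<dots> \<le> ennreal (C * real n powr p) * (ennreal ((C * real n powr p) ^ k) * pint p T)"
      by (intro mult_left_mono Suc) auto
    finally show ?case using C by (simp add: ennreal_mult' mult.assoc)
  qed simp
  then show ?thesis using C by blast
qed

section \<open>Primitives and an amalgam of \<open>L\<^sub>1\<close> and \<open>L\<^sub>p\<close>\<close>

definition L1per :: "(real \<Rightarrow> complex) \<Rightarrow> bool" where
  "L1per w \<longleftrightarrow> w \<in> borel_measurable borel \<and> periodic w \<and> (\<forall>a b. set_integrable lborel {a..b} w)"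

lemma L1perD:
  assumes "L1per w"
  shows "w \<in> borel_measurable borel" "periodic w" "set_integrable lborel {a..b} w"
    "set_integrable lborel {a..b} (\<lambda>s. norm (w s))"
  using assms unfolding L1per_def by (auto intro: set_integrable_norm)

lemma L1per_add: "L1per v \<Longrightarrow> L1per w \<Longrightarrow> L1per (\<lambda>x. v x + w x)"
  unfolding L1per_def periodic_def by auto

lemma L1per_diff: "L1per v \<Longrightarrow> L1per w \<Longrightarrow> L1per (\<lambda>x. v x - w x)"
  unfolding L1per_def periodic_def by auto

lemma L1per_continuous:
  assumes "continuous_on UNIV w" "periodic w"
  shows "L1per w"
  unfolding L1per_def using assms
  by (auto intro: borel_measurable_continuous_onI borel_integrable_atLeastAtMost' continuous_on_subset)

lemma L1per_trig: "T \<in> trig_polys n \<Longrightarrow> L1per T"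
  by (intro L1per_continuous trig_poly_continuous trig_poly_periodic)

definition absint :: "(real \<Rightarrow> complex) \<Rightarrow> real \<Rightarrow> real \<Rightarrow> real" where
  "absint w a b = (LINT s:{a..b}|lborel. norm (w s))"

lemma absint_nonneg: "0 \<le> absint w a b"
  unfolding absint_def set_lebesgue_integral_def by (intro integral_nonneg_AE) auto

lemma absint_subset:
  assumes "L1per w" "a' \<le> a" "b \<le> b'"
  shows "absint w a b \<le> absint w a' b'"
  unfolding absint_def set_lebesgue_integral_def
  using L1perD(4)[OF assms(1)] assms(2,3)
  by (intro integral_mono) (auto simp: set_integrable_def indicator_def)

lemma LINT_split:
  fixes f :: "real \<Rightarrow> 'a :: {banach, second_countable_topology}"
  assumes "\<And>a b. set_integrable lborel {a..b} f" "a \<le> b" "b \<le> c"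
  shows "(LINT s:{a..c}|lborel. f s) = (LINT s:{a..b}|lborel. f s) + (LINT s:{b..c}|lborel. f s)"
proof -
  have "{a..c} = {a..b} \<union> {b..c}" using assms by auto
  moreover have "AE x in lborel. \<not> (x \<in> {a..b} \<and> x \<in> {b..c})"
    using AE_lborel_singleton[of b] by eventually_elim auto
  ultimately show ?thesis
    using set_integral_Un_AE[of "{a..b}" "{b..c}" lborel f] assms by simp
qed

lemma absint_split: "L1per w \<Longrightarrow> a \<le> b \<Longrightarrow> b \<le> c \<Longrightarrow> absint w a c = absint w a b + absint w b c"
  unfolding absint_def by (rule LINT_split) (auto intro: L1perD)

lemma absint_pieces:
  assumes "L1per w" "0 \<le> h"
  shows "absint w x (x + real k * h) = (\<Sum>i<k. absint w (x + real i * h) (x + real i * h + h))"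
proof (induction k)
  case 0
  show ?case using absint_split[OF assms(1), of x x x] by simp
next
  case (Suc k)
  have "absint w x (x + real (Suc k) * h) = absint w x (x + real k * h) + absint w (x + real k * h) (x + real (Suc k) * h)"
    using assms by (intro absint_split) (auto simp: mult_right_mono)
  then show ?case using Suc by (simp add: algebra_simps)
qed

lemma absint_add_le:
  assumes "L1per v" "L1per w"
  shows "absint (\<lambda>s. v s + w s) a b \<le> absint v a b + absint w a b"
proof -
  have "absint (\<lambda>s. v s + w s) a b \<le> (LINT s:{a..b}|lborel. norm (v s) + norm (w s))"
    unfolding absint_def using L1perD[OF L1per_add[OF assms]] L1perD[OF assms(1)] L1perD[OF assms(2)]
    by (intro set_integral_mono norm_triangle_ineq set_integral_add) auto
  also have "\<dots> = absint v a b + absint w a b"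
    unfolding absint_def using L1perD[OF assms(1)] L1perD[OF assms(2)] by (intro set_integral_add) auto
  finally show ?thesis .
qed

lemma absint_cmult: "absint (\<lambda>s. c * w s) a b = norm c * absint w a b"
  unfolding absint_def by (simp add: norm_mult)

lemma absint_measurable [measurable]:
  assumes "L1per w" and [measurable]: "f \<in> borel_measurable borel" "g \<in> borel_measurable borel"
  shows "(\<lambda>x. absint w (f x) (g x)) \<in> borel_measurable borel"
proof -
  have [measurable]: "w \<in> borel_measurable borel" by (rule L1perD[OF assms(1)])
  have "absint w (f x) (g x) = (LINT s|lborel. (if f x \<le> s \<and> s \<le> g x then norm (w s) else 0))" for x
    unfolding absint_def set_lebesgue_integral_def by (intro Bochner_Integration.integral_cong) auto
  then show ?thesis by simp
qed

lemma ennreal_absint: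
  assumes "L1per w"
  shows "ennreal (absint w a b) = (\<integral>\<^sup>+s\<in>{a..b}. ennreal (norm (w s)) \<partial>lborel)"
proof -
  have "ennreal (absint w a b) = (\<integral>\<^sup>+s. ennreal (indicator {a..b} s * norm (w s)) \<partial>lborel)"
    unfolding absint_def set_lebesgue_integral_def real_scaleR_def
    using L1perD(4)[OF assms, of a b]
    by (intro nn_integral_eq_integral[symmetric]) (auto simp: set_integrable_def)
  also have "\<dots> = (\<integral>\<^sup>+s\<in>{a..b}. ennreal (norm (w s)) \<partial>lborel)"
    by (intro nn_integral_cong) (auto simp: indicator_def)
  finally show ?thesis .
qed

lemma absint_shift:
  assumes "L1per w"
  shows "absint w (a + 2 * pi) (b + 2 * pi) = absint w a b"
proof -
  have [measurable]: "w \<in> borel_measurable borel" by (rule L1perD[OF assms(1)])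
  have "ennreal (absint w (a + 2 * pi) (b + 2 * pi))
      = (\<integral>\<^sup>+s. (\<lambda>t. ennreal (norm (w t)) * indicator {a + 2 * pi..b + 2 * pi} t) (s + 2 * pi) \<partial>lborel)"
    unfolding ennreal_absint[OF assms] by (rule nn_integral_shift[symmetric]) measurable
  also have "\<dots> = ennreal (absint w a b)"
    unfolding ennreal_absint[OF assms] using L1perD(2)[OF assms]
    by (intro nn_integral_cong) (auto simp: indicator_def periodicD)
  finally show ?thesis by (simp add: absint_nonneg)
qed

lemma absint_period:
  assumes "L1per w"
  shows "absint w x (x + 2 * pi) = absint w 0 (2 * pi)"
proof -
  have [measurable]: "w \<in> borel_measurable borel" by (rule L1perD[OF assms(1)])
  have per: "periodic (\<lambda>s. ennreal (norm (w s)))"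
    using L1perD(2)[OF assms] by (simp add: periodic_def)
  have "ennreal (absint w x (x + 2 * pi))
      = (\<integral>\<^sup>+s. (\<lambda>t. ennreal (norm (w t)) * indicator {x..x + 2 * pi} t) (s + x) \<partial>lborel)"
    unfolding ennreal_absint[OF assms] by (rule nn_integral_shift[symmetric]) measurable
  also have "\<dots> = (\<integral>\<^sup>+s\<in>{0..<2*pi}. ennreal (norm (w (s + x))) \<partial>lborel)"
    by (intro nn_integral_cong_AE, use AE_lborel_singleton[of "2 * pi"] in eventually_elim)
      (auto simp: indicator_def)
  also have "\<dots> = (\<integral>\<^sup>+s\<in>{0..<2*pi}. ennreal (norm (w s)) \<partial>lborel)"
    by (rule nn_integral_period_shift[OF _ per]) measurable
  also have "\<dots> = ennreal (absint w 0 (2 * pi))"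
    unfolding ennreal_absint[OF assms]
    by (intro nn_integral_cong_AE, use AE_lborel_singleton[of "2 * pi"] in eventually_elim)
      (auto simp: indicator_def)
  finally show ?thesis by (simp add: absint_nonneg)
qed

text \<open>The \<open>p\<close>-th power of an amalgam quasi-norm, locally \<open>L\<^sub>1\<close> with windows of length \<open>h\<close> and globally
  \<open>L\<^sub>p\<close>. Moving windows instead of a fixed partition make it invariant under shifts.\<close>

definition amalgam :: "real \<Rightarrow> real \<Rightarrow> (real \<Rightarrow> complex) \<Rightarrow> ennreal" where
  "amalgam p h w = circ_int (\<lambda>x. absint w x (x + h) powr p)"

abbreviation adist :: "real \<Rightarrow> nat \<Rightarrow> (real \<Rightarrow> complex) \<Rightarrow> (real \<Rightarrow> complex) \<Rightarrow> ennreal" where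
  "adist p n v w \<equiv> amalgam p (1 / real n) (\<lambda>x. v x - w x)"

lemma periodic_absint_powr:
  assumes "L1per w"
  shows "periodic (\<lambda>x. absint w x (x + h) powr p)"
proof -
  have "absint w (x + 2 * pi) (x + 2 * pi + h) = absint w x (x + h)" for x
    using absint_shift[OF assms, of x "x + h"] by (simp add: add_ac)
  then show ?thesis by (simp add: periodic_def)
qed

lemma amalgam_add_le:
  assumes "0 < p" "p \<le> 1" "L1per v" "L1per w"
  shows "amalgam p h (\<lambda>x. v x + w x) \<le> amalgam p h v + amalgam p h w"
proof -
  have "amalgam p h (\<lambda>x. v x + w x) \<le> circ_int (\<lambda>x. absint v x (x + h) powr p + absint w x (x + h) powr p)"
    unfolding amalgam_def
  proof (intro circ_int_mono)
    fix x
    have "absint (\<lambda>x. v x + w x) x (x + h) powr p \<le> (absint v x (x + h) + absint w x (x + h)) powr p"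
      using assms by (intro powr_mono2 absint_add_le absint_nonneg) auto
    also have "\<dots> \<le> absint v x (x + h) powr p + absint w x (x + h) powr p"
      using assms by (intro powr_add_le absint_nonneg) auto
    finally show "absint (\<lambda>x. v x + w x) x (x + h) powr p \<le> absint v x (x + h) powr p + absint w x (x + h) powr p" .
  qed
  also have "\<dots> = amalgam p h v + amalgam p h w"
    unfolding amalgam_def using assms by (intro circ_int_add) auto
  finally show ?thesis .
qed

lemma amalgam_cmult:
  assumes "L1per w"
  shows "amalgam p h (\<lambda>x. c * w x) = ennreal (norm c powr p) * amalgam p h w"
  unfolding amalgam_def absint_cmult using assms by (simp add: powr_mult absint_nonneg circ_int_cmult)

lemma amalgam_commute: "amalgam p h (\<lambda>x. v x - w x) = amalgam p h (\<lambda>x. w x - v x)"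
  by (simp add: amalgam_def absint_def norm_minus_commute)

lemma amalgam_diff_le:
  assumes "0 < p" "p \<le> 1" "L1per u" "L1per v" "L1per w"
  shows "amalgam p h (\<lambda>x. u x - w x) \<le> amalgam p h (\<lambda>x. u x - v x) + amalgam p h (\<lambda>x. v x - w x)"
  using amalgam_add_le[of p "\<lambda>x. u x - v x" "\<lambda>x. v x - w x"] assms by (simp add: L1per_diff)

lemma amalgam_mono:
  assumes "0 < p" "L1per w" "h \<le> h'"
  shows "amalgam p h w \<le> amalgam p h' w"
  unfolding amalgam_def using assms by (intro circ_int_mono powr_mono2 absint_subset absint_nonneg) auto

text \<open>Cut each window into \<open>k\<close> windows of length \<open>h\<close>, use subadditivity of \<open>p\<close>-th powers and
  shift invariance.\<close>

lemma amalgam_multiple: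
  assumes "0 < p" "p \<le> 1" "L1per w" "0 \<le> h"
  shows "amalgam p (real k * h) w \<le> ennreal (real k) * amalgam p h w"
proof -
  have "amalgam p (real k * h) w \<le> circ_int (\<lambda>x. \<Sum>i<k. absint w (x + real i * h) (x + real i * h + h) powr p)"
    unfolding amalgam_def absint_pieces[OF assms(3,4)]
    using assms by (intro circ_int_mono powr_sum_le) (auto simp: absint_nonneg)
  also have "\<dots> = (\<Sum>i<k. circ_int (\<lambda>x. absint w (x + real i * h) (x + real i * h + h) powr p))"
    using assms by (intro circ_int_sum) auto
  also have "\<dots> = (\<Sum>i<k. amalgam p h w)"
    unfolding amalgam_def
    using circ_int_shift[OF _ periodic_absint_powr[OF assms(3)], of h p] assms(3)
    by (intro sum.cong refl) auto
  finally show ?thesis by (simp add: ennreal_of_nat_eq_real_of_nat)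
qed

text \<open>A period is covered by \<open>8 * n\<close> windows of length \<open>1 / n\<close>, as \<open>2 * pi \<le> 8\<close>.\<close>

lemma absint_period_le_amalgam:
  assumes "0 < p" "p \<le> 1" "L1per w" "1 \<le> n"
  shows "ennreal (absint w 0 (2 * pi) powr p) \<le> ennreal (8 * real n) * amalgam p (1 / real n) w"
proof -
  have "1 * absint w 0 (2 * pi) powr p \<le> 2 * pi * absint w 0 (2 * pi) powr p"
    using pi_gt3 by (intro mult_right_mono) auto
  then have "ennreal (absint w 0 (2 * pi) powr p) \<le> ennreal (2 * pi * absint w 0 (2 * pi) powr p)"
    by (intro ennreal_leI) simp
  also have "\<dots> = amalgam p (2 * pi) w"
    unfolding amalgam_def absint_period[OF assms(3)] by (simp add: circ_int_const)
  also have "\<dots> \<le> amalgam p (real (8 * n) * (1 / real n)) w"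
    using assms pi_less_4 by (intro amalgam_mono) auto
  also have "\<dots> \<le> ennreal (real (8 * n)) * amalgam p (1 / real n) w"
    using assms by (intro amalgam_multiple) auto
  finally show ?thesis by simp
qed

lemma amalgam_le_absint_period:
  assumes "0 < p" "L1per w" "h \<le> 2 * pi"
  shows "amalgam p h w \<le> ennreal (2 * pi * absint w 0 (2 * pi) powr p)"
proof -
  have "amalgam p h w \<le> amalgam p (2 * pi) w" using assms by (rule amalgam_mono)
  then show ?thesis unfolding amalgam_def absint_period[OF assms(2)] by (simp add: circ_int_const)
qed

definition primitive :: "(real \<Rightarrow> complex) \<Rightarrow> (real \<Rightarrow> complex) \<Rightarrow> bool" where
  "primitive H h \<longleftrightarrow> L1per h \<and> periodic H \<and> (\<forall>a b. a \<le> b \<longrightarrow> H b - H a = (LINT s:{a..b}|lborel. h s))"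

lemma primitive_norm_le:
  assumes "primitive H h" "a \<le> b"
  shows "norm (H b - H a) \<le> absint h a b"
proof -
  have "H b - H a = (LINT s:{a..b}|lborel. h s)" using assms by (auto simp: primitive_def)
  also have "norm \<dots> \<le> absint h a b"
    unfolding absint_def using assms by (intro set_integral_norm_bound L1perD) (auto simp: primitive_def)
  finally show ?thesis .
qed

lemma primitive_measurable:
  assumes "primitive H h"
  shows "H \<in> borel_measurable borel"
proof -
  have [measurable]: "h \<in> borel_measurable borel" using assms L1perD by (auto simp: primitive_def)
  have eq: "(LINT s:{a..b}|lborel. h s) = (LINT s|lborel. (if a \<le> s \<and> s \<le> b then h s else 0))"
    for a b :: real
    unfolding set_lebesgue_integral_def by (intro Bochner_Integration.integral_cong) auto
  have "H x = (if 0 \<le> x then H 0 + (LINT s|lborel. (if 0 \<le> s \<and> s \<le> x then h s else 0))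
      else H 0 - (LINT s|lborel. (if x \<le> s \<and> s \<le> 0 then h s else 0)))" for x
  proof (cases "0 \<le> x")
    case True
    then have e: "H x - H 0 = (LINT s:{0..x}|lborel. h s)" using assms by (auto simp: primitive_def)
    have "H x = H 0 + (H x - H 0)" by simp
    then show ?thesis using True unfolding e eq by simp
  next
    case False
    then have e: "H 0 - H x = (LINT s:{x..0}|lborel. h s)" using assms by (auto simp: primitive_def)
    have "H x = H 0 - (H 0 - H x)" by simp
    then show ?thesis using False unfolding e eq by simp
  qed
  then have *: "H = (\<lambda>x. if 0 \<le> x then H 0 + (LINT s|lborel. (if 0 \<le> s \<and> s \<le> x then h s else 0))
      else H 0 - (LINT s|lborel. (if x \<le> s \<and> s \<le> 0 then h s else 0)))"
    by (rule ext)
  show ?thesis by (subst *) measurable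
qed

lemma primitive_L1per:
  assumes "primitive H h"
  shows "L1per H"
  unfolding L1per_def
proof (intro conjI allI)
  show [measurable]: "H \<in> borel_measurable borel" by (rule primitive_measurable[OF assms])
  show "periodic H" using assms by (simp add: primitive_def)
  fix a b
  have "norm (H s) \<le> norm (H a) + absint h a b" if "s \<in> {a..b}" for s
  proof -
    have "norm (H s - H a) \<le> absint h a s" using that by (intro primitive_norm_le[OF assms]) auto
    also have "\<dots> \<le> absint h a b" using assms that by (intro absint_subset) (auto simp: primitive_def)
    finally show ?thesis using norm_triangle_ineq2[of "H s" "H a"] by linarith
  qed
  then show "set_integrable lborel {a..b} H"
    unfolding set_integrable_def
    by (intro integrableI_bounded_set_indicator[where B = "norm (H a) + absint h a b"])
      (auto simp: emeasure_lborel_Icc_eq)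
qed

lemma primitive_diff:
  assumes "primitive H h" "primitive G g"
  shows "primitive (\<lambda>x. H x - G x) (\<lambda>x. h x - g x)"
  unfolding primitive_def
proof (intro conjI allI impI)
  show "L1per (\<lambda>x. h x - g x)" using assms by (simp add: primitive_def L1per_diff)
  show "periodic (\<lambda>x. H x - G x)" using assms by (simp add: primitive_def periodic_def)
  fix a b :: real assume ab: "a \<le> b"
  have "(LINT s:{a..b}|lborel. h s - g s) = (LINT s:{a..b}|lborel. h s) - (LINT s:{a..b}|lborel. g s)"
    using assms by (intro set_integral_diff) (auto simp: primitive_def intro: L1perD)
  also have "\<dots> = (H b - H a) - (G b - G a)" using assms ab by (auto simp: primitive_def)
  finally show "H b - G b - (H a - G a) = (LINT s:{a..b}|lborel. h s - g s)" by simp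
qed

lemma primitive_derivative:
  assumes "periodic H" "\<And>x. (H has_vector_derivative h x) (at x)" "L1per h"
  shows "primitive H h"
  unfolding primitive_def
proof (intro conjI allI impI assms)
  fix a b :: real assume ab: "a \<le> b"
  have "(h has_integral (H b - H a)) {a..b}"
    using assms(2) ab by (intro fundamental_theorem_of_calculus) (auto intro: has_vector_derivative_at_within)
  then show "H b - H a = (LINT s:{a..b}|lborel. h s)"
    using set_borel_integral_eq_integral(2)[OF L1perD(3)[OF assms(3), of a b]] by (simp add: integral_unique)
qed

lemma primitive_trig: "T \<in> trig_polys n \<Longrightarrow> primitive T (dv T)"
  by (intro primitive_derivative trig_poly_dv(2) trig_poly_periodic L1per_trig[OF trig_poly_dv(1)])

text \<open>On a window starting at \<open>x\<close> the function \<open>H\<close> differs from \<open>H x\<close> by at most the integral of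
  \<open>\<bar>h\<bar>\<close> over the window.\<close>

lemma amalgam_primitive_le:
  assumes "0 < p" "p \<le> 1" "primitive H h" "0 < d"
  shows "amalgam p d H \<le> ennreal (d powr p) * (pint p H + amalgam p d h)"
proof -
  have L: "L1per H" "L1per h" using assms primitive_L1per by (auto simp: primitive_def)
  have [measurable]: "H \<in> borel_measurable borel" by (rule L1perD[OF L(1)])
  have "amalgam p d H \<le> circ_int (\<lambda>x. d powr p * (norm (H x) powr p + absint h x (x + d) powr p))"
    unfolding amalgam_def
  proof (intro circ_int_mono)
    fix x
    have "norm (H s) \<le> norm (H x) + absint h x (x + d)" if "s \<in> {x..x + d}" for s
    proof -
      have "norm (H s - H x) \<le> absint h x s" using that by (intro primitive_norm_le[OF assms(3)]) auto
      also have "\<dots> \<le> absint h x (x + d)" using that by (intro absint_subset L) auto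
      finally show ?thesis using norm_triangle_ineq2[of "H s" "H x"] by linarith
    qed
    then have "absint H x (x + d) \<le> (LINT s:{x..x + d}|lborel. norm (H x) + absint h x (x + d))"
      unfolding absint_def[of H] by (intro set_integral_mono L1perD[OF L(1)] borel_integrable_atLeastAtMost' continuous_intros) auto
    also have "\<dots> = d * (norm (H x) + absint h x (x + d))"
      using assms by (simp add: set_lebesgue_integral_def)
    finally have "absint H x (x + d) powr p \<le> (d * (norm (H x) + absint h x (x + d))) powr p"
      using assms by (intro powr_mono2 absint_nonneg) auto
    also have "\<dots> = d powr p * (norm (H x) + absint h x (x + d)) powr p"
      using assms by (simp add: powr_mult absint_nonneg)
    also have "\<dots> \<le> d powr p * (norm (H x) powr p + absint h x (x + d) powr p)"
      using assms by (intro mult_left_mono powr_add_le absint_nonneg) auto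
    finally show "absint H x (x + d) powr p \<le> d powr p * (norm (H x) powr p + absint h x (x + d) powr p)" .
  qed
  also have "\<dots> = ennreal (d powr p) * (pint p H + amalgam p d h)"
    unfolding pint_def amalgam_def using L by (subst circ_int_cmult) (auto simp: circ_int_add)
  finally show ?thesis .
qed

text \<open>An interval of length \<open>\<bar>t\<bar>\<close> is covered by at most \<open>1 + n * \<bar>t\<bar>\<close> windows of length
  \<open>1 / n\<close>. This inequality is what makes primitives tractable for \<open>p < 1\<close>.\<close>

lemma pint_increment_le:
  assumes "0 < p" "p \<le> 1" "primitive H h" "1 \<le> n"
  shows "pint p (\<lambda>x. H (x + t) - H x) \<le> ennreal (1 + real n * \<bar>t\<bar>) * amalgam p (1 / real n) h"
proof -
  have L: "L1per H" "L1per h" using assms primitive_L1per by (auto simp: primitive_def)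
  have [measurable]: "H \<in> borel_measurable borel" by (rule L1perD[OF L(1)])
  have pos: "pint p (\<lambda>x. H (x + t) - H x) \<le> amalgam p t h" if "0 \<le> t" for t
    unfolding pint_def amalgam_def using that assms
    by (intro circ_int_mono powr_mono2 primitive_norm_le) auto
  have "pint p (\<lambda>x. H (x + t) - H x) \<le> amalgam p \<bar>t\<bar> h"
  proof (cases "0 \<le> t")
    case True
    then show ?thesis using pos[of t] by simp
  next
    case False
    have "pint p (\<lambda>x. H (x + t) - H x) = pint p (\<lambda>x. H x - H (x - t))"
    proof -
      have "periodic (\<lambda>x. H x - H (x - t))"
        unfolding periodic_def
        using periodicD[OF L1perD(2)[OF L(1)]] by (metis add_diff_eq diff_add_eq)
      then show ?thesis
        using pint_shift[of "\<lambda>x. H x - H (x - t)" p t] by simp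
    qed
    also have "\<dots> = pint p (\<lambda>x. H (x + - t) - H x)"
      by (subst pint_commute) simp
    also have "\<dots> \<le> amalgam p (- t) h" using False by (intro pos) auto
    finally show ?thesis using False by simp
  qed
  also have "\<dots> \<le> amalgam p (real (nat \<lceil>real n * \<bar>t\<bar>\<rceil>) * (1 / real n)) h"
  proof (intro amalgam_mono assms L)
    have "real n * \<bar>t\<bar> \<le> real (nat \<lceil>real n * \<bar>t\<bar>\<rceil>)" by linarith
    then show "\<bar>t\<bar> \<le> real (nat \<lceil>real n * \<bar>t\<bar>\<rceil>) * (1 / real n)"
      using assms by (simp add: field_simps)
  qed
  also have "\<dots> \<le> ennreal (real (nat \<lceil>real n * \<bar>t\<bar>\<rceil>)) * amalgam p (1 / real n) h"
    using assms L by (intro amalgam_multiple) auto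
  also have "\<dots> \<le> ennreal (1 + real n * \<bar>t\<bar>) * amalgam p (1 / real n) h"
  proof (intro mult_right_mono ennreal_leI)
    have "0 \<le> real n * \<bar>t\<bar>" by simp
    then show "real (nat \<lceil>real n * \<bar>t\<bar>\<rceil>) \<le> 1 + real n * \<bar>t\<bar>" by linarith
  qed simp
  finally show ?thesis .
qed

section \<open>The amalgam quantity of trigonometric polynomials\<close>

lemma dv_trig_sum:
  "dv (\<lambda>x. \<Sum>k = - int n..int n. c k * cis (of_int k * x))
    = (\<lambda>x. \<Sum>k = - int n..int n. (c k * \<i> * of_int k) * cis (of_int k * x))"
  unfolding dv_def by (intro ext vector_derivative_at trig_sum_has_vector_derivative)

lemma dv_iter_trig_bound:
  assumes "T \<in> trig_polys n"
  obtains S where "0 \<le> S" "\<And>k x. norm ((dv ^^ k) T x) \<le> real n ^ k * S"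
proof -
  obtain c where c: "T = (\<lambda>x. \<Sum>j = - int n..int n. c j * cis (of_int j * x))"
    using assms by (rule trig_polysE)
  have iter: "(dv ^^ k) T = (\<lambda>x. \<Sum>j = - int n..int n. (c j * (\<i> * of_int j) ^ k) * cis (of_int j * x))" for k
  proof (induction k)
    case 0
    show ?case by (simp add: c)
  next
    case (Suc k)
    show ?case
      by (simp only: funpow.simps o_apply Suc dv_trig_sum) (simp add: mult_ac)
  qed
  show ?thesis
  proof (rule that[of "\<Sum>j = - int n..int n. norm (c j)"])
    fix k x
    have "norm ((dv ^^ k) T x) \<le> (\<Sum>j = - int n..int n. real n ^ k * norm (c j))"
      unfolding iter
    proof (intro sum_norm_le)
      fix j assume j: "j \<in> {- int n..int n}"
      have "\<bar>real_of_int j\<bar> ^ k \<le> real n ^ k" using j by (intro power_mono) auto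
      then show "norm (c j * (\<i> * of_int j) ^ k * cis (of_int j * x)) \<le> real n ^ k * norm (c j)"
        by (simp add: norm_mult norm_power mult.commute[of "norm (c j)"] mult_right_mono)
    qed
    then show "norm ((dv ^^ k) T x) \<le> real n ^ k * (\<Sum>j = - int n..int n. norm (c j))"
      by (simp add: sum_distrib_left)
  qed (simp add: sum_nonneg)
qed

lemma absint_le_bound:
  assumes "L1per w" "\<And>s. norm (w s) \<le> B" "a \<le> b"
  shows "absint w a b \<le> (b - a) * B"
proof -
  have "absint w a b \<le> (LINT s:{a..b}|lborel. B)"
    unfolding absint_def using assms
    by (intro set_integral_mono L1perD borel_integrable_atLeastAtMost' continuous_intros) auto
  also have "\<dots> = (b - a) * B" using assms by (simp add: set_lebesgue_integral_def)
  finally show ?thesis .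
qed

lemma ennreal_le_geometric:
  assumes "\<And>k. X \<le> Y + ennreal (b * q ^ k)" "0 \<le> q" "q < (1::real)"
  shows "X \<le> Y"
proof -
  have "(\<lambda>k. b * q ^ k) \<longlonglongrightarrow> b * 0"
    using assms by (intro tendsto_intros LIMSEQ_realpow_zero) auto
  then have "(\<lambda>k. Y + ennreal (b * q ^ k)) \<longlonglongrightarrow> Y + ennreal (b * 0)"
    by (intro tendsto_add tendsto_const tendsto_ennrealI)
  then show ?thesis
    using assms(1) by (intro LIMSEQ_le_const[of "\<lambda>k. Y + ennreal (b * q ^ k)"]) auto
qed

lemma ennreal_step_identity:
  assumes "0 \<le> a" "0 \<le> b"
  shows "ennreal (a ^ k) * (ennreal a * (ennreal (b ^ k) * P + A))
    = ennreal (a * (a * b) ^ k) * P + ennreal (a ^ Suc k) * A"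
  using assms by (simp add: ennreal_mult ennreal_power[symmetric] power_mult_distrib algebra_simps)

text \<open>A Plancherel-Polya inequality. Apply \<open>amalgam_primitive_le\<close> to \<open>T\<close> and its successive
  derivatives, with windows of length \<open>1 / (K * n)\<close>. By Bernstein's inequality each derivative costs a
  factor of order \<open>n powr p\<close>, while each step gains \<open>(K * n) powr (- p)\<close>; for large \<open>K\<close> the terms
  form a geometric series, and the remainder tends to \<open>0\<close> because the derivatives of one fixed \<open>T\<close>
  grow at most like \<open>n ^ k\<close>.\<close>

lemma amalgam_trig_le:
  assumes "0 < p" "p \<le> 1"
  shows "\<exists>C>0. \<forall>n\<ge>1. \<forall>T\<in>trig_polys n. amalgam p (1 / real n) T \<le> ennreal (C * real n powr (- p)) * pint p T"
proof -
  obtain C where C: "0 < C" and bern: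
    "\<forall>n\<ge>1. \<forall>T\<in>trig_polys n. \<forall>k. pint p ((dv ^^ k) T) \<le> ennreal ((C * real n powr p) ^ k) * pint p T"
    using bernstein_iter[OF assms] by blast
  (* Then C <= K powr p / 2, so each derivative gains a factor 1/2; K >= 2 makes the remainder vanish. *)
  define K where "K = nat \<lceil>(2 * C) powr (1 / p)\<rceil> + 2"
  have K: "K \<ge> 2" by (simp add: K_def)
  have "(2 * C) powr (1 / p) \<le> real K" unfolding K_def by linarith
  then have "((2 * C) powr (1 / p)) powr p \<le> real K powr p" using assms by (intro powr_mono2) auto
  then have KC: "2 * C \<le> real K powr p" using assms C by (simp add: powr_powr)
  have main: "amalgam p (1 / real n) T \<le> ennreal (2 * real K * real n powr (- p)) * pint p T"
    if n: "1 \<le> n" and T: "T \<in> trig_polys n" for n T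
  proof -
    define d where "d = 1 / (real K * real n)"
    have d: "d > 0" using K n by (simp add: d_def)
    have dC: "d powr p * (C * real n powr p) \<le> 1 / 2"
    proof -
      have "d powr p * (C * real n powr p) = C / real K powr p"
        using K n by (simp add: d_def powr_divide powr_mult)
      also have "\<dots> \<le> 1 / 2" using KC K by (simp add: divide_le_eq)
      finally show ?thesis .
    qed
    have step: "amalgam p d T \<le> ennreal (d powr p * (\<Sum>i<k. (1/2) ^ i)) * pint p T
        + ennreal ((d powr p) ^ k) * amalgam p d ((dv ^^ k) T)" for k
    proof (induction k)
      case 0
      show ?case by simp
    next
      case (Suc k)
      let ?P = "pint p T" and ?Ak = "amalgam p d ((dv ^^ Suc k) T)"
      have Tk: "(dv ^^ k) T \<in> trig_polys n" by (rule trig_poly_dv_iter[OF T])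
      have "ennreal ((d powr p) ^ k) * amalgam p d ((dv ^^ k) T)
          \<le> ennreal ((d powr p) ^ k) * (ennreal (d powr p) * (pint p ((dv ^^ k) T) + amalgam p d (dv ((dv ^^ k) T))))"
        using amalgam_primitive_le[OF assms primitive_trig[OF Tk] d] by (intro mult_left_mono) auto
      also have "\<dots> \<le> ennreal ((d powr p) ^ k) * (ennreal (d powr p) *
          (ennreal ((C * real n powr p) ^ k) * ?P + amalgam p d (dv ((dv ^^ k) T))))"
        using bern n T by (intro mult_left_mono add_right_mono) auto
      also have "\<dots> = ennreal (d powr p * (d powr p * (C * real n powr p)) ^ k) * ?P
          + ennreal ((d powr p) ^ Suc k) * ?Ak"
        using C unfolding funpow.simps o_apply by (intro ennreal_step_identity) auto
      also have "\<dots> \<le> ennreal (d powr p * (1/2) ^ k) * ?P + ennreal ((d powr p) ^ Suc k) * ?Ak"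
        using dC C by (intro add_right_mono mult_right_mono ennreal_leI mult_left_mono power_mono) auto
      finally have "amalgam p d T \<le> ennreal (d powr p * (\<Sum>i<k. (1/2) ^ i)) * ?P
          + (ennreal (d powr p * (1/2) ^ k) * ?P + ennreal ((d powr p) ^ Suc k) * ?Ak)"
        using Suc by (meson add_left_mono order_trans)
      also have "\<dots> = ennreal (d powr p * (\<Sum>i<Suc k. (1/2) ^ i)) * ?P + ennreal ((d powr p) ^ Suc k) * ?Ak"
        by (simp add: distrib_left ennreal_plus sum_nonneg distrib_right add.assoc)
      finally show ?case .
    qed
    obtain S where S: "0 \<le> S" "\<And>k x. norm ((dv ^^ k) T x) \<le> real n ^ k * S"
      using dv_iter_trig_bound[OF T] by blast
    have half: "(\<Sum>i<k. (1/2) ^ i) \<le> (2::real)" for k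
      using sum_gp_strict[of "1/2::real" k] by simp
    have "amalgam p d T \<le> ennreal (2 * d powr p) * pint p T
        + ennreal (2 * pi * (2 * pi * S) powr p * ((1 / real K) powr p) ^ k)" for k
    proof -
      have Tk: "(dv ^^ k) T \<in> trig_polys n" by (rule trig_poly_dv_iter[OF T])
      have "d \<le> 1" using K n mult_mono[of 1 "real K" 1 "real n"] by (simp add: d_def)
      then have "amalgam p d ((dv ^^ k) T) \<le> ennreal (2 * pi * absint ((dv ^^ k) T) 0 (2 * pi) powr p)"
        using assms pi_gt3 by (intro amalgam_le_absint_period L1per_trig[OF Tk]) auto
      also have "absint ((dv ^^ k) T) 0 (2 * pi) \<le> 2 * pi * (real n ^ k * S)"
        using absint_le_bound[OF L1per_trig[OF Tk] S(2), of 0 "2 * pi"] by simp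
      then have "ennreal (2 * pi * absint ((dv ^^ k) T) 0 (2 * pi) powr p)
          \<le> ennreal (2 * pi * (2 * pi * (real n ^ k * S)) powr p)"
        using assms by (intro ennreal_leI mult_left_mono powr_mono2 absint_nonneg) auto
      finally have "ennreal ((d powr p) ^ k) * amalgam p d ((dv ^^ k) T)
          \<le> ennreal ((d powr p) ^ k) * ennreal (2 * pi * (2 * pi * (real n ^ k * S)) powr p)"
        by (intro mult_left_mono) auto
      also have "\<dots> = ennreal (2 * pi * (2 * pi * S) powr p * ((1 / real K) powr p) ^ k)"
      proof -
        have "(real n ^ k) powr p = (real n powr p) ^ k"
          using n by (simp add: powr_powr powr_realpow[symmetric] mult.commute)
        moreover have "(1 / real K) powr p = d powr p * real n powr p"
          using n K by (simp add: d_def powr_divide powr_mult)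
        ultimately show ?thesis
          using S(1) by (simp add: ennreal_mult'[symmetric] powr_mult power_mult_distrib mult_ac)
      qed
      finally have "ennreal ((d powr p) ^ k) * amalgam p d ((dv ^^ k) T)
          \<le> ennreal (2 * pi * (2 * pi * S) powr p * ((1 / real K) powr p) ^ k)" .
      moreover have "ennreal (d powr p * (\<Sum>i<k. (1/2) ^ i)) * pint p T \<le> ennreal (2 * d powr p) * pint p T"
        using half[of k] by (intro mult_right_mono ennreal_leI) (auto simp: mult.commute[of 2] intro: mult_left_mono)
      ultimately show ?thesis using step[of k] by (meson add_mono order_trans)
    qed
    then have "amalgam p d T \<le> ennreal (2 * d powr p) * pint p T"
    proof (rule ennreal_le_geometric)
      have "(1 / real K) powr p < 1 powr p" using K assms by (intro powr_less_mono2) auto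
      then show "(1 / real K) powr p < 1" by simp
    qed simp
    also have "\<dots> \<le> ennreal (2 * real n powr (- p)) * pint p T"
    proof (intro mult_right_mono ennreal_leI mult_left_mono)
      have "d \<le> 1 / real n" using K n by (simp add: d_def field_simps)
      then have "d powr p \<le> (1 / real n) powr p" using d assms by (intro powr_mono2) auto
      then show "d powr p \<le> real n powr (- p)" using n by (simp add: powr_divide powr_minus_divide)
    qed auto
    finally have "ennreal (real K) * amalgam p d T \<le> ennreal (real K) * (ennreal (2 * real n powr (- p)) * pint p T)"
      by (intro mult_left_mono) auto
    moreover have "amalgam p (real K * d) T \<le> ennreal (real K) * amalgam p d T"
      using d by (intro amalgam_multiple assms L1per_trig[OF T]) auto
    moreover have "real K * d = 1 / real n" using K by (simp add: d_def)
    ultimately show ?thesis by (simp add: ennreal_mult' mult_ac)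
  qed
  show ?thesis
    by (rule exI[of _ "2 * real K"]) (use K main in auto)
qed

lemma circ_int_inverse_square_le:
  assumes "1 \<le> n"
  shows "circ_int (\<lambda>t. 1 / (1 + real n * \<bar>t - pi\<bar>)\<^sup>2) \<le> ennreal (2 / real n)"
proof -
  have n: "real n > 0" using assms by simp
  let ?f = "\<lambda>t. 1 / (1 + real n * \<bar>t - pi\<bar>)\<^sup>2"
  have deriv: "((\<lambda>t. - inverse (a + c * t) / c) has_real_derivative 1 / (a + c * t)\<^sup>2) (at t)"
    if "a + c * t > 0" "c \<noteq> 0" for a c t :: real
  proof -
    have "((\<lambda>t. a + c * t) has_real_derivative c) (at t)"
      by (auto intro!: derivative_eq_intros)
    then have "((\<lambda>t. inverse (a + c * t)) has_real_derivative
        - (inverse (a + c * t) * c * inverse (a + c * t))) (at t)"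
      using that by (intro DERIV_inverse') auto
    from DERIV_cdivide[OF DERIV_minus[OF this], of c] show ?thesis
      using that by (simp add: power2_eq_square inverse_eq_divide)
  qed
  have 1: "(\<integral>\<^sup>+t. ennreal (1 / (1 + real n * (t - pi))\<^sup>2) * indicator {pi..2*pi} t \<partial>lborel)
      \<le> ennreal (1 / real n)"
  proof -
    let ?a = "1 - real n * pi"
    have "?a + real n * t > 0" if "pi \<le> t" for t
      using mult_left_mono[OF that, of "real n"] by simp
    then have "(\<integral>\<^sup>+t. ennreal (1 / (?a + real n * t)\<^sup>2) * indicator {pi..2*pi} t \<partial>lborel)
       = ennreal (- inverse (?a + real n * (2 * pi)) / real n - - inverse (?a + real n * pi) / real n)"
      using n by (intro nn_integral_FTC_Icc deriv has_field_derivative_at_within) auto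
    also have "\<dots> \<le> ennreal (1 / real n)"
      using n by (intro ennreal_leI) (auto simp: inverse_eq_divide)
    finally show ?thesis by (simp add: algebra_simps)
  qed
  have 2: "(\<integral>\<^sup>+t. ennreal (1 / (1 + real n * (pi - t))\<^sup>2) * indicator {0..pi} t \<partial>lborel)
      \<le> ennreal (1 / real n)"
  proof -
    let ?a = "1 + real n * pi"
    have "?a + - real n * t > 0" if "t \<le> pi" for t
      using mult_left_mono[OF that, of "real n"] by simp
    then have "(\<integral>\<^sup>+t. ennreal (1 / (?a + - real n * t)\<^sup>2) * indicator {0..pi} t \<partial>lborel)
       = ennreal (- inverse (?a + - real n * pi) / (- real n) - - inverse (?a + - real n * 0) / (- real n))"
      using n by (intro nn_integral_FTC_Icc deriv has_field_derivative_at_within) auto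
    also have "\<dots> \<le> ennreal (1 / real n)"
      using n by (intro ennreal_leI) (auto simp: inverse_eq_divide)
    finally show ?thesis by (simp add: algebra_simps)
  qed
  have "circ_int ?f \<le> (\<integral>\<^sup>+t. ennreal (1 / (1 + real n * (t - pi))\<^sup>2) * indicator {pi..2*pi} t
      + ennreal (1 / (1 + real n * (pi - t))\<^sup>2) * indicator {0..pi} t \<partial>lborel)"
    unfolding circ_int_def by (intro nn_integral_mono) (auto simp: indicator_def abs_if)
  also have "\<dots> = (\<integral>\<^sup>+t. ennreal (1 / (1 + real n * (t - pi))\<^sup>2) * indicator {pi..2*pi} t \<partial>lborel)
      + (\<integral>\<^sup>+t. ennreal (1 / (1 + real n * (pi - t))\<^sup>2) * indicator {0..pi} t \<partial>lborel)"
    by (intro nn_integral_add) auto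
  also have "\<dots> \<le> ennreal (1 / real n) + ennreal (1 / real n)"
    by (intro add_mono 1 2)
  also have "\<dots> = ennreal (2 / real n)"
    using n by (simp add: ennreal_plus[symmetric] del: ennreal_plus)
  finally show ?thesis .
qed

section \<open>Approximation of primitives by discretised convolution\<close>

lemma kernel_moment_le:
  fixes F :: "real \<Rightarrow> real"
  assumes "1 \<le> n" "0 \<le> C"
    and ker: "\<And>t. \<bar>t\<bar> \<le> pi \<Longrightarrow> F t powr p * (1 + real n * \<bar>t\<bar>) \<le> C / (1 + real n * \<bar>t\<bar>)\<^sup>2"
  shows "circ_int (\<lambda>t. F (t - pi) powr p * (1 + real n * \<bar>t - pi\<bar>)) \<le> ennreal (2 * C / real n)"
proof -
  have "circ_int (\<lambda>t. F (t - pi) powr p * (1 + real n * \<bar>t - pi\<bar>))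
      \<le> circ_int (\<lambda>t. C * (1 / (1 + real n * \<bar>t - pi\<bar>)\<^sup>2))"
    unfolding circ_int_def using ker
    by (intro nn_integral_mono) (auto simp: indicator_def intro!: ennreal_leI)
  also have "\<dots> = ennreal C * circ_int (\<lambda>t. 1 / (1 + real n * \<bar>t - pi\<bar>)\<^sup>2)"
    using assms by (intro circ_int_cmult) auto
  also have "\<dots> \<le> ennreal C * ennreal (2 / real n)"
    using assms by (intro mult_left_mono circ_int_inverse_square_le) auto
  also have "\<dots> = ennreal (2 * C / real n)"
    using assms by (simp add: ennreal_mult'[symmetric] mult.commute)
  finally show ?thesis .
qed

text \<open>A period is longer than \<open>1\<close>; so a function exceeding \<open>K\<close> everywhere would have an integral
  larger than \<open>K\<close>.\<close>

lemma nn_integral_period_ex_le: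
  fixes G :: "real \<Rightarrow> ennreal"
  assumes [measurable]: "G \<in> borel_measurable borel"
    and le: "(\<integral>\<^sup>+u\<in>{0..<2*pi}. G u \<partial>lborel) \<le> K"
  shows "\<exists>u. G u \<le> K"
proof (rule ccontr)
  assume "\<nexists>u. G u \<le> K"
  then have nle: "\<not> G u \<le> K" for u by blast
  then have gt: "K < G u" for u by (meson not_le)
  then have K: "K \<noteq> \<infinity>" using gt[of 0] by auto
  have e: "emeasure lborel {0..<2*pi} = ennreal (2 * pi)" by simp
  have "(\<integral>\<^sup>+u\<in>{0..<2*pi}. K \<partial>lborel) < (\<integral>\<^sup>+u\<in>{0..<2*pi}. G u \<partial>lborel)"
  proof (rule nn_integral_less)
    show "(\<integral>\<^sup>+u\<in>{0..<2*pi}. K \<partial>lborel) \<noteq> \<infinity>"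
      using K by (simp add: nn_integral_cmult ennreal_mult_eq_top_iff)
    show "AE u in lborel. K * indicator {0..<2*pi} u \<le> G u * indicator {0..<2*pi} u"
      using gt by (intro AE_I2 mult_right_mono) (auto intro: less_imp_le)
    show "\<not> (AE u in lborel. G u * indicator {0..<2*pi} u \<le> K * indicator {0..<2*pi} u)"
    proof
      assume "AE u in lborel. G u * indicator {0..<2*pi} u \<le> K * indicator {0..<2*pi} u"
      then have "AE u in lborel. u \<notin> {0..<2*pi}"
        by eventually_elim (use nle in \<open>auto simp: indicator_def split: if_splits\<close>)
      then have "emeasure lborel {0..<2*pi} = 0"
        by (subst (asm) AE_iff_measurable[of "{0..<2*pi}"]) auto
      then show False using e pi_gt3 by simp
    qed
  qed auto
  also note le
  finally have "ennreal (2 * pi) * K < K"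
    by (simp add: nn_integral_cmult mult.commute)
  moreover have "1 * K \<le> ennreal (2 * pi) * K"
    using pi_gt3 by (intro mult_right_mono) auto
  ultimately show False by simp
qed

text \<open>The approximant is a convolution of \<open>H\<close> with a localised kernel, discretised at \<open>n + 1\<close>
  equidistant nodes shifted by \<open>u\<close>. A sum is needed since \<open>p\<close>-th powers can be taken inside sums but
  not inside integrals. At fixed nodes the increments of \<open>H\<close> are out of control; their average over
  \<open>u\<close> is a double integral of increments \<open>H (y + t) - H y\<close> with weight \<open>F t powr p\<close>, which is bounded
  by \<open>pint_increment_le\<close>. Some shift \<open>u\<close> does as well as the average.\<close>

lemma quasi_interpolation:
  assumes "0 < p" "p \<le> 1"
  shows "\<exists>C>0. \<forall>n\<ge>1. \<forall>H h. primitive H h \<longrightarrow>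
    (\<exists>S\<in>trig_polys n. pdist p H S \<le> ennreal C * amalgam p (1 / real n) h)"
proof -
  obtain C where C: "0 < C" and ker: "\<forall>n. \<exists>F. localised_kernel p C n F"
    using trig_kernel[OF assms(1)] by blast
  have main: "\<exists>S\<in>trig_polys n. pdist p H S \<le> ennreal (4 * C) * amalgam p (1 / real n) h"
    if n: "1 \<le> n" and H: "primitive H h" for n H h
  proof -
    obtain F :: "real \<Rightarrow> real" where F: "(\<lambda>t. complex_of_real (F t)) \<in> trig_polys n" "F 0 = 1"
      "\<And>t. 0 \<le> F t" "\<And>t. F t \<le> 1"
      "\<And>t. \<bar>t\<bar> \<le> pi \<Longrightarrow> F t powr p * (1 + real n * \<bar>t\<bar>) \<le> C / (1 + real n * \<bar>t\<bar>)\<^sup>2"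
      using ker unfolding localised_kernel_def by blast
    let ?A = "amalgam p (1 / real n) h"
    have LH: "L1per H" by (rule primitive_L1per[OF H])
    have [measurable]: "H \<in> borel_measurable borel" by (rule L1perD[OF LH])
    have "(\<lambda>t. Re (complex_of_real (F t))) \<in> borel_measurable borel"
      using trig_poly_measurable[OF F(1)] by measurable
    then have [measurable]: "F \<in> borel_measurable borel" by simp
    have perF: "F (t + 2 * pi) = F t" for t
      using periodicD[OF trig_poly_periodic[OF F(1)], of t] by simp
    have perH: "H (t + 2 * pi) = H t" for t
      by (rule periodicD[OF L1perD(2)[OF LH]])
    define L where "L = n + 1"
    obtain c where c: "\<forall>L>n. \<forall>x. (\<Sum>k<L. complex_of_real (F (x + 2 * pi * real k / real L))) = of_nat L * c"
      using trig_poly_mean[OF F(1)] by blast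
    define \<theta> where "\<theta> k = 2 * pi * real k / real L" for k
    define s where "s = (\<Sum>k<L. F (\<theta> k))"
    have sumF: "(\<Sum>k<L. F (x + \<theta> k)) = s" for x
    proof -
      have "complex_of_real (\<Sum>k<L. F (x + \<theta> k)) = of_real (\<Sum>k<L. F (0 + \<theta> k))"
        using c[rule_format, of L x] c[rule_format, of L 0] unfolding \<theta>_def by (simp add: L_def)
      then show ?thesis unfolding s_def by (simp only: of_real_eq_iff add_0)
    qed
    (* The node 0 contributes F 0 = 1. *)
    have s1: "1 \<le> s"
    proof -
      have "F (\<theta> 0) \<le> s" unfolding s_def using F(3) by (intro member_le_sum) (auto simp: L_def)
      then show ?thesis by (simp add: \<theta>_def F(2))
    qed
    define S where "S u x = (\<Sum>k<L. (H (u - \<theta> k) / of_real s) * of_real (F (x + (\<theta> k - u))))" for u x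
    have Strig: "S u \<in> trig_polys n" for u
      unfolding S_def[abs_def] by (intro trig_poly_sum trig_poly_cmult trig_poly_shift[OF F(1)])
    define P where "P x y = F (x - y) powr p * norm (H x - H y) powr p" for x y
    have Pnn: "0 \<le> P x y" for x y by (simp add: P_def)
    have err: "norm (H x - S u x) powr p \<le> (\<Sum>k<L. P x (u - \<theta> k))" for u x
    proof -
      have "(\<Sum>k<L. F (x + (\<theta> k - u))) = s"
        using sumF[of "x - u"] by (simp add: algebra_simps)
      then have "H x = (H x / of_real s) * of_real (\<Sum>k<L. F (x + (\<theta> k - u)))"
        using s1 by simp
      then have "H x = (\<Sum>k<L. (H x / of_real s) * of_real (F (x + (\<theta> k - u))))"
        unfolding of_real_sum sum_distrib_left .
      then have "H x - S u x = (\<Sum>k<L. (H x / of_real s) * of_real (F (x + (\<theta> k - u)))) - S u x"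
        by (rule arg_cong)
      also have "\<dots> = (\<Sum>k<L. of_real (F (x + (\<theta> k - u)) / s) * (H x - H (u - \<theta> k)))"
        unfolding S_def sum_subtractf[symmetric]
        by (intro sum.cong refl) (simp add: algebra_simps diff_divide_distrib)
      finally have "norm (H x - S u x) powr p
          \<le> (\<Sum>k<L. norm (of_real (F (x + (\<theta> k - u)) / s) * (H x - H (u - \<theta> k))) powr p)"
        using assms by (simp only:) (intro norm_sum_powr_le, auto)
      also have "\<dots> \<le> (\<Sum>k<L. P x (u - \<theta> k))"
      proof (intro sum_mono)
        fix k
        have "F (x + (\<theta> k - u)) / s \<le> F (x + (\<theta> k - u))"
          using s1 F(3)[of "x + (\<theta> k - u)"] by (simp add: divide_le_eq mult_left_le_one_le mult_le_cancel_left1)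
        then have "(F (x + (\<theta> k - u)) / s) powr p \<le> F (x + (\<theta> k - u)) powr p"
          using s1 F(3) assms by (intro powr_mono2) auto
        then have "(F (x + (\<theta> k - u)) / s) powr p * norm (H x - H (u - \<theta> k)) powr p \<le> P x (u - \<theta> k)"
          unfolding P_def by (intro mult_mono) (auto simp: algebra_simps)
        moreover have nn: "0 \<le> F (x + (\<theta> k - u)) / s" using s1 F(3) by simp
        moreover have "norm (complex_of_real (F (x + (\<theta> k - u)) / s) * (H x - H (u - \<theta> k))) powr p
            = (F (x + (\<theta> k - u)) / s) powr p * norm (H x - H (u - \<theta> k)) powr p"
          unfolding norm_mult norm_of_real abs_of_nonneg[OF nn] by (intro powr_mult)
        ultimately show "norm (complex_of_real (F (x + (\<theta> k - u)) / s) * (H x - H (u - \<theta> k))) powr p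
            \<le> P x (u - \<theta> k)" by simp
      qed
      finally show ?thesis .
    qed
    define Q where "Q y = (\<integral>\<^sup>+x\<in>{0..<2*pi}. ennreal (P x y) \<partial>lborel)" for y
    have [measurable]: "(\<lambda>(x, y). P x y) \<in> borel_measurable (borel \<Otimes>\<^sub>M borel)"
      unfolding P_def by measurable
    have Qm [measurable]: "Q \<in> borel_measurable borel"
      unfolding Q_def by measurable
    have Qper: "periodic Q"
    proof -
      have "P x (y + 2 * pi) = P x y" for x y
        using perF[of "x - (y + 2 * pi)"] perH[of y] by (simp add: P_def)
      then show ?thesis by (simp add: periodic_def Q_def)
    qed
    define G where "G u = pdist p H (S u)" for u
    have Gm: "G \<in> borel_measurable borel"
      unfolding G_def pint_def circ_int_def S_def by measurable
    have GQ: "G u \<le> (\<Sum>k<L. Q (u - \<theta> k))" for u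
    proof -
      have "G u \<le> circ_int (\<lambda>x. \<Sum>k<L. P x (u - \<theta> k))"
        unfolding G_def pint_def by (intro circ_int_mono err)
      also have "\<dots> = (\<Sum>k<L. circ_int (\<lambda>x. P x (u - \<theta> k)))"
        using Pnn by (intro circ_int_sum) auto
      finally show ?thesis by (simp add: Q_def circ_int_def)
    qed
    have Qeq: "Q y = (\<integral>\<^sup>+t\<in>{0..<2*pi}. ennreal (F (t - pi) powr p * norm (H (t - pi + y) - H y) powr p) \<partial>lborel)" for y
    proof -
      have per: "periodic (\<lambda>x. ennreal (P x y))"
        using perF[of "x - y" for x] perH unfolding periodic_def P_def
        by (simp add: diff_add_eq[symmetric])
      have "Q y = (\<integral>\<^sup>+t\<in>{0..<2*pi}. ennreal (P (t + (y - pi)) y) \<partial>lborel)"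
        unfolding Q_def by (rule nn_integral_period_shift[OF _ per, symmetric]) measurable
      then show ?thesis by (simp add: P_def algebra_simps)
    qed
    have "(\<integral>\<^sup>+y\<in>{0..<2*pi}. Q y \<partial>lborel) = (\<integral>\<^sup>+y. \<integral>\<^sup>+t. ennreal (F (t - pi) powr p
        * norm (H (t - pi + y) - H y) powr p) * indicator {0..<2*pi} t * indicator {0..<2*pi} y \<partial>lborel \<partial>lborel)"
      unfolding Qeq by (intro nn_integral_cong nn_integral_multc[symmetric]) measurable
    also have "\<dots> = (\<integral>\<^sup>+t. \<integral>\<^sup>+y. ennreal (F (t - pi) powr p
        * norm (H (t - pi + y) - H y) powr p) * indicator {0..<2*pi} t * indicator {0..<2*pi} y \<partial>lborel \<partial>lborel)"
      by (rule lborel_pair.Fubini') measurable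
    also have "\<dots> = (\<integral>\<^sup>+t\<in>{0..<2*pi}. ennreal (F (t - pi) powr p) * pint p (\<lambda>y. H (y + (t - pi)) - H y) \<partial>lborel)"
    proof (intro nn_integral_cong)
      fix t
      have "(\<integral>\<^sup>+y. ennreal (F (t - pi) powr p
        * norm (H (t - pi + y) - H y) powr p) * indicator {0..<2*pi} t * indicator {0..<2*pi} y \<partial>lborel)
        = (\<integral>\<^sup>+y. (ennreal (F (t - pi) powr p) * indicator {0..<2*pi} t) *
            (ennreal (norm (H (y + (t - pi)) - H y) powr p) * indicator {0..<2*pi} y) \<partial>lborel)"
        by (intro nn_integral_cong) (simp add: ennreal_mult' add.commute mult_ac)
      also have "\<dots> = (ennreal (F (t - pi) powr p) * indicator {0..<2*pi} t) * pint p (\<lambda>y. H (y + (t - pi)) - H y)"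
        unfolding pint_def circ_int_def by (intro nn_integral_cmult) measurable
      finally show "(\<integral>\<^sup>+y. ennreal (F (t - pi) powr p
        * norm (H (t - pi + y) - H y) powr p) * indicator {0..<2*pi} t * indicator {0..<2*pi} y \<partial>lborel)
        = ennreal (F (t - pi) powr p) * pint p (\<lambda>y. H (y + (t - pi)) - H y) * indicator {0..<2*pi} t"
        by (simp add: mult_ac)
    qed
    also have "\<dots> \<le> (\<integral>\<^sup>+t\<in>{0..<2*pi}. ennreal (F (t - pi) powr p) * (ennreal (1 + real n * \<bar>t - pi\<bar>) * ?A) \<partial>lborel)"
      by (intro nn_integral_mono mult_right_mono mult_left_mono pint_increment_le assms H n) auto
    also have "\<dots> = (\<integral>\<^sup>+t. ?A * (ennreal (F (t - pi) powr p * (1 + real n * \<bar>t - pi\<bar>)) * indicator {0..<2*pi} t) \<partial>lborel)"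
      by (intro nn_integral_cong) (simp add: ennreal_mult' mult_ac)
    also have "\<dots> = ?A * circ_int (\<lambda>t. F (t - pi) powr p * (1 + real n * \<bar>t - pi\<bar>))"
      unfolding circ_int_def by (intro nn_integral_cmult) measurable
    also have "\<dots> \<le> ?A * ennreal (2 * C / real n)"
      using n C F(5) by (intro mult_left_mono kernel_moment_le) auto
    finally have QA: "(\<integral>\<^sup>+y\<in>{0..<2*pi}. Q y \<partial>lborel) \<le> ?A * ennreal (2 * C / real n)" .
    have "(\<integral>\<^sup>+u\<in>{0..<2*pi}. G u \<partial>lborel) \<le> (\<integral>\<^sup>+u. (\<Sum>k<L. Q (u - \<theta> k) * indicator {0..<2*pi} u) \<partial>lborel)"
      unfolding sum_distrib_right[symmetric] by (intro nn_integral_mono mult_right_mono GQ) auto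
    also have "\<dots> = (\<Sum>k<L. \<integral>\<^sup>+u\<in>{0..<2*pi}. Q (u + - \<theta> k) \<partial>lborel)"
      by (subst nn_integral_sum) auto
    also have "\<dots> = (\<Sum>k<L. \<integral>\<^sup>+u\<in>{0..<2*pi}. Q u \<partial>lborel)"
      by (intro sum.cong refl nn_integral_period_shift Qm Qper)
    also have "\<dots> \<le> (\<Sum>k<L. ?A * ennreal (2 * C / real n))"
      by (intro sum_mono QA)
    also have "\<dots> = ennreal (real L * (2 * C / real n)) * ?A"
    proof -
      have "(\<Sum>k<L. ?A * ennreal (2 * C / real n)) = (ennreal (real L) * ennreal (2 * C / real n)) * ?A"
        by (simp add: ennreal_of_nat_eq_real_of_nat mult_ac)
      then show ?thesis by (subst ennreal_mult') auto
    qed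
    also have "\<dots> \<le> ennreal (4 * C) * ?A"
    proof (intro mult_right_mono ennreal_leI)
      have "real L \<le> 2 * real n" using n by (simp add: L_def)
      then have "real L * (2 * C) \<le> 2 * real n * (2 * C)" using C by (intro mult_right_mono) auto
      then show "real L * (2 * C / real n) \<le> 4 * C" using n by (simp add: divide_le_eq)
    qed simp
    finally obtain u where "G u \<le> ennreal (4 * C) * ?A"
      using nn_integral_period_ex_le[OF Gm] by blast
    then show ?thesis unfolding G_def using Strig by blast
  qed
  show ?thesis by (rule exI[of _ "4 * C"]) (use C main in auto)
qed

section \<open>Correcting the mean and approximating one primitive\<close>

text \<open>The weights of a derivative rule sum to \<open>0\<close>, because constants have derivative \<open>0\<close>. Hence in
  the rule for \<open>dv S x\<close> each value \<open>S (x + \<theta> k)\<close> may be replaced by the sum of \<open>S - H\<close> at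
  \<open>x + \<theta> k\<close> and the increment \<open>H (x + \<theta> k) - H x\<close>.\<close>

lemma quasi_interpolation_dv:
  assumes "0 < p" "p \<le> 1"
  shows "\<exists>C>0. \<forall>n\<ge>1. \<forall>H h S A. primitive H h \<longrightarrow> S \<in> trig_polys n \<longrightarrow> 1 \<le> A \<longrightarrow>
    pdist p H S \<le> ennreal A * amalgam p (1 / real n) h \<longrightarrow>
    pint p (dv S) \<le> ennreal (C * A * real n powr p) * amalgam p (1 / real n) h"
proof -
  obtain C where C: "0 < C" and wts: "\<forall>n\<ge>1. \<exists>N a \<theta>. derivative_rule p C n N a \<theta>"
    using bernstein_weights[OF assms(1)] by blast
  have main: "pint p (dv S) \<le> ennreal (2 * C * A * real n powr p) * amalgam p (1 / real n) h"
    if n: "1 \<le> n" and H: "primitive H h" and S: "S \<in> trig_polys n" and A: "1 \<le> A"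
      and le: "pdist p H S \<le> ennreal A * amalgam p (1 / real n) h" for n H h S A
  proof -
    obtain N :: nat and a :: "nat \<Rightarrow> complex" and \<theta> where
      rep: "\<forall>T\<in>trig_polys n. \<forall>x. dv T x = (\<Sum>k<N. a k * T (x + \<theta> k))"
      and sum: "(\<Sum>k<N. norm (a k) powr p * (1 + real n * \<bar>\<theta> k\<bar>)) \<le> C * real n powr p"
      using wts n unfolding derivative_rule_def by blast
    let ?A = "amalgam p (1 / real n) h"
    have [measurable]: "H \<in> borel_measurable borel" by (rule primitive_measurable[OF H])
    have [measurable]: "S \<in> borel_measurable borel" by (rule trig_poly_measurable[OF S])
    have per: "periodic (\<lambda>x. S x - H x)"
      using trig_poly_periodic[OF S] L1perD(2)[OF primitive_L1per[OF H]] by (simp add: periodic_def)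
    have "dv (\<lambda>x. 1) 0 = 0" unfolding dv_def by (rule vector_derivative_const_at)
    then have a0: "(\<Sum>k<N. a k) = 0"
      using rep[rule_format, OF trig_poly_const[of 1 n], of 0] by simp
    have dvS: "dv S x = (\<Sum>k<N. a k * ((S (x + \<theta> k) - H (x + \<theta> k)) + (H (x + \<theta> k) - H x)))" for x
    proof -
      have "(\<Sum>k<N. a k * ((S (x + \<theta> k) - H (x + \<theta> k)) + (H (x + \<theta> k) - H x)))
          = (\<Sum>k<N. a k * S (x + \<theta> k)) - (\<Sum>k<N. a k) * H x"
        by (simp add: algebra_simps sum.distrib sum_subtractf sum_distrib_left)
      then show ?thesis using a0 rep S by simp
    qed
    have "pint p (dv S) \<le> (\<Sum>k<N. pint p (\<lambda>x. a k * ((S (x + \<theta> k) - H (x + \<theta> k)) + (H (x + \<theta> k) - H x))))"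
      unfolding dvS[abs_def] using assms by (intro pint_sum_le) auto
    also have "\<dots> \<le> (\<Sum>k<N. ennreal (2 * A * (norm (a k) powr p * (1 + real n * \<bar>\<theta> k\<bar>))) * ?A)"
    proof (intro sum_mono)
      fix k
      have "pint p (\<lambda>x. (S (x + \<theta> k) - H (x + \<theta> k)) + (H (x + \<theta> k) - H x))
          \<le> pint p (\<lambda>x. S (x + \<theta> k) - H (x + \<theta> k)) + pint p (\<lambda>x. H (x + \<theta> k) - H x)"
        using assms by (intro pint_add_le) measurable
      also have "\<dots> = pdist p H S + pint p (\<lambda>x. H (x + \<theta> k) - H x)"
        using pint_shift[OF _ per, of p "\<theta> k"] pint_commute[of p S H] by simp
      also have "\<dots> \<le> ennreal A * ?A + ennreal (1 + real n * \<bar>\<theta> k\<bar>) * ?A"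
        by (intro add_mono le pint_increment_le assms H n)
      also have "\<dots> = ennreal (A + (1 + real n * \<bar>\<theta> k\<bar>)) * ?A"
        using A by (simp add: distrib_right[symmetric] ennreal_plus[symmetric] del: ennreal_plus)
      also have "\<dots> \<le> ennreal (2 * A * (1 + real n * \<bar>\<theta> k\<bar>)) * ?A"
      proof (intro mult_right_mono ennreal_leI)
        have "1 * (1 + real n * \<bar>\<theta> k\<bar>) \<le> A * (1 + real n * \<bar>\<theta> k\<bar>)"
          using A by (intro mult_right_mono) auto
        moreover have "A * 1 \<le> A * (1 + real n * \<bar>\<theta> k\<bar>)"
          using A by (intro mult_left_mono) auto
        ultimately show "A + (1 + real n * \<bar>\<theta> k\<bar>) \<le> 2 * A * (1 + real n * \<bar>\<theta> k\<bar>)" by simp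
      qed simp
      finally have X: "pint p (\<lambda>x. (S (x + \<theta> k) - H (x + \<theta> k)) + (H (x + \<theta> k) - H x))
          \<le> ennreal (2 * A * (1 + real n * \<bar>\<theta> k\<bar>)) * ?A" .
      have "pint p (\<lambda>x. a k * ((S (x + \<theta> k) - H (x + \<theta> k)) + (H (x + \<theta> k) - H x)))
          = ennreal (norm (a k) powr p) * pint p (\<lambda>x. (S (x + \<theta> k) - H (x + \<theta> k)) + (H (x + \<theta> k) - H x))"
        by (intro pint_cmult) measurable
      also have "\<dots> \<le> ennreal (norm (a k) powr p) * (ennreal (2 * A * (1 + real n * \<bar>\<theta> k\<bar>)) * ?A)"
        by (intro mult_left_mono X) auto
      also have "\<dots> = ennreal (norm (a k) powr p * (2 * A * (1 + real n * \<bar>\<theta> k\<bar>))) * ?A"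
        by (subst ennreal_mult') (auto simp: mult.assoc)
      also have "norm (a k) powr p * (2 * A * (1 + real n * \<bar>\<theta> k\<bar>))
          = 2 * A * (norm (a k) powr p * (1 + real n * \<bar>\<theta> k\<bar>))" by simp
      finally show "pint p (\<lambda>x. a k * ((S (x + \<theta> k) - H (x + \<theta> k)) + (H (x + \<theta> k) - H x)))
          \<le> ennreal (2 * A * (norm (a k) powr p * (1 + real n * \<bar>\<theta> k\<bar>))) * ?A" .
    qed
    also have "\<dots> = ennreal (2 * A * (\<Sum>k<N. norm (a k) powr p * (1 + real n * \<bar>\<theta> k\<bar>))) * ?A"
      using A by (simp add: sum_distrib_right[symmetric] sum_ennreal sum_distrib_left)
    also have "\<dots> \<le> ennreal (2 * A * (C * real n powr p)) * ?A"
      using A sum by (intro mult_right_mono ennreal_leI mult_left_mono) auto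
    finally show ?thesis by (simp add: mult_ac)
  qed
  show ?thesis by (rule exI[of _ "2 * C"]) (use C main in auto)
qed

lemma kernel_pint_le:
  fixes F :: "real \<Rightarrow> real"
  assumes "1 \<le> n" "0 \<le> C" "(\<lambda>t. complex_of_real (F t)) \<in> trig_polys n" "\<And>t. 0 \<le> F t"
    "\<And>t. \<bar>t\<bar> \<le> pi \<Longrightarrow> F t powr p * (1 + real n * \<bar>t\<bar>) \<le> C / (1 + real n * \<bar>t\<bar>)\<^sup>2"
  shows "pint p (\<lambda>t. of_real (F t)) \<le> ennreal (2 * C / real n)"
proof -
  have "pint p (\<lambda>t. of_real (F t)) = pint p (\<lambda>t. of_real (F (t + - pi)))"
    by (rule pint_shift[symmetric]) (use assms trig_poly_measurable trig_poly_periodic in blast)+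
  also have "\<dots> \<le> circ_int (\<lambda>t. F (t - pi) powr p * (1 + real n * \<bar>t - pi\<bar>))"
    unfolding pint_def
  proof (intro circ_int_mono)
    fix t
    have "F (t - pi) powr p * 1 \<le> F (t - pi) powr p * (1 + real n * \<bar>t - pi\<bar>)"
      by (intro mult_left_mono) auto
    then show "norm (complex_of_real (F (t + - pi))) powr p \<le> F (t - pi) powr p * (1 + real n * \<bar>t - pi\<bar>)"
      using assms(4) by simp
  qed
  also have "\<dots> \<le> ennreal (2 * C / real n)" using assms by (intro kernel_moment_le) auto
  finally show ?thesis .
qed

text \<open>Only polynomials with mean \<open>0\<close> have periodic primitives. The mean \<open>b\<close> of \<open>U\<close> is at most the
  integral of \<open>\<bar>v - U\<bar>\<close>, because \<open>v\<close> has mean \<open>0\<close>. Subtracting the constant \<open>b\<close> would be too costly in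
  \<open>L\<^sub>p\<close>. A localised kernel with mean \<open>b\<close> has an \<open>L\<^sub>p\<close> quasi-norm smaller than that of \<open>b\<close> by a
  factor of order \<open>n powr (1 - 1 / p)\<close>, which exactly compensates for the passage from the amalgam of
  \<open>v - U\<close> to its integral over a period.\<close>

lemma mean_correction:
  assumes "0 < p" "p \<le> 1"
  shows "\<exists>C>0. \<forall>n\<ge>1. \<forall>w v U. primitive w v \<longrightarrow> U \<in> trig_polys n \<longrightarrow>
    (\<exists>V\<in>trig_polys n. pdist p U (dv V) \<le> ennreal (C * real n powr p) * adist p n v U
      \<and> adist p n v (dv V) \<le> ennreal C * adist p n v U)"
proof -
  obtain C where C: "0 < C" and ker: "\<forall>n. \<exists>F. localised_kernel p C n F"
    using trig_kernel[OF assms(1)] by blast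
  obtain D where D: "0 < D" and amalT:
    "\<forall>n\<ge>1. \<forall>T\<in>trig_polys n. amalgam p (1 / real n) T \<le> ennreal (D * real n powr (- p)) * pint p T"
    using amalgam_trig_le[OF assms] by blast
  have main: "\<exists>V\<in>trig_polys n. pdist p U (dv V) \<le> ennreal (32 * C * real n powr p) * adist p n v U
      \<and> adist p n v (dv V) \<le> ennreal (1 + D * (32 * C)) * adist p n v U"
    if n: "1 \<le> n" and w: "primitive w v" and U: "U \<in> trig_polys n" for n w v U
  proof -
    let ?A = "adist p n v U"
    obtain F :: "real \<Rightarrow> real" where F: "(\<lambda>t. complex_of_real (F t)) \<in> trig_polys n" "F 0 = 1"
      "\<And>t. 0 \<le> F t" "\<And>t. F t \<le> 1"
      "\<And>t. \<bar>t\<bar> \<le> pi \<Longrightarrow> F t powr p * (1 + real n * \<bar>t\<bar>) \<le> C / (1 + real n * \<bar>t\<bar>)\<^sup>2"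
      using ker unfolding localised_kernel_def by blast
    have Lv: "L1per v" using w by (simp add: primitive_def)
    have LU: "L1per U" by (rule L1per_trig[OF U])
    obtain c VF where c: "\<forall>L>n. \<forall>x. (\<Sum>k<L. complex_of_real (F (x + 2 * pi * real k / real L))) = of_nat L * c"
      and VF: "VF \<in> trig_polys n" "\<forall>x. (VF has_vector_derivative of_real (F x) - c) (at x)"
      using trig_poly_mean[OF F(1)] by blast
    obtain b VU where VU: "VU \<in> trig_polys n" "\<forall>x. (VU has_vector_derivative U x - b) (at x)"
      using trig_poly_mean[OF U] by blast
    (* Quadrature with n + 1 nodes, one of them at the maximum F 0 = 1. *)
    have c1: "1 \<le> real (n + 1) * norm c"
    proof -
      define s where "s = (\<Sum>k<n + 1. F (0 + 2 * pi * real k / real (n + 1)))"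
      have "F (0 + 2 * pi * real 0 / real (n + 1)) \<le> s"
        unfolding s_def using F(3) by (intro member_le_sum) auto
      then have "1 \<le> s" using F(2) by simp
      moreover have "of_real s = of_nat (n + 1) * c"
        using c[rule_format, of "n + 1" 0] unfolding s_def of_real_sum by simp
      then have "norm (complex_of_real s) = real (n + 1) * norm c"
        by (simp only: norm_mult norm_of_nat)
      ultimately show ?thesis by simp
    qed
    then have c0: "c \<noteq> 0" by auto
    define V where "V = (\<lambda>x. VU x - (b / c) * VF x)"
    have V: "V \<in> trig_polys n"
      unfolding V_def by (intro trig_poly_diff trig_poly_cmult VU VF)
    have dvV: "dv V = (\<lambda>x. U x - (b / c) * of_real (F x))"
    proof
      fix x
      have "(V has_vector_derivative (U x - b) - (b / c) * (of_real (F x) - c)) (at x)"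
        unfolding V_def using VU(2) VF(2)
        by (intro has_vector_derivative_diff has_vector_derivative_mult_right) auto
      then have "dv V x = (U x - b) - (b / c) * (of_real (F x) - c)"
        unfolding dv_def by (rule vector_derivative_at)
      then show "dv V x = U x - (b / c) * of_real (F x)"
        using c0 by (simp add: algebra_simps)
    qed
    have b: "norm b \<le> absint (\<lambda>x. v x - U x) 0 (2 * pi)"
    proof -
      have prim0: "(LINT s:{0..2*pi}|lborel. g s) = 0" if "primitive f g" for f g
      proof -
        have "f (2 * pi) - f 0 = (LINT s:{0..2*pi}|lborel. g s)" using that by (simp add: primitive_def)
        moreover have "f (2 * pi) = f 0" using that periodicD[of f 0] by (simp add: primitive_def)
        ultimately show ?thesis by simp
      qed
      have i1: "(LINT s:{0..2*pi}|lborel. v s) = 0" by (rule prim0[OF w])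
      have "primitive VU (\<lambda>x. U x - b)"
        using VU(2) by (intro primitive_derivative trig_poly_periodic[OF VU(1)]
            L1per_trig[OF trig_poly_diff[OF U trig_poly_const]]) auto
      then have i2: "(LINT s:{0..2*pi}|lborel. U s - b) = 0"
        by (rule prim0)
      have "(LINT s:{0..2*pi}|lborel. v s - (U s - b))
          = (LINT s:{0..2*pi}|lborel. v s) - (LINT s:{0..2*pi}|lborel. U s - b)"
        by (rule set_integral_diff(2)[OF L1perD(3)[OF Lv] borel_integrable_atLeastAtMost'])
          (intro continuous_intros trig_poly_continuous[OF U])
      then have "0 = (LINT s:{0..2*pi}|lborel. (v s - U s) + b)" unfolding i1 i2
        by (simp add: diff_diff_eq2 diff_add_eq)
      also have "\<dots> = (LINT s:{0..2*pi}|lborel. v s - U s) + (LINT s:{0..2*pi}|lborel. b)"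
        by (rule set_integral_add(2)[OF L1perD(3)[OF L1per_diff[OF Lv LU]] borel_integrable_atLeastAtMost'])
          (intro continuous_intros)
      also have "(LINT s:{0..2*pi}|lborel. b) = of_real (2 * pi) * b"
        by (simp add: set_lebesgue_integral_def scaleR_conv_of_real)
      finally have "of_real (2 * pi) * b = - (LINT s:{0..2*pi}|lborel. v s - U s)"
        by (simp add: eq_neg_iff_add_eq_0 add.commute)
      then have "2 * pi * norm b = norm (LINT s:{0..2*pi}|lborel. v s - U s)"
        by (metis abs_of_nonneg norm_minus_cancel norm_mult norm_of_real pi_ge_zero zero_le_mult_iff zero_le_numeral)
      also have "\<dots> \<le> absint (\<lambda>x. v x - U x) 0 (2 * pi)"
        unfolding absint_def using L1perD(3)[OF L1per_diff[OF Lv LU]] by (rule set_integral_norm_bound)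
      finally have "2 * pi * norm b \<le> absint (\<lambda>x. v x - U x) 0 (2 * pi)" .
      moreover have "1 * norm b \<le> 2 * pi * norm b"
        using pi_gt3 by (intro mult_right_mono) auto
      ultimately show ?thesis by simp
    qed
    have 1: "pdist p U (dv V) \<le> ennreal (32 * C * real n powr p) * ?A"
    proof -
      have "norm (b / c) \<le> 2 * real n * norm b"
      proof -
        have "1 \<le> (2 * real n) * norm c"
        proof -
          have "real (n + 1) * norm c \<le> (2 * real n) * norm c"
            using n by (intro mult_right_mono) auto
          then show ?thesis using c1 by linarith
        qed
        then have "norm b * 1 \<le> norm b * ((2 * real n) * norm c)" by (intro mult_left_mono) auto
        then show ?thesis using c0 by (simp add: norm_divide divide_le_eq mult_ac)
      qed
      then have "norm (b / c) powr p \<le> (2 * real n * absint (\<lambda>x. v x - U x) 0 (2 * pi)) powr p"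
        using b assms mult_left_mono[OF b, of "2 * real n"] by (intro powr_mono2) auto
      also have "\<dots> = 2 powr p * real n powr p * absint (\<lambda>x. v x - U x) 0 (2 * pi) powr p"
        by (simp add: powr_mult absint_nonneg)
      also have "\<dots> \<le> 2 * real n powr p * absint (\<lambda>x. v x - U x) 0 (2 * pi) powr p"
        using assms powr_mono[of p 1 2] by (intro mult_right_mono) auto
      finally have bc: "norm (b / c) powr p \<le> 2 * real n powr p * absint (\<lambda>x. v x - U x) 0 (2 * pi) powr p" .
      have "pdist p U (dv V) = pint p (\<lambda>x. (b / c) * of_real (F x))"
        unfolding dvV by simp
      also have "\<dots> = ennreal (norm (b / c) powr p) * pint p (\<lambda>x. of_real (F x))"
        by (rule pint_cmult[OF trig_poly_measurable[OF F(1)]])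
      also have "\<dots> \<le> ennreal (2 * real n powr p * absint (\<lambda>x. v x - U x) 0 (2 * pi) powr p) * ennreal (2 * C / real n)"
        using C F(3,5) n by (intro mult_mono ennreal_leI bc kernel_pint_le[OF n _ F(1)]) auto
      also have "\<dots> = ennreal (2 * real n powr p * (2 * C / real n)) * ennreal (absint (\<lambda>x. v x - U x) 0 (2 * pi) powr p)"
        using C by (simp add: ennreal_mult'[symmetric] mult_ac)
      also have "\<dots> \<le> ennreal (2 * real n powr p * (2 * C / real n)) * (ennreal (8 * real n) * ?A)"
        by (intro mult_left_mono absint_period_le_amalgam assms L1per_diff Lv LU n) auto
      also have "\<dots> = ennreal (2 * real n powr p * (2 * C / real n) * (8 * real n)) * ?A"
        using C by (simp only: mult.assoc[symmetric]) (subst ennreal_mult'[symmetric], auto)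
      also have "2 * real n powr p * (2 * C / real n) * (8 * real n) = 32 * C * real n powr p"
        using n by simp
      finally show ?thesis .
    qed
    have trig: "(\<lambda>x. U x - dv V x) \<in> trig_polys n"
      by (intro trig_poly_diff U trig_poly_dv V)
    have sub: "adist p n v (dv V) \<le> ?A + adist p n U (dv V)"
      by (intro amalgam_diff_le assms Lv LU L1per_trig[OF trig_poly_dv(1)[OF V]])
    have "adist p n U (dv V) \<le> ennreal (D * real n powr (- p)) * (ennreal (32 * C * real n powr p) * ?A)"
      using amalT n trig 1 by (meson mult_left_mono order_trans zero_le)
    also have "\<dots> = ennreal (D * (32 * C)) * ?A"
    proof -
      have "real n powr (- p) * real n powr p = 1" using n by (simp add: powr_add[symmetric])
      moreover have "(D * real n powr (- p)) * (32 * C * real n powr p)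
          = D * (32 * C) * (real n powr (- p) * real n powr p)"
        by (simp only: mult_ac)
      ultimately have e: "(D * real n powr (- p)) * (32 * C * real n powr p) = D * (32 * C)"
        by (metis mult_1_right)
      have nn: "0 \<le> D * real n powr (- p)" using D by simp
      show ?thesis by (simp only: ennreal_mult_assoc[OF nn] e)
    qed
    finally have "adist p n v (dv V) \<le> ?A + ennreal (D * (32 * C)) * ?A"
      using sub by (meson add_left_mono order_trans)
    also have "?A + ennreal (D * (32 * C)) * ?A = ennreal (1 + D * (32 * C)) * ?A"
      using C D by (simp add: distrib_right)
    finally show ?thesis using 1 V by blast
  qed
  show ?thesis
  proof (rule exI[of _ "1 + D * (32 * C) + 32 * C"], intro conjI allI impI)
    show "0 < 1 + D * (32 * C) + 32 * C" using C D by (simp add: add_pos_pos)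
    fix n w v U assume *: "1 \<le> (n::nat)" "primitive w v" "U \<in> trig_polys n"
    let ?A = "adist p n v U"
    obtain V where V: "V \<in> trig_polys n" "pdist p U (dv V) \<le> ennreal (32 * C * real n powr p) * ?A"
      "adist p n v (dv V) \<le> ennreal (1 + D * (32 * C)) * ?A"
      using main[OF *] by blast
    have "ennreal (32 * C * real n powr p) * ?A \<le> ennreal ((1 + D * (32 * C) + 32 * C) * real n powr p) * ?A"
      using C D by (intro mult_right_mono ennreal_leI) auto
    moreover have "ennreal (1 + D * (32 * C)) * ?A \<le> ennreal (1 + D * (32 * C) + 32 * C) * ?A"
      using C D by (intro mult_right_mono ennreal_leI) auto
    ultimately show "\<exists>V\<in>trig_polys n. pdist p U (dv V)
        \<le> ennreal ((1 + D * (32 * C) + 32 * C) * real n powr p) * ?A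
      \<and> adist p n v (dv V) \<le> ennreal (1 + D * (32 * C) + 32 * C) * ?A"
      using V by (meson order_trans)
  qed
qed

text \<open>Quality of \<open>V\<close> as an approximant of \<open>w\<close>, relative to the error of \<open>U\<close> as an approximant of
  the \<open>r\<close>-th derivative \<open>v\<close> of \<open>w\<close>. The bound for \<open>w - V\<close> in \<open>L\<^sub>p\<close> exceeds that in the
  amalgam by the factor \<open>n powr p\<close> because the windows have length \<open>1 / n\<close>.\<close>

definition approx_bounds :: "real \<Rightarrow> nat \<Rightarrow> real \<Rightarrow> nat \<Rightarrow> (real \<Rightarrow> complex) \<Rightarrow> (real \<Rightarrow> complex) \<Rightarrow>
    (real \<Rightarrow> complex) \<Rightarrow> (real \<Rightarrow> complex) \<Rightarrow> bool" where
  "approx_bounds p r C n w v U V \<longleftrightarrow>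
     pdist p w V
       \<le> ennreal (C * real n powr p / (real n powr p) ^ r) * adist p n v U \<and>
     pdist p ((dv ^^ r) V) U \<le> ennreal (C * real n powr p) * adist p n v U \<and>
     adist p n w V
       \<le> ennreal (C / (real n powr p) ^ r) * adist p n v U"

text \<open>Let \<open>V0\<close> be a primitive of the corrected \<open>U\<close> and let \<open>S\<close> be the quasi-interpolant of
  \<open>H = w - V0\<close>; then \<open>V = V0 + S\<close>. The amalgam of \<open>w - V = H - S\<close> follows from its \<open>L\<^sub>p\<close>
  bound and the amalgam of its derivative by \<open>amalgam_primitive_le\<close>.\<close>

lemma primitive_step:
  assumes "0 < p" "p \<le> 1"
  shows "\<exists>C>0. \<forall>n\<ge>1. \<forall>w v U. primitive w v \<longrightarrow> U \<in> trig_polys n \<longrightarrow>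
    (\<exists>V\<in>trig_polys n. approx_bounds p 1 C n w v U V)"
proof -
  obtain A where A: "0 < A" and mc: "\<forall>n\<ge>1. \<forall>w v U. primitive w v \<longrightarrow> U \<in> trig_polys n \<longrightarrow>
    (\<exists>V\<in>trig_polys n. pdist p U (dv V) \<le> ennreal (A * real n powr p) * adist p n v U
      \<and> adist p n v (dv V) \<le> ennreal A * adist p n v U)"
    using mean_correction[OF assms] by blast
  obtain B0 where B0: "0 < B0" and qi0: "\<forall>n\<ge>1. \<forall>H h. primitive H h \<longrightarrow>
    (\<exists>S\<in>trig_polys n. pdist p H S \<le> ennreal B0 * amalgam p (1 / real n) h)"
    using quasi_interpolation[OF assms] by blast
  define B where "B = B0 + 1"
  have B: "1 \<le> B" using B0 by (simp add: B_def)
  have qi: "\<exists>S\<in>trig_polys n. pdist p H S \<le> ennreal B * amalgam p (1 / real n) h"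
    if "1 \<le> n" "primitive H h" for n H h
  proof -
    have "ennreal B0 * amalgam p (1 / real n) h \<le> ennreal B * amalgam p (1 / real n) h"
      unfolding B_def by (intro mult_right_mono ennreal_leI) auto
    then show ?thesis using qi0 that by (meson order_trans)
  qed
  obtain D where D: "0 < D" and qd: "\<forall>n\<ge>1. \<forall>H h S A. primitive H h \<longrightarrow> S \<in> trig_polys n \<longrightarrow> 1 \<le> A \<longrightarrow>
    pdist p H S \<le> ennreal A * amalgam p (1 / real n) h \<longrightarrow>
    pint p (dv S) \<le> ennreal (D * A * real n powr p) * amalgam p (1 / real n) h"
    using quasi_interpolation_dv[OF assms] by blast
  obtain E where E: "0 < E" and amalT:
    "\<forall>n\<ge>1. \<forall>T\<in>trig_polys n. amalgam p (1 / real n) T \<le> ennreal (E * real n powr (- p)) * pint p T"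
    using amalgam_trig_le[OF assms] by blast
  define C where "C = B * A + (D * B * A + A) + (B + 1 + E * D * B) * A"
  have parts: "0 \<le> B * A" "0 \<le> D * B * A + A" "0 \<le> (B + 1 + E * D * B) * A"
    using A B D E by auto
  have C: "0 < C" using parts A B D E by (simp add: C_def add_pos_pos add_pos_nonneg)
  have Cge: "B * A \<le> C" "D * B * A + A \<le> C" "(B + 1 + E * D * B) * A \<le> C"
    using parts unfolding C_def by linarith+
  show ?thesis
  proof (rule exI[of _ C], intro conjI C allI impI)
    fix n w v U assume n: "1 \<le> (n::nat)" and w: "primitive w v" and U: "U \<in> trig_polys n"
    let ?A = "adist p n v U"
    obtain V0 where V0: "V0 \<in> trig_polys n"
      "pdist p U (dv V0) \<le> ennreal (A * real n powr p) * ?A"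
      "adist p n v (dv V0) \<le> ennreal A * ?A"
      using mc n w U by blast
    define H where "H = (\<lambda>x. w x - V0 x)"
    define h where "h = (\<lambda>x. v x - dv V0 x)"
    let ?h = "amalgam p (1 / real n) h"
    have H: "primitive H h" unfolding H_def h_def by (intro primitive_diff w primitive_trig[OF V0(1)])
    have hA: "?h \<le> ennreal A * ?A" using V0(3) by (simp add: h_def)
    obtain S where S: "S \<in> trig_polys n" "pdist p H S \<le> ennreal B * ?h"
      using qi[OF n H] by blast
    have dS: "pint p (dv S) \<le> ennreal (D * B * real n powr p) * ?h"
      using qd n H S B by blast
    have dSt: "dv S \<in> trig_polys n" "dv V0 \<in> trig_polys n" using S V0 by (auto intro: trig_poly_dv)
    define V where "V = (\<lambda>x. V0 x + S x)"
    have V: "V \<in> trig_polys n" unfolding V_def by (intro trig_poly_add V0 S)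
    have dvV: "dv V = (\<lambda>x. dv V0 x + dv S x)"
    proof
      fix x
      have "(V has_vector_derivative dv V0 x + dv S x) (at x)"
        unfolding V_def
        by (intro has_vector_derivative_add trig_poly_dv(2)[OF V0(1)] trig_poly_dv(2)[OF S(1)])
      then show "dv V x = dv V0 x + dv S x" unfolding dv_def[of V] by (rule vector_derivative_at)
    qed
    have wV: "(\<lambda>x. w x - V x) = (\<lambda>x. H x - S x)" by (simp add: V_def H_def fun_eq_iff)
    have up: "ennreal c * ?h \<le> ennreal (c * A) * ?A" if "0 \<le> c" for c
    proof -
      have "ennreal c * ?h \<le> ennreal c * (ennreal A * ?A)" by (intro mult_left_mono hA) auto
      then show ?thesis using that A by (simp add: ennreal_mult mult.assoc)
    qed
    have 1: "pdist p w V \<le> ennreal C * ?A"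
    proof -
      have "pdist p w V \<le> ennreal (B * A) * ?A"
        unfolding wV using S(2) up[of B] B by (meson order_trans zero_le_one)
      also have "\<dots> \<le> ennreal C * ?A" by (intro mult_right_mono ennreal_leI Cge) auto
      finally show ?thesis .
    qed
    have 2: "pdist p (dv V) U \<le> ennreal (C * real n powr p) * ?A"
    proof -
      have "pdist p (dv V) U = pint p (\<lambda>x. dv S x + (dv V0 x - U x))"
        unfolding dvV by (simp add: algebra_simps)
      also have "\<dots> \<le> pint p (dv S) + pdist p (dv V0) U"
        using trig_poly_measurable[OF dSt(1)] trig_poly_measurable[OF dSt(2)] trig_poly_measurable[OF U]
        by (intro pint_add_le assms) auto
      also have "\<dots> \<le> ennreal (D * B * real n powr p * A) * ?A + ennreal (A * real n powr p) * ?A"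
        using order_trans[OF dS up[of "D * B * real n powr p"]] D B V0(2)
        by (intro add_mono) (auto simp: pint_commute[of p U])
      also have "\<dots> = ennreal ((D * B * A + A) * real n powr p) * ?A"
        using A B D by (subst distrib_right[symmetric], subst ennreal_plus[symmetric]) (auto simp: algebra_simps)
      also have "\<dots> \<le> ennreal (C * real n powr p) * ?A"
        by (intro mult_right_mono ennreal_leI Cge) auto
      finally show ?thesis .
    qed
    have 3: "adist p n w V \<le> ennreal (C * real n powr (- p)) * ?A"
    proof -
      have Lh: "L1per h" using H by (simp add: primitive_def)
      have "amalgam p (1 / real n) (dv S) \<le> ennreal (E * real n powr (- p)) * (ennreal (D * B * real n powr p) * ?h)"
        using amalT n dSt(1) dS by (meson mult_left_mono order_trans zero_le)
      also have "\<dots> = ennreal (E * D * B) * ?h"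
      proof -
        have "real n powr (- p) * real n powr p = 1" using n by (simp add: powr_add[symmetric])
        moreover have "(E * real n powr (- p)) * (D * B * real n powr p)
            = E * D * B * (real n powr (- p) * real n powr p)"
          by (simp only: mult_ac)
        ultimately have e: "(E * real n powr (- p)) * (D * B * real n powr p) = E * D * B"
          by (metis mult_1_right)
        have nn: "0 \<le> E * real n powr (- p)" using E by simp
        show ?thesis by (simp only: ennreal_mult_assoc[OF nn] e)
      qed
      finally have aS: "amalgam p (1 / real n) (dv S) \<le> ennreal (E * D * B) * ?h" .
      have "adist p n h (dv S) \<le> ?h + amalgam p (1 / real n) (\<lambda>x. 0 - dv S x)"
        using amalgam_diff_le[OF assms Lh L1per_trig[OF trig_poly_const[of 0]] L1per_trig[OF dSt(1)]] by simp
      also have "\<dots> = ?h + amalgam p (1 / real n) (dv S)"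
        using amalgam_commute[of p "1 / real n" "\<lambda>x. 0" "dv S"] by simp
      also have "\<dots> \<le> ?h + ennreal (E * D * B) * ?h" by (intro add_left_mono aS)
      finally have ah: "adist p n h (dv S) \<le> ?h + ennreal (E * D * B) * ?h" .
      have "adist p n w V
          \<le> ennreal ((1 / real n) powr p) * (pdist p H S + adist p n h (dv S))"
        unfolding wV using n by (intro amalgam_primitive_le assms primitive_diff H primitive_trig[OF S(1)]) auto
      also have "\<dots> \<le> ennreal (real n powr (- p)) * (ennreal B * ?h + (?h + ennreal (E * D * B) * ?h))"
        using n by (intro mult_mono add_mono S ah) (auto simp: powr_divide powr_minus_divide)
      also have "\<dots> = ennreal (real n powr (- p)) * (ennreal (B + 1 + E * D * B) * ?h)"
        using B E D by (simp add: distrib_right add.assoc)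
      also have "\<dots> \<le> ennreal (real n powr (- p)) * (ennreal ((B + 1 + E * D * B) * A) * ?A)"
        using B E D by (intro mult_left_mono up) auto
      also have "\<dots> \<le> ennreal (real n powr (- p)) * (ennreal C * ?A)"
        by (intro mult_left_mono mult_right_mono ennreal_leI Cge) auto
      also have "\<dots> = ennreal (C * real n powr (- p)) * ?A"
        using C by (simp add: ennreal_mult mult_ac)
      finally show ?thesis .
    qed
    have "C * real n powr p / (real n powr p) ^ 1 = C" "C / (real n powr p) ^ 1 = C * real n powr (- p)"
      using n by (simp_all add: powr_minus_divide)
    then have "approx_bounds p 1 C n w v U V" using 1 2 3 by (simp add: approx_bounds_def)
    then show "\<exists>V\<in>trig_polys n. approx_bounds p 1 C n w v U V" using V by blast
  qed
qed

section \<open>Iterated primitives\<close>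

text \<open>One application of \<open>primitive_step\<close> for each order, starting with \<open>U\<close> and the highest
  derivative. The amalgam bound of one step is the hypothesis of the next.\<close>

lemma simultaneous_approx:
  assumes "0 < p" "p \<le> 1" "1 \<le> r"
  shows "\<exists>C>0. \<forall>n\<ge>1. \<forall>\<phi> U. (\<forall>j<r. primitive (\<phi> j) (\<phi> (Suc j))) \<longrightarrow> U \<in> trig_polys n \<longrightarrow>
    (\<exists>V\<in>trig_polys n. approx_bounds p r C n (\<phi> 0) (\<phi> r) U V)"
  using assms(3)
proof (induction r rule: nat_induct_at_least)
  case base
  obtain C where C: "0 < C" and step: "\<forall>n\<ge>1. \<forall>w v U. primitive w v \<longrightarrow> U \<in> trig_polys n \<longrightarrow>
    (\<exists>V\<in>trig_polys n. approx_bounds p 1 C n w v U V)"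
    using primitive_step[OF assms(1,2)] by blast
  show ?case
    by (rule exI[of _ C]) (use C step in simp)
next
  case (Suc r)
  obtain A where A: "0 < A" and step: "\<forall>n\<ge>1. \<forall>w v U. primitive w v \<longrightarrow> U \<in> trig_polys n \<longrightarrow>
    (\<exists>V\<in>trig_polys n. approx_bounds p 1 A n w v U V)"
    using primitive_step[OF assms(1,2)] by blast
  obtain B where B: "0 < B" and bern:
    "\<forall>n\<ge>1. \<forall>T\<in>trig_polys n. \<forall>k. pint p ((dv ^^ k) T) \<le> ennreal ((B * real n powr p) ^ k) * pint p T"
    using bernstein_iter[OF assms(1,2)] by blast
  obtain C where C: "0 < C" and IH: "\<forall>n\<ge>1. \<forall>\<phi> U. (\<forall>j<r. primitive (\<phi> j) (\<phi> (Suc j))) \<longrightarrow> U \<in> trig_polys n \<longrightarrow>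
    (\<exists>V\<in>trig_polys n. approx_bounds p r C n (\<phi> 0) (\<phi> r) U V)"
    using Suc.IH by blast
  define K where "K = A * C + (B ^ r * A * C + C)"
  have K: "0 < K" "A * C \<le> K" "B ^ r * A * C + C \<le> K"
    using A B C by (auto simp: K_def add_pos_pos)
  show ?case
  proof (rule exI[of _ K], intro conjI K(1) allI impI)
    fix n \<phi> U assume n: "1 \<le> (n::nat)" and \<phi>: "\<forall>j<Suc r. primitive (\<phi> j) (\<phi> (Suc j))"
      and U: "U \<in> trig_polys n"
    define q where "q = real n powr p"
    have q: "0 < q" using n by (simp add: q_def)
    let ?A = "adist p n (\<phi> (Suc r)) U"
    have "\<forall>j<r. primitive ((\<lambda>j. \<phi> (Suc j)) j) ((\<lambda>j. \<phi> (Suc j)) (Suc j))" using \<phi> by auto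
    then have "\<exists>V\<in>trig_polys n. approx_bounds p r C n (\<phi> (Suc 0)) (\<phi> (Suc r)) U V"
      using IH[rule_format, of n "\<lambda>j. \<phi> (Suc j)" U] n U by simp
    then obtain W where W: "W \<in> trig_polys n" "pdist p ((dv ^^ r) W) U \<le> ennreal (C * q) * ?A"
      "adist p n (\<phi> (Suc 0)) W \<le> ennreal (C / q ^ r) * ?A"
      unfolding approx_bounds_def q_def by blast
    have "primitive (\<phi> 0) (\<phi> (Suc 0))" using \<phi> by simp
    then obtain V where V: "V \<in> trig_polys n" "approx_bounds p 1 A n (\<phi> 0) (\<phi> (Suc 0)) W V"
      using step[rule_format, OF n _ W(1), of "\<phi> 0" "\<phi> (Suc 0)"] by blast
    have "A * q / q ^ 1 = A" "A / q ^ 1 = A * (1 / q)" using q by simp_all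
    with V(2) have V':
      "pdist p (\<phi> 0) V \<le> ennreal A * adist p n (\<phi> (Suc 0)) W"
      "pdist p (dv V) W \<le> ennreal (A * q) * adist p n (\<phi> (Suc 0)) W"
      "adist p n (\<phi> 0) V \<le> ennreal (A * (1 / q)) * adist p n (\<phi> (Suc 0)) W"
      unfolding approx_bounds_def q_def[symmetric] by simp_all
    have up: "ennreal c * adist p n (\<phi> (Suc 0)) W \<le> ennreal (c * (C / q ^ r)) * ?A"
      if "0 \<le> c" for c
    proof -
      have "ennreal c * adist p n (\<phi> (Suc 0)) W \<le> ennreal c * (ennreal (C / q ^ r) * ?A)"
        by (intro mult_left_mono W(3)) auto
      also have "\<dots> = ennreal (c * (C / q ^ r)) * ?A" using that by (subst ennreal_mult') (auto simp: mult.assoc)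
      finally show ?thesis .
    qed
    have 1: "pdist p (\<phi> 0) V \<le> ennreal (K * q / q ^ Suc r) * ?A"
    proof -
      have "pdist p (\<phi> 0) V \<le> ennreal (A * (C / q ^ r)) * ?A"
        using V'(1) up[of A] A by (meson less_imp_le order_trans)
      also have "\<dots> \<le> ennreal (K * q / q ^ Suc r) * ?A"
        using q K(2) by (intro mult_right_mono ennreal_leI) (auto simp: divide_right_mono)
      finally show ?thesis .
    qed
    have 3: "adist p n (\<phi> 0) V \<le> ennreal (K / q ^ Suc r) * ?A"
    proof -
      have "adist p n (\<phi> 0) V \<le> ennreal (A * (1 / q) * (C / q ^ r)) * ?A"
        using V'(3) up[of "A * (1 / q)"] A q by (meson less_imp_le order_trans divide_nonneg_nonneg mult_nonneg_nonneg zero_le_one)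
      also have "A * (1 / q) * (C / q ^ r) = A * C / q ^ Suc r" by simp
      also have "ennreal (A * C / q ^ Suc r) * ?A \<le> ennreal (K / q ^ Suc r) * ?A"
        using q K(2) by (intro mult_right_mono ennreal_leI divide_right_mono) auto
      finally show ?thesis .
    qed
    have 2: "pdist p ((dv ^^ Suc r) V) U \<le> ennreal (K * q) * ?A"
    proof -
      have dV: "dv V \<in> trig_polys n" by (rule trig_poly_dv[OF V(1)])
      have dif: "(\<lambda>x. dv V x - W x) \<in> trig_polys n" by (intro trig_poly_diff dV W)
      have "pint p (\<lambda>x. (dv ^^ r) (dv V) x - (dv ^^ r) W x) \<le> ennreal ((B * q) ^ r) * pdist p (dv V) W"
        using bern n dif unfolding dv_iter_trig_diff[OF dV W(1), symmetric] q_def by blast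
      also have "\<dots> \<le> ennreal ((B * q) ^ r) * (ennreal (A * q * (C / q ^ r)) * ?A)"
        using order_trans[OF V'(2) up[of "A * q"]] A q by (intro mult_left_mono) auto
      also have "\<dots> = ennreal ((B * q) ^ r * (A * q * (C / q ^ r))) * ?A"
        using B q by (subst ennreal_mult') (auto simp: mult.assoc)
      also have "(B * q) ^ r * (A * q * (C / q ^ r)) = B ^ r * A * C * q"
        using q by (simp add: power_mult_distrib field_simps)
      finally have d: "pint p (\<lambda>x. (dv ^^ r) (dv V) x - (dv ^^ r) W x) \<le> ennreal (B ^ r * A * C * q) * ?A" .
      have "pdist p ((dv ^^ Suc r) V) U = pint p (\<lambda>x. (dv ^^ r) (dv V) x - U x)"
        unfolding funpow_Suc_right o_apply ..
      also have "\<dots> \<le> pint p (\<lambda>x. (dv ^^ r) (dv V) x - (dv ^^ r) W x) + pdist p ((dv ^^ r) W) U"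
        by (intro pint_diff_le assms(1,2) trig_poly_measurable[OF trig_poly_dv_iter[OF dV]]
            trig_poly_measurable[OF trig_poly_dv_iter[OF W(1)]] trig_poly_measurable[OF U])
      also have "\<dots> \<le> ennreal (B ^ r * A * C * q) * ?A + ennreal (C * q) * ?A"
        by (intro add_mono d W(2))
      also have "\<dots> = ennreal ((B ^ r * A * C + C) * q) * ?A"
        using A B C q by (subst distrib_right[symmetric], subst ennreal_plus[symmetric]) (auto simp: algebra_simps)
      also have "\<dots> \<le> ennreal (K * q) * ?A"
        using q K(3) by (intro mult_right_mono ennreal_leI) auto
      finally show ?thesis .
    qed
    have "approx_bounds p (Suc r) K n (\<phi> 0) (\<phi> (Suc r)) U V"
      using 1 2 3 unfolding approx_bounds_def q_def by blast
    then show "\<exists>V\<in>trig_polys n. approx_bounds p (Suc r) K n (\<phi> 0) (\<phi> (Suc r)) U V" using V(1) by blast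
  qed
qed

section \<open>Variation over open sets\<close>

definition interval_families :: "real set \<Rightarrow> (real \<times> real) set set" where
  "interval_families G = {P. finite P \<and> (\<forall>I\<in>P. fst I < snd I \<and> {fst I<..<snd I} \<subseteq> G) \<and>
     disjoint_family_on (\<lambda>I. {fst I<..<snd I}) P}"

text \<open>For an absolutely continuous \<open>\<phi>\<close> this set function is small on sets of small measure,
  by the very definition of absolute continuity (\<open>abs_cont_variation\<close>). Allowing arbitrary sets instead of
  intervals makes superadditivity a mere union of families.\<close>

definition variation :: "(real \<Rightarrow> real) \<Rightarrow> real set \<Rightarrow> ennreal" where
  "variation \<phi> G = (SUP P\<in>interval_families G. ennreal (\<Sum>I\<in>P. \<bar>\<phi> (snd I) - \<phi> (fst I)\<bar>))"

lemma interval_families_empty: "{} \<in> interval_families G"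
  by (simp add: interval_families_def disjoint_family_on_def)

lemma interval_families_mono: "G \<subseteq> H \<Longrightarrow> interval_families G \<subseteq> interval_families H"
  by (auto simp: interval_families_def)

lemma variation_mono: "G \<subseteq> H \<Longrightarrow> variation \<phi> G \<le> variation \<phi> H"
  unfolding variation_def by (intro SUP_subset_mono interval_families_mono) auto

lemma variation_upper:
  "P \<in> interval_families G \<Longrightarrow> ennreal (\<Sum>I\<in>P. \<bar>\<phi> (snd I) - \<phi> (fst I)\<bar>) \<le> variation \<phi> G"
  unfolding variation_def by (rule SUP_upper)

lemma interval_families_Un:
  assumes P: "P \<in> interval_families G" and Q: "Q \<in> interval_families H" and GH: "G \<inter> H = {}"
  shows "P \<union> Q \<in> interval_families (G \<union> H)" "P \<inter> Q = {}"
proof -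
  have ne: "{fst I<..<snd I} \<noteq> {}" if "I \<in> P" for I
    using that P by (auto simp: interval_families_def)
  have cross: "{fst I<..<snd I} \<inter> {fst K<..<snd K} = {}" if "I \<in> P" "K \<in> Q" for I K
    using that P Q GH by (fastforce simp: interval_families_def)
  show "P \<inter> Q = {}" using ne cross by (metis Int_absorb disjoint_iff)
  have "disjoint_family_on (\<lambda>I. {fst I<..<snd I}) (P \<union> Q)"
    unfolding disjoint_family_on_def
  proof (intro ballI impI)
    fix I K assume "I \<in> P \<union> Q" "K \<in> P \<union> Q" "I \<noteq> K"
    then show "{fst I<..<snd I} \<inter> {fst K<..<snd K} = {}"
      using P Q cross[of I K] cross[of K I] by (auto simp: interval_families_def disjoint_family_on_def)
  qed
  then show "P \<union> Q \<in> interval_families (G \<union> H)" using P Q by (auto simp: interval_families_def)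
qed

lemma variation_superadditive:
  assumes "G \<inter> H = {}"
  shows "variation \<phi> G + variation \<phi> H \<le> variation \<phi> (G \<union> H)"
proof -
  let ?v = "\<lambda>P. \<Sum>I\<in>P. \<bar>\<phi> (snd I) - \<phi> (fst I)\<bar>"
  have "ennreal (?v P) + ennreal (?v Q) \<le> variation \<phi> (G \<union> H)" if "P \<in> interval_families G" "Q \<in> interval_families H" for P Q
  proof -
    have "finite P" "finite Q" using that by (auto simp: interval_families_def)
    then have "?v (P \<union> Q) = ?v P + ?v Q"
      using interval_families_Un(2)[OF that assms] by (intro sum.union_disjoint) auto
    then show ?thesis
      using variation_upper[OF interval_families_Un(1)[OF that assms], of \<phi>]
      by (simp add: sum_nonneg ennreal_plus[symmetric] del: ennreal_plus)
  qed
  then have "ennreal (?v P) + variation \<phi> H \<le> variation \<phi> (G \<union> H)" if "P \<in> interval_families G" for P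
    unfolding variation_def[of \<phi> H] using that interval_families_empty
    by (subst ennreal_SUP_add_right) (auto intro!: SUP_least)
  then show ?thesis
    unfolding variation_def[of \<phi> G] using interval_families_empty
    by (subst ennreal_SUP_add_left[symmetric]) (auto intro!: SUP_least)
qed

lemma variation_empty: "variation \<phi> {} = 0"
proof -
  have "interval_families {} = {{}}" using interval_families_empty by (auto simp: interval_families_def)
  then show ?thesis by (simp add: variation_def)
qed

lemma variation_sum_le:
  assumes "finite S" "disjoint_family_on G S"
  shows "(\<Sum>i\<in>S. variation \<phi> (G i)) \<le> variation \<phi> (\<Union>i\<in>S. G i)"
  using assms
proof (induction S rule: finite_induct)
  case (insert i S)
  have "G i \<inter> (\<Union>j\<in>S. G j) = {}"
    using insert by (auto simp: disjoint_family_on_def)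
  then have "variation \<phi> (G i) + variation \<phi> (\<Union>j\<in>S. G j) \<le> variation \<phi> (\<Union>j\<in>insert i S. G j)"
    using variation_superadditive by simp
  moreover have "(\<Sum>j\<in>S. variation \<phi> (G j)) \<le> variation \<phi> (\<Union>j\<in>S. G j)"
    using insert by (auto simp: disjoint_family_on_def)
  ultimately show ?case using insert by (simp add: add_left_mono order_trans[rotated])
qed (simp add: variation_empty)

text \<open>The point \<open>y\<close> lies in at most one interval of a family; cut that interval at \<open>y\<close>.\<close>

lemma variation_split:
  assumes "x \<le> y" "y \<le> z"
  shows "variation \<phi> {x<..<z} \<le> variation \<phi> {x<..<y} + variation \<phi> {y<..<z}"
  unfolding variation_def[of \<phi> "{x<..<z}"]
proof (rule SUP_least)
  fix P assume P: "P \<in> interval_families {x<..<z}"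
  let ?d = "\<lambda>I. \<bar>\<phi> (snd I) - \<phi> (fst I)\<bar>"
  have fin: "finite P" and lt: "\<And>I. I \<in> P \<Longrightarrow> fst I < snd I"
    and sub: "\<And>I. I \<in> P \<Longrightarrow> {fst I<..<snd I} \<subseteq> {x<..<z}"
    and dis: "\<And>I K. I \<in> P \<Longrightarrow> K \<in> P \<Longrightarrow> I \<noteq> K \<Longrightarrow> {fst I<..<snd I} \<inter> {fst K<..<snd K} = {}"
    using P by (auto simp: interval_families_def disjoint_family_on_def)
  define l where "l I = (fst I, min (snd I) y)" for I :: "real \<times> real"
  define r where "r I = (max (fst I) y, snd I)" for I :: "real \<times> real"
  define P1 where "P1 = {I\<in>P. fst I < y}"
  define P2 where "P2 = {I\<in>P. y < snd I}"
  have end1: "x \<le> fst I" "snd I \<le> z" if "I \<in> P" for I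
    using sub[OF that] lt[OF that] by (auto simp: greaterThanLessThan_subseteq_greaterThanLessThan)
  have sub_l: "{fst (l I)<..<snd (l I)} \<subseteq> {fst I<..<snd I}" for I by (auto simp: l_def)
  have sub_r: "{fst (r I)<..<snd (r I)} \<subseteq> {fst I<..<snd I}" for I by (auto simp: r_def)
  have lt_l: "fst (l I) < snd (l I)" if "I \<in> P1" for I using that lt by (auto simp: l_def P1_def)
  have lt_r: "fst (r I) < snd (r I)" if "I \<in> P2" for I using that lt by (auto simp: r_def P2_def)
  have inj_l: "inj_on l P1"
  proof (rule inj_onI, rule ccontr)
    fix I K assume *: "I \<in> P1" "K \<in> P1" "l I = l K" "I \<noteq> K"
    have "{fst (l I)<..<snd (l I)} \<subseteq> {fst I<..<snd I} \<inter> {fst K<..<snd K}"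
      using sub_l[of I] sub_l[of K] unfolding *(3) by (intro Int_greatest)
    then have "{fst (l I)<..<snd (l I)} \<subseteq> {}"
      using dis[of I K] * by (simp add: P1_def)
    then show False using lt_l[OF *(1)] by auto
  qed
  have inj_r: "inj_on r P2"
  proof (rule inj_onI, rule ccontr)
    fix I K assume *: "I \<in> P2" "K \<in> P2" "r I = r K" "I \<noteq> K"
    have "{fst (r I)<..<snd (r I)} \<subseteq> {fst I<..<snd I} \<inter> {fst K<..<snd K}"
      using sub_r[of I] sub_r[of K] unfolding *(3) by (intro Int_greatest)
    then have "{fst (r I)<..<snd (r I)} \<subseteq> {}"
      using dis[of I K] * by (simp add: P2_def)
    then show False using lt_r[OF *(1)] by auto
  qed
  have "l ` P1 \<in> interval_families {x<..<y}"
    unfolding interval_families_def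
  proof (intro CollectI conjI ballI)
    show "finite (l ` P1)" using fin by (simp add: P1_def)
    show "disjoint_family_on (\<lambda>I. {fst I<..<snd I}) (l ` P1)"
      unfolding disjoint_family_on_def
    proof (intro ballI impI)
      fix A B assume "A \<in> l ` P1" "B \<in> l ` P1" "A \<noteq> B"
      then obtain I K where *: "A = l I" "B = l K" "I \<in> P1" "K \<in> P1" "I \<noteq> K" by auto
      then have "{fst I<..<snd I} \<inter> {fst K<..<snd K} = {}" by (intro dis) (auto simp: P1_def)
      then show "{fst A<..<snd A} \<inter> {fst B<..<snd B} = {}"
        using sub_l[of I] sub_l[of K] unfolding * by blast
    qed
    fix A assume "A \<in> l ` P1"
    then obtain I where "A = l I" "I \<in> P1" by auto
    then show "fst A < snd A" "{fst A<..<snd A} \<subseteq> {x<..<y}"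
      using lt_l[of I] end1[of I] by (auto simp: l_def P1_def)
  qed
  note g1 = variation_upper[OF this, of \<phi>]
  have "r ` P2 \<in> interval_families {y<..<z}"
    unfolding interval_families_def
  proof (intro CollectI conjI ballI)
    show "finite (r ` P2)" using fin by (simp add: P2_def)
    show "disjoint_family_on (\<lambda>I. {fst I<..<snd I}) (r ` P2)"
      unfolding disjoint_family_on_def
    proof (intro ballI impI)
      fix A B assume "A \<in> r ` P2" "B \<in> r ` P2" "A \<noteq> B"
      then obtain I K where *: "A = r I" "B = r K" "I \<in> P2" "K \<in> P2" "I \<noteq> K" by auto
      then have "{fst I<..<snd I} \<inter> {fst K<..<snd K} = {}" by (intro dis) (auto simp: P2_def)
      then show "{fst A<..<snd A} \<inter> {fst B<..<snd B} = {}"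
        using sub_r[of I] sub_r[of K] unfolding * by blast
    qed
    fix A assume "A \<in> r ` P2"
    then obtain I where "A = r I" "I \<in> P2" by auto
    then show "fst A < snd A" "{fst A<..<snd A} \<subseteq> {y<..<z}"
      using lt_r[of I] end1[of I] by (auto simp: r_def P2_def)
  qed
  note g2 = variation_upper[OF this, of \<phi>]
  have s1: "sum ?d (l ` P1) = (\<Sum>I\<in>P. if fst I < y then ?d (l I) else 0)"
  proof -
    have "sum ?d (l ` P1) = (\<Sum>I\<in>P1. ?d (l I))" by (simp add: sum.reindex[OF inj_l])
    then show ?thesis unfolding P1_def using fin by (simp add: sum.inter_filter)
  qed
  have s2: "sum ?d (r ` P2) = (\<Sum>I\<in>P. if y < snd I then ?d (r I) else 0)"
  proof -
    have "sum ?d (r ` P2) = (\<Sum>I\<in>P2. ?d (r I))" by (simp add: sum.reindex[OF inj_r])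
    then show ?thesis unfolding P2_def using fin by (simp add: sum.inter_filter)
  qed
  have "sum ?d P \<le> sum ?d (l ` P1) + sum ?d (r ` P2)"
    unfolding s1 s2 sum.distrib[symmetric]
  proof (intro sum_mono)
    fix I assume "I \<in> P"
    from lt[OF this] show "?d I \<le> (if fst I < y then ?d (l I) else 0) + (if y < snd I then ?d (r I) else 0)"
      by (auto simp: l_def r_def min_def max_def)
  qed
  then have "ennreal (sum ?d P) \<le> ennreal (sum ?d (l ` P1)) + ennreal (sum ?d (r ` P2))"
    by (simp add: ennreal_plus[symmetric] sum_nonneg ennreal_leI del: ennreal_plus)
  also have "\<dots> \<le> variation \<phi> {x<..<y} + variation \<phi> {y<..<z}" by (intro add_mono g1 g2)
  finally show "ennreal (sum ?d P) \<le> variation \<phi> {x<..<y} + variation \<phi> {y<..<z}" .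
qed

definition abs_cont :: "(real \<Rightarrow> real) \<Rightarrow> bool" where
  "abs_cont \<phi> \<longleftrightarrow> (\<forall>\<epsilon>>0. \<exists>\<delta>>0. \<forall>N. \<forall>a b :: nat \<Rightarrow> real.
        (\<forall>i<N. 0 \<le> a i \<and> a i \<le> b i \<and> b i \<le> 2 * pi) \<and>
        disjoint_family_on (\<lambda>i. {a i<..<b i}) {..<N} \<and>
        (\<Sum>i<N. b i - a i) < \<delta>
        \<longrightarrow> (\<Sum>i<N. \<bar>\<phi> (b i) - \<phi> (a i)\<bar>) < \<epsilon>)"

lemma abs_cont_variation:
  assumes "abs_cont \<phi>" "0 < \<epsilon>"
  shows "\<exists>\<delta>>0. \<forall>G\<in>sets borel. G \<subseteq> {0<..<2*pi} \<longrightarrow> emeasure lborel G < ennreal \<delta> \<longrightarrow> variation \<phi> G \<le> ennreal \<epsilon>"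
proof -
  obtain \<delta> where \<delta>: "\<delta> > 0" and ac: "\<forall>N. \<forall>a b :: nat \<Rightarrow> real.
        (\<forall>i<N. 0 \<le> a i \<and> a i \<le> b i \<and> b i \<le> 2 * pi) \<and>
        disjoint_family_on (\<lambda>i. {a i<..<b i}) {..<N} \<and>
        (\<Sum>i<N. b i - a i) < \<delta>
        \<longrightarrow> (\<Sum>i<N. \<bar>\<phi> (b i) - \<phi> (a i)\<bar>) < \<epsilon>"
    using assms(1)[unfolded abs_cont_def, rule_format, OF assms(2)] by blast
  show ?thesis
  proof (intro exI[of _ \<delta>] conjI \<delta> ballI impI)
    fix G :: "real set" assume G: "G \<in> sets borel" "G \<subseteq> {0<..<2*pi}" "emeasure lborel G < ennreal \<delta>"
    show "variation \<phi> G \<le> ennreal \<epsilon>"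
      unfolding variation_def
    proof (rule SUP_least)
      fix P assume P: "P \<in> interval_families G"
      then have fin: "finite P" by (simp add: interval_families_def)
      have end1: "0 \<le> fst I \<and> fst I \<le> snd I \<and> snd I \<le> 2 * pi" if "I \<in> P" for I
      proof -
        have "fst I < snd I" "{fst I<..<snd I} \<subseteq> {0<..<2*pi}" using P that G(2) by (auto simp: interval_families_def)
        then show ?thesis by (auto simp: greaterThanLessThan_subseteq_greaterThanLessThan)
      qed
      obtain e where e: "bij_betw e {..<card P} P"
        using ex_bij_betw_nat_finite[OF fin] by (auto simp: atLeast0LessThan)
      have eP: "e i \<in> P" if "i < card P" for i using e that by (auto dest: bij_betwE)
      have "ennreal (\<Sum>I\<in>P. snd I - fst I) = (\<Sum>I\<in>P. emeasure lborel {fst I<..<snd I})"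
        using end1 by (subst sum_ennreal[symmetric]) (auto intro!: sum.cong)
      also have "\<dots> = emeasure lborel (\<Union>I\<in>P. {fst I<..<snd I})"
        using P fin by (intro sum_emeasure) (auto simp: interval_families_def)
      also have "\<dots> \<le> emeasure lborel G"
        using P G by (intro emeasure_mono) (auto simp: interval_families_def)
      also have "\<dots> < ennreal \<delta>" by (rule G)
      finally have len: "(\<Sum>I\<in>P. snd I - fst I) < \<delta>"
        using \<delta> by (simp add: ennreal_less_iff sum_nonneg end1)
      have "(\<Sum>i<card P. \<bar>\<phi> (snd (e i)) - \<phi> (fst (e i))\<bar>) < \<epsilon>"
      proof (rule ac[rule_format], intro conjI)
        show "\<forall>i<card P. 0 \<le> fst (e i) \<and> fst (e i) \<le> snd (e i) \<and> snd (e i) \<le> 2 * pi"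
          using eP end1 by blast
        show "disjoint_family_on (\<lambda>i. {fst (e i)<..<snd (e i)}) {..<card P}"
          unfolding disjoint_family_on_def
        proof (intro ballI impI)
          fix i j assume "i \<in> {..<card P}" "j \<in> {..<card P}" "i \<noteq> j"
          then have "e i \<in> P" "e j \<in> P" "e i \<noteq> e j"
            using eP e by (auto simp: bij_betw_def inj_on_def)
          then show "{fst (e i)<..<snd (e i)} \<inter> {fst (e j)<..<snd (e j)} = {}"
            using P by (auto simp: interval_families_def disjoint_family_on_def)
        qed
        show "(\<Sum>i<card P. snd (e i) - fst (e i)) < \<delta>"
          using sum.reindex_bij_betw[OF e, of "\<lambda>I. snd I - fst I"] len by simp
      qed
      then have "(\<Sum>I\<in>P. \<bar>\<phi> (snd I) - \<phi> (fst I)\<bar>) < \<epsilon>"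
        using sum.reindex_bij_betw[OF e, of "\<lambda>I. \<bar>\<phi> (snd I) - \<phi> (fst I)\<bar>"] by simp
      then show "ennreal (\<Sum>I\<in>P. \<bar>\<phi> (snd I) - \<phi> (fst I)\<bar>) \<le> ennreal \<epsilon>"
        by (intro ennreal_leI) simp
    qed
  qed
qed

text \<open>Cut the period into finitely many intervals so short that the variation over each is at
  most \<open>1\<close>.\<close>

lemma abs_cont_variation_finite:
  assumes "abs_cont \<phi>"
  shows "variation \<phi> {0<..<2*pi} < \<infinity>"
proof -
  obtain \<delta> where \<delta>: "\<delta> > 0" and ac: "\<And>G. G \<in> sets borel \<Longrightarrow> G \<subseteq> {0<..<2*pi} \<Longrightarrow>
      emeasure lborel G < ennreal \<delta> \<Longrightarrow> variation \<phi> G \<le> ennreal 1"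
    using abs_cont_variation[OF assms, of 1] by auto
  obtain K :: nat where K: "K > 0" "2 * pi / \<delta> < real K"
    using reals_Archimedean2[of "max 1 (2 * pi / \<delta>)"] by (metis max_less_iff_conj of_nat_0_less_iff zero_less_one less_trans)
  define h where "h = 2 * pi / real K"
  have h: "0 < h" "h < \<delta>" "real K * h = 2 * pi"
    using K \<delta> by (auto simp: h_def field_simps)
  have "variation \<phi> {0<..<real k * h} \<le> ennreal (real k)" if "k \<le> K" for k
    using that
  proof (induction k)
    case 0
    then show ?case by (simp add: variation_empty)
  next
    case (Suc k)
    have "real (Suc k) * h \<le> real K * h" using Suc.prems h by (intro mult_right_mono) auto
    then have le: "real (Suc k) * h \<le> 2 * pi" by (simp add: h)
    have "variation \<phi> {0<..<real (Suc k) * h} \<le> variation \<phi> {0<..<real k * h} + variation \<phi> {real k * h<..<real (Suc k) * h}"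
      using h by (intro variation_split) auto
    also have "\<dots> \<le> ennreal (real k) + ennreal 1"
    proof (intro add_mono Suc.IH ac)
      show "{real k * h<..<real (Suc k) * h} \<subseteq> {0<..<2*pi}"
      proof -
        have "0 \<le> real k * h" using h by simp
        then show ?thesis using le by auto
      qed
      show "emeasure lborel {real k * h<..<real (Suc k) * h} < ennreal \<delta>"
        using h by (simp add: algebra_simps ennreal_lessI)
    qed (use Suc.prems in auto)
    finally show ?case by (simp add: add.commute)
  qed
  from this[of K] show ?thesis unfolding h(3) by (simp add: le_less_trans)
qed

section \<open>Densities of absolutely continuous functions\<close>

text \<open>Every point of \<open>G\<close> lies in a grid cell contained in \<open>G\<close> as soon as the grid is fine enough,
  so by Fatou's lemma it suffices to bound the measure of the union of these cells. For that, sum the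
  bound for cells and use superadditivity of the variation.\<close>

lemma interval_measure_open_le:
  assumes mono: "\<And>x y. x \<le> y \<Longrightarrow> F x \<le> F y" and cont: "\<And>a. continuous (at_right a) F"
    and bd: "\<And>x y. x \<le> y \<Longrightarrow> ennreal (F y - F x) \<le> 2 * variation \<phi> ({x<..<y} \<inter> {0<..<2*pi})"
    and G: "open G" "G \<subseteq> {-K<..<K}"
  shows "emeasure (interval_measure F) G \<le> 2 * variation \<phi> (G \<inter> {0<..<2*pi})"
proof -
  define h where "h k = 1 / real (Suc k)" for k
  have h: "h k > 0" for k by (simp add: h_def)
  define cell where "cell k i = {of_int i * h k<..(of_int i + 1) * h k}" for k and i :: int
  define Is where "Is k = {i. cell k i \<subseteq> G}" for k
  define Gk where "Gk k = (\<Union>i\<in>Is k. cell k i)" for k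
  have cell_top: "(of_int i + 1) * h k \<in> cell k i" for k i
    using h[of k] by (simp add: cell_def mult_strict_right_mono)
  have finI: "finite (Is k)" for k
  proof (rule finite_subset)
    show "Is k \<subseteq> {- \<lceil>K / h k\<rceil> - 2..\<lceil>K / h k\<rceil> + 2}"
    proof
      fix i assume "i \<in> Is k"
      then have "(of_int i + 1) * h k \<in> {-K<..<K}" using cell_top[of i k] G by (auto simp: Is_def)
      then have "of_int i + 1 < K / h k" "- (K / h k) < of_int i + 1"
        using h[of k] by (auto simp: field_simps)
      then show "i \<in> {- \<lceil>K / h k\<rceil> - 2..\<lceil>K / h k\<rceil> + 2}"
        by (auto simp: le_ceiling_iff) linarith+
    qed
  qed simp
  have dis: "cell k i \<inter> cell k j = {}" if "i \<noteq> j" for k i j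
  proof -
    have "cell k i \<inter> cell k j = {}" if "i < j" for i j
    proof -
      have "of_int i + 1 \<le> (of_int j :: real)" using that by linarith
      then have "(of_int i + 1) * h k \<le> of_int j * h k" using h[of k] by (intro mult_right_mono) auto
      then show ?thesis by (auto simp: cell_def)
    qed
    then show ?thesis using \<open>i \<noteq> j\<close> by (metis Int_commute linorder_neqE)
  qed
  let ?M = "interval_measure F"
  have GkG: "Gk k \<subseteq> G" for k by (auto simp: Gk_def Is_def)
  have Gk_le: "emeasure ?M (Gk k) \<le> 2 * variation \<phi> (G \<inter> {0<..<2*pi})" for k
  proof -
    let ?o = "\<lambda>i. {of_int i * h k<..<(of_int i + 1) * h k} \<inter> {0<..<2*pi}"
    have oc: "?o i \<subseteq> cell k i" for i by (auto simp: cell_def)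
    have "emeasure ?M (Gk k) = (\<Sum>i\<in>Is k. emeasure ?M (cell k i))"
      unfolding Gk_def using finI dis
      by (intro sum_emeasure[symmetric]) (auto simp: disjoint_family_on_def cell_def)
    also have "\<dots> \<le> (\<Sum>i\<in>Is k. 2 * variation \<phi> (?o i))"
    proof (intro sum_mono)
      fix i
      have le: "of_int i * h k \<le> (of_int i + 1) * h k" using h[of k] by (intro mult_right_mono) auto
      show "emeasure ?M (cell k i) \<le> 2 * variation \<phi> (?o i)"
        unfolding cell_def using bd[OF le] emeasure_interval_measure_Ioc[OF le mono cont] by simp
    qed
    also have "\<dots> = 2 * (\<Sum>i\<in>Is k. variation \<phi> (?o i))" by (simp add: sum_distrib_left)
    also have "\<dots> \<le> 2 * variation \<phi> (\<Union>i\<in>Is k. ?o i)"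
    proof (intro mult_left_mono variation_sum_le finI)
      show "disjoint_family_on ?o (Is k)"
        unfolding disjoint_family_on_def using dis oc by blast
    qed simp
    also have "\<dots> \<le> 2 * variation \<phi> (G \<inter> {0<..<2*pi})"
    proof (intro mult_left_mono variation_mono)
      show "(\<Union>i\<in>Is k. ?o i) \<subseteq> G \<inter> {0<..<2*pi}"
        using oc GkG[of k] unfolding Gk_def by blast
    qed simp
    finally show ?thesis .
  qed
  have Gm: "G \<in> sets ?M" "Gk k \<in> sets ?M" for k
    using G finI by (auto simp: Gk_def cell_def)
  have ev: "\<forall>\<^sub>F k in sequentially. x \<in> Gk k" if x: "x \<in> G" for x
  proof -
    obtain e where e: "e > 0" "ball x e \<subseteq> G" using G(1) x by (auto simp: open_contains_ball)
    obtain k0 :: nat where k0: "1 / e < real k0" using reals_Archimedean2 by blast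
    have "x \<in> Gk k" if "k0 \<le> k" for k
    proof -
      have "1 / e < real (Suc k)" using k0 that by linarith
      then have he: "h k < e" using e(1) by (simp add: h_def field_simps)
      define i where "i = \<lceil>x / h k\<rceil> - 1"
      have "of_int i < x / h k" "x / h k \<le> of_int i + 1" unfolding i_def by linarith+
      then have ix: "of_int i * h k < x" "x \<le> (of_int i + 1) * h k" using h[of k] by (auto simp: field_simps)
      have "cell k i \<subseteq> ball x e"
        using ix he by (auto simp: cell_def dist_real_def abs_less_iff algebra_simps)
      then show ?thesis using e ix by (auto simp: Gk_def Is_def cell_def)
    qed
    then show ?thesis by (auto simp: eventually_sequentially)
  qed
  have "emeasure ?M G = (\<integral>\<^sup>+x. indicator G x \<partial>?M)" using Gm by simp
  also have "\<dots> \<le> (\<integral>\<^sup>+x. liminf (\<lambda>k. indicator (Gk k) x) \<partial>?M)"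
  proof (intro nn_integral_mono)
    fix x
    show "indicator G x \<le> liminf (\<lambda>k. indicator (Gk k) x :: ennreal)"
    proof (cases "x \<in> G")
      case True
      then show ?thesis
        by (intro Liminf_bounded eventually_mono[OF ev[OF True]]) auto
    qed simp
  qed
  also have "\<dots> \<le> liminf (\<lambda>k. \<integral>\<^sup>+x. indicator (Gk k) x \<partial>?M)"
    using Gm by (intro nn_integral_liminf) auto
  also have "\<dots> \<le> 2 * variation \<phi> (G \<inter> {0<..<2*pi})"
    using Gm Gk_le by (intro Liminf_le) auto
  finally show ?thesis .
qed

text \<open>A null set is contained in open sets of small measure, over which the variation is small.\<close>

lemma interval_measure_absolutely_continuous:
  assumes mono: "\<And>x y. x \<le> y \<Longrightarrow> F x \<le> F y" and cont: "\<And>a. continuous (at_right a) F"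
    and bd: "\<And>x y. x \<le> y \<Longrightarrow> ennreal (F y - F x) \<le> 2 * variation \<phi> ({x<..<y} \<inter> {0<..<2*pi})"
    and ac: "abs_cont \<phi>"
  shows "absolutely_continuous lborel (interval_measure F)"
  unfolding absolutely_continuous_def
proof
  fix N :: "real set" assume N: "N \<in> null_sets lborel"
  let ?M = "interval_measure F"
  have zero: "emeasure ?M (N \<inter> {-real K<..<real K}) = 0" for K :: nat
  proof -
    have small: "emeasure ?M (N \<inter> {-real K<..<real K}) \<le> 0 + ennreal e" if e: "0 < e" for e :: real
    proof -
      obtain \<delta> where \<delta>: "\<delta> > 0" and acd: "\<forall>G\<in>sets borel. G \<subseteq> {0<..<2*pi} \<longrightarrow>
          emeasure lborel G < ennreal \<delta> \<longrightarrow> variation \<phi> G \<le> ennreal (e / 2)"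
        using abs_cont_variation[OF ac, of "e / 2"] e by auto
      obtain U where U: "open U" "N \<subseteq> U" "emeasure lborel (U - N) < ennreal \<delta>"
      proof -
        have "N \<in> sets borel" using N by auto
        from outer_regular_lborel[OF this \<delta>] that show ?thesis by blast
      qed
      have "emeasure lborel (U \<inter> {-real K<..<real K} \<inter> {0<..<2*pi}) \<le> emeasure lborel (U - N \<union> N)"
        using N U by (intro emeasure_mono) auto
      also have "\<dots> = emeasure lborel (U - N)"
        using N U by (intro emeasure_Un_null_set) auto
      finally have "emeasure lborel (U \<inter> {-real K<..<real K} \<inter> {0<..<2*pi}) < ennreal \<delta>"
        using U by simp
      then have v: "variation \<phi> (U \<inter> {-real K<..<real K} \<inter> {0<..<2*pi}) \<le> ennreal (e / 2)"
        using U by (intro acd[rule_format]) auto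
      have "emeasure ?M (N \<inter> {-real K<..<real K}) \<le> emeasure ?M (U \<inter> {-real K<..<real K})"
        using U by (intro emeasure_mono) auto
      also have "\<dots> \<le> 2 * variation \<phi> (U \<inter> {-real K<..<real K} \<inter> {0<..<2*pi})"
        using U by (intro interval_measure_open_le[OF mono cont bd]) auto
      also have "\<dots> \<le> 2 * ennreal (e / 2)" by (intro mult_left_mono v) auto
      also have "\<dots> = 0 + ennreal e" using e by (simp add: ennreal_mult'[symmetric] flip: ennreal_numeral)
      finally show ?thesis .
    qed
    have "emeasure ?M (N \<inter> {-real K<..<real K}) \<le> 0"
      by (rule ennreal_le_epsilon) (rule small)
    then show ?thesis by simp
  qed
  have "N = (\<Union>K. N \<inter> {-real K<..<real K})"
  proof -
    have "\<exists>K::nat. x \<in> {-real K<..<real K}" for x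
    proof -
      obtain K :: nat where "\<bar>x\<bar> < real K" using reals_Archimedean2 by blast
      then show ?thesis by (intro exI[of _ K]) auto
    qed
    then show ?thesis by auto
  qed
  moreover have "(\<Union>K. N \<inter> {-real K<..<real K}) \<in> null_sets ?M"
    using N zero by (intro null_sets_UN null_setsI) auto
  ultimately show "N \<in> null_sets ?M" by simp
qed

lemma interval_measure_density:
  assumes mono: "\<And>x y. x \<le> y \<Longrightarrow> F x \<le> F y" and cont: "\<And>a. continuous (at_right a) F"
    and bd: "\<And>x y. x \<le> y \<Longrightarrow> ennreal (F y - F x) \<le> 2 * variation \<phi> ({x<..<y} \<inter> {0<..<2*pi})"
    and ac: "abs_cont \<phi>"
  shows "\<exists>g \<in> borel_measurable borel. (\<forall>x y. set_integrable lborel {x..y} g) \<and>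
     (\<forall>x y. x \<le> y \<longrightarrow> F y - F x = (LINT s:{x..y}|lborel. g s))"
proof -
  obtain f where f: "f \<in> borel_measurable lborel" "density lborel f = interval_measure F"
    using sigma_finite_measure.Radon_Nikodym[OF lborel.sigma_finite_measure_axioms interval_measure_absolutely_continuous[OF assms]] by auto
  have [measurable]: "f \<in> borel_measurable borel" using f by simp
  have nn: "(\<integral>\<^sup>+s\<in>{x..y}. f s \<partial>lborel) = ennreal (F y - F x)" if "x \<le> y" for x y
  proof -
    have "(\<integral>\<^sup>+s\<in>{x..y}. f s \<partial>lborel) = (\<integral>\<^sup>+s\<in>{x<..y}. f s \<partial>lborel)"
      by (intro nn_integral_cong_AE, use AE_lborel_singleton[of x] in eventually_elim)
        (auto simp: indicator_def)
    also have "\<dots> = emeasure (interval_measure F) {x<..y}"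
      unfolding f(2)[symmetric] by (subst emeasure_density) auto
    also have "\<dots> = ennreal (F y - F x)"
      by (rule emeasure_interval_measure_Ioc[OF that mono cont])
    finally show ?thesis .
  qed
  define g where "g s = enn2real (f s)" for s
  have gm [measurable]: "g \<in> borel_measurable borel" unfolding g_def by measurable
  have eq: "(\<integral>\<^sup>+s. ennreal (indicator {x..y} s *\<^sub>R g s) \<partial>lborel) = ennreal (F y - F x)" if "x \<le> y" for x y
  proof -
    have "AE s in lborel. f s * indicator {x..y} s \<noteq> \<infinity>"
      using nn[OF that] by (intro nn_integral_noteq_infinite) auto
    then have "(\<integral>\<^sup>+s. ennreal (indicator {x..y} s *\<^sub>R g s) \<partial>lborel) = (\<integral>\<^sup>+s\<in>{x..y}. f s \<partial>lborel)"
      by (intro nn_integral_cong_AE, eventually_elim) (auto simp: g_def indicator_def less_top)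
    then show ?thesis using nn[OF that] by simp
  qed
  have int: "set_integrable lborel {x..y} g" for x y
  proof (cases "x \<le> y")
    case True
    show ?thesis
      unfolding set_integrable_def
    proof (rule integrableI_nonneg)
      show "(\<integral>\<^sup>+s. ennreal (indicator {x..y} s *\<^sub>R g s) \<partial>lborel) < \<infinity>" unfolding eq[OF True] by simp
    qed (auto simp: g_def)
  next
    case False
    then show ?thesis by (simp add: set_integrable_def)
  qed
  have "F y - F x = (LINT s:{x..y}|lborel. g s)" if "x \<le> y" for x y
  proof -
    have "(LINT s:{x..y}|lborel. g s) = enn2real (ennreal (F y - F x))"
      unfolding set_lebesgue_integral_def eq[OF that, symmetric]
      by (rule integral_eq_nn_integral) (auto simp: g_def)
    then show ?thesis using mono[OF that] by simp
  qed
  with gm int show ?thesis by blast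
qed

text \<open>With the variation function \<open>V\<close> both \<open>V + \<phi>\<close> and \<open>V - \<phi>\<close> increase, and their increments
  are at most twice those of \<open>V\<close>. Hence both have densities, and half the difference of the densities is
  a density for \<open>\<phi>\<close>.\<close>

lemma abs_cont_density:
  assumes ac: "abs_cont \<phi>"
  shows "\<exists>g \<in> borel_measurable borel. (\<forall>x y. set_integrable lborel {x..y} g) \<and>
     (\<forall>x y. 0 \<le> x \<longrightarrow> x \<le> y \<longrightarrow> y \<le> 2 * pi \<longrightarrow> \<phi> y - \<phi> x = (LINT s:{x..y}|lborel. g s))"
proof -
  (* Interval measures need a function that is monotone on the whole line. *)
  define cl where "cl x = max 0 (min x (2 * pi))" for x :: real
  have cl: "0 \<le> cl x" "cl x \<le> 2 * pi" "x \<le> y \<Longrightarrow> cl x \<le> cl y" "x \<le> y \<Longrightarrow> cl y - cl x \<le> y - x" for x y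
    by (auto simp: cl_def)
  have cl_id: "cl x = x" if "0 \<le> x" "x \<le> 2 * pi" for x using that by (simp add: cl_def)
  define V where "V x = enn2real (variation \<phi> {0<..<cl x})" for x
  have fin: "variation \<phi> {0<..<cl x} < \<infinity>" for x
  proof -
    have "variation \<phi> {0<..<cl x} \<le> variation \<phi> {0<..<2*pi}" using cl[of x] by (intro variation_mono) auto
    then show ?thesis using abs_cont_variation_finite[OF ac] by simp
  qed
  have VV: "ennreal (V y - V x) = variation \<phi> {cl x<..<cl y} \<and> V x \<le> V y" if "x \<le> y" for x y
  proof -
    have "variation \<phi> {0<..<cl x} + variation \<phi> {cl x<..<cl y} \<le> variation \<phi> ({0<..<cl x} \<union> {cl x<..<cl y})"
      by (intro variation_superadditive) auto
    also have "\<dots> \<le> variation \<phi> {0<..<cl y}" using cl(1)[of x] cl(3)[OF that] by (intro variation_mono) auto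
    finally have 1: "variation \<phi> {0<..<cl x} + variation \<phi> {cl x<..<cl y} \<le> variation \<phi> {0<..<cl y}" .
    have 2: "variation \<phi> {0<..<cl y} \<le> variation \<phi> {0<..<cl x} + variation \<phi> {cl x<..<cl y}"
      using cl that by (intro variation_split) auto
    have e: "variation \<phi> {0<..<cl x} + variation \<phi> {cl x<..<cl y} = variation \<phi> {0<..<cl y}" using 1 2 by simp
    have ex: "variation \<phi> {0<..<cl x} = ennreal (V x)" "variation \<phi> {0<..<cl y} = ennreal (V y)"
      using fin[of x] fin[of y] by (auto simp: V_def)
    have V0: "0 \<le> V x" by (simp add: V_def)
    have "variation \<phi> {cl x<..<cl y} \<le> variation \<phi> {0<..<cl x} + variation \<phi> {cl x<..<cl y}" by simp
    then have "variation \<phi> {cl x<..<cl y} < \<infinity>" using 1 fin[of y] by (meson le_less_trans order_trans)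
    then obtain d where d: "variation \<phi> {cl x<..<cl y} = ennreal d" "0 \<le> d"
      by (metis ennreal_cases infinity_ennreal_def less_irrefl)
    have "V x + d = V y" using e V0 d(2) unfolding ex d(1)
      by (metis V_def add_nonneg_nonneg enn2real_ennreal enn2real_nonneg ennreal_plus)
    then show ?thesis using d by auto
  qed
  have inc: "\<bar>\<phi> (cl y) - \<phi> (cl x)\<bar> \<le> V y - V x" if "x \<le> y" for x y
  proof (cases "cl x < cl y")
    case True
    have "{(cl x, cl y)} \<in> interval_families {cl x<..<cl y}" using True by (simp add: interval_families_def disjoint_family_on_def)
    from variation_upper[OF this, of \<phi>] have "ennreal \<bar>\<phi> (cl y) - \<phi> (cl x)\<bar> \<le> variation \<phi> {cl x<..<cl y}" by simp
    also have "\<dots> = ennreal (V y - V x)" using VV[OF that] by simp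
    finally show ?thesis using VV[OF that] by (subst (asm) ennreal_le_iff) auto
  next
    case False
    then show ?thesis using cl(3)[OF that] VV[OF that] by simp
  qed
  have main: "\<exists>g \<in> borel_measurable borel. (\<forall>x y. set_integrable lborel {x..y} g) \<and>
     (\<forall>x y. x \<le> y \<longrightarrow> (V y + s * \<phi> (cl y)) - (V x + s * \<phi> (cl x)) = (LINT t:{x..y}|lborel. g t))"
    if s: "s = 1 \<or> s = -1" for s :: real
  proof -
    let ?F = "\<lambda>x. V x + s * \<phi> (cl x)"
    have mono: "?F x \<le> ?F y" if "x \<le> y" for x y using s inc[OF that] by auto
    have le2: "?F y - ?F x \<le> 2 * (V y - V x)" if "x \<le> y" for x y using s inc[OF that] by auto
    have bd: "ennreal (?F y - ?F x) \<le> 2 * variation \<phi> ({x<..<y} \<inter> {0<..<2*pi})" if "x \<le> y" for x y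
    proof -
      have "ennreal (?F y - ?F x) \<le> ennreal (2 * (V y - V x))" by (intro ennreal_leI le2 that)
      also have "\<dots> = ennreal 2 * ennreal (V y - V x)" by (rule ennreal_mult') simp
      also have "\<dots> = 2 * variation \<phi> {cl x<..<cl y}" using VV[OF that] by simp
      also have "\<dots> \<le> 2 * variation \<phi> ({x<..<y} \<inter> {0<..<2*pi})"
        by (intro mult_left_mono variation_mono) (auto simp: cl_def)
      finally show ?thesis .
    qed
    have cont: "continuous (at_right a) ?F" for a
      unfolding continuous_within
    proof (rule tendstoI)
      fix e :: real assume e: "0 < e"
      obtain \<delta> where \<delta>: "\<delta> > 0" and acd: "\<forall>G\<in>sets borel. G \<subseteq> {0<..<2*pi} \<longrightarrow>
          emeasure lborel G < ennreal \<delta> \<longrightarrow> variation \<phi> G \<le> ennreal (e / 4)"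
        using abs_cont_variation[OF ac, of "e / 4"] e by auto
      have "dist (?F y) (?F a) < e" if "a < y" "y < a + \<delta>" for y
      proof -
        have ay: "a \<le> y" using that by simp
        have "emeasure lborel {cl a<..<cl y} < ennreal \<delta>"
          using cl(3)[OF ay] cl(4)[OF ay] that by (simp add: ennreal_less_iff)
        then have "variation \<phi> {cl a<..<cl y} \<le> ennreal (e / 4)"
          using cl[of a] cl[of y] by (intro acd[rule_format]) auto
        then have "V y - V a \<le> e / 4"
          using e by (subst ennreal_le_iff[symmetric]) (simp_all add: VV[OF ay])
        then show ?thesis using le2[OF ay] mono[OF ay] e by (simp add: dist_real_def)
      qed
      then show "\<forall>\<^sub>F y in at_right a. dist (?F y) (?F a) < e"
        unfolding eventually_at_right_field using \<delta> by (intro exI[of _ "a + \<delta>"]) auto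
    qed
    show ?thesis by (rule interval_measure_density[OF mono cont bd ac])
  qed
  obtain g1 where g1: "g1 \<in> borel_measurable borel" "\<And>x y. set_integrable lborel {x..y} g1"
    "\<And>x y. x \<le> y \<Longrightarrow> (V y + \<phi> (cl y)) - (V x + \<phi> (cl x)) = (LINT t:{x..y}|lborel. g1 t)"
    using main[of 1] by auto
  obtain g2 where g2: "g2 \<in> borel_measurable borel" "\<And>x y. set_integrable lborel {x..y} g2"
    "\<And>x y. x \<le> y \<Longrightarrow> (V y - \<phi> (cl y)) - (V x - \<phi> (cl x)) = (LINT t:{x..y}|lborel. g2 t)"
    using main[of "-1"] by auto
  show ?thesis
  proof (intro bexI[of _ "\<lambda>x. (g1 x - g2 x) / 2"] conjI allI impI)
    show "(\<lambda>x. (g1 x - g2 x) / 2) \<in> borel_measurable borel" using g1 g2 by measurable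
    show "set_integrable lborel {x..y} (\<lambda>x. (g1 x - g2 x) / 2)" for x y using g1 g2 by auto
    fix x y :: real assume xy: "0 \<le> x" "x \<le> y" "y \<le> 2 * pi"
    have "(LINT s:{x..y}|lborel. (g1 s - g2 s) / 2) = ((LINT s:{x..y}|lborel. g1 s) - (LINT s:{x..y}|lborel. g2 s)) / 2"
      using set_integral_diff(2)[OF g1(2) g2(2), of x y] by simp
    also have "\<dots> = \<phi> y - \<phi> x"
      unfolding g1(3)[OF xy(2), symmetric] g2(3)[OF xy(2), symmetric] using xy by (simp add: cl_id)
    finally show "\<phi> y - \<phi> x = (LINT s:{x..y}|lborel. (g1 s - g2 s) / 2)" ..
  qed
qed

section \<open>Absolutely continuous functions as primitives\<close>

text \<open>Densities of the real and the imaginary part on one period, extended periodically.\<close>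

lemma AC_circle_primitive:
  assumes "\<phi> \<in> AC_circle"
  shows "\<exists>g. primitive \<phi> g"
proof -
  have per: "periodic \<phi>" using assms by (simp add: AC_circle_def circle_fun_eq)
  have part: "abs_cont (\<lambda>x. q (\<phi> x))" if q: "\<And>z w. \<bar>q z - q w\<bar> \<le> norm (z - w)" for q :: "complex \<Rightarrow> real"
    unfolding abs_cont_def
  proof (intro allI impI)
    fix \<epsilon> :: real assume e: "0 < \<epsilon>"
    obtain \<delta> where \<delta>: "\<delta> > 0" "\<forall>N. \<forall>a b :: nat \<Rightarrow> real.
        (\<forall>i<N. 0 \<le> a i \<and> a i \<le> b i \<and> b i \<le> 2 * pi) \<and>
        disjoint_family_on (\<lambda>i. {a i<..<b i}) {..<N} \<and>
        (\<Sum>i<N. b i - a i) < \<delta>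
        \<longrightarrow> (\<Sum>i<N. norm (\<phi> (b i) - \<phi> (a i))) < \<epsilon>"
      using assms e unfolding AC_circle_def by blast
    have le: "(\<Sum>i<N. \<bar>q (\<phi> (b i)) - q (\<phi> (a i))\<bar>) \<le> (\<Sum>i<N. norm (\<phi> (b i) - \<phi> (a i)))"
      for N and a b :: "nat \<Rightarrow> real"
      by (intro sum_mono q)
    show "\<exists>\<delta>>0. \<forall>N. \<forall>a b :: nat \<Rightarrow> real.
        (\<forall>i<N. 0 \<le> a i \<and> a i \<le> b i \<and> b i \<le> 2 * pi) \<and>
        disjoint_family_on (\<lambda>i. {a i<..<b i}) {..<N} \<and>
        (\<Sum>i<N. b i - a i) < \<delta>
        \<longrightarrow> (\<Sum>i<N. \<bar>q (\<phi> (b i)) - q (\<phi> (a i))\<bar>) < \<epsilon>"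
      using \<delta> le by (intro exI[of _ \<delta>]) (meson le_less_trans)
  qed
  obtain g1 where g1: "g1 \<in> borel_measurable borel" "\<And>x y. set_integrable lborel {x..y} g1"
    "\<And>x y. 0 \<le> x \<Longrightarrow> x \<le> y \<Longrightarrow> y \<le> 2 * pi \<Longrightarrow> Re (\<phi> y) - Re (\<phi> x) = (LINT s:{x..y}|lborel. g1 s)"
    using abs_cont_density[OF part[of Re]] abs_Re_le_cmod by (metis minus_complex.simps(1))
  obtain g2 where g2: "g2 \<in> borel_measurable borel" "\<And>x y. set_integrable lborel {x..y} g2"
    "\<And>x y. 0 \<le> x \<Longrightarrow> x \<le> y \<Longrightarrow> y \<le> 2 * pi \<Longrightarrow> Im (\<phi> y) - Im (\<phi> x) = (LINT s:{x..y}|lborel. g2 s)"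
    using abs_cont_density[OF part[of Im]] abs_Im_le_cmod by (metis minus_complex.simps(2))
  define g where "g x = of_real (g1 x) + \<i> * of_real (g2 x)" for x
  have [measurable]: "g1 \<in> borel_measurable borel" "g2 \<in> borel_measurable borel" by fact+
  have gm [measurable]: "g \<in> borel_measurable borel" unfolding g_def by measurable
  have gi: "set_integrable lborel {x..y} g" for x y
    unfolding g_def using g1(2)[of x y] g2(2)[of x y]
    by (intro set_integral_add set_integrable_mult_right) (auto simp: set_integrable_def scaleR_conv_of_real simp flip: of_real_mult)
  have gF: "\<phi> y - \<phi> x = (LINT s:{x..y}|lborel. g s)" if "0 \<le> x" "x \<le> y" "y \<le> 2 * pi" for x y
  proof -
    have "Re (LINT s:{x..y}|lborel. g s) = (LINT s:{x..y}|lborel. g1 s)"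
      using gi[of x y] unfolding set_lebesgue_integral_def set_integrable_def
      by (subst integral_Re[symmetric]) (auto simp: g_def)
    moreover have "Im (LINT s:{x..y}|lborel. g s) = (LINT s:{x..y}|lborel. g2 s)"
      using gi[of x y] unfolding set_lebesgue_integral_def set_integrable_def
      by (subst integral_Im[symmetric]) (auto simp: g_def)
    ultimately show ?thesis using g1(3)[OF that] g2(3)[OF that] by (simp add: complex_eq_iff)
  qed
  define k where "k x = g (x - 2 * pi * of_int \<lfloor>x / (2 * pi)\<rfloor>)" for x
  have km [measurable]: "k \<in> borel_measurable borel" unfolding k_def by measurable
  have kper: "periodic k" unfolding periodic_def
  proof
    fix x
    have "(x + 2 * pi) / (2 * pi) = x / (2 * pi) + 1" by (simp add: field_simps)
    then have "\<lfloor>(x + 2 * pi) / (2 * pi)\<rfloor> = \<lfloor>x / (2 * pi)\<rfloor> + 1" by simp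
    then show "k (x + 2 * pi) = k x" unfolding k_def by (simp add: algebra_simps)
  qed
  have kg: "k x = g (x - 2 * pi * of_int j)" if "2 * pi * of_int j \<le> x" "x < 2 * pi * (of_int j + 1)" for x j
  proof -
    have "\<lfloor>x / (2 * pi)\<rfloor> = j" using that by (intro floor_unique) (auto simp: field_simps)
    then show ?thesis by (simp add: k_def)
  qed
  have cell: "set_integrable lborel {x..y} k \<and> \<phi> y - \<phi> x = (LINT s:{x..y}|lborel. k s)"
    if "x \<le> y" "2 * pi * of_int j \<le> x" "y \<le> 2 * pi * (of_int j + 1)" for x y j
  proof -
    let ?c = "2 * pi * of_int j"
    have ae: "AE s in lborel. indicator {x..y} s *\<^sub>R k s = indicator {x - ?c..y - ?c} (- ?c + 1 * s) *\<^sub>R g (- ?c + 1 * s)"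
      using AE_lborel_singleton[of "2 * pi * (of_int j + 1)"]
      by eventually_elim (use that in \<open>auto simp: indicator_def kg[of j]\<close>)
    have i0: "integrable lborel (\<lambda>s. indicator {x - ?c..y - ?c} (- ?c + 1 * s) *\<^sub>R g (- ?c + 1 * s))"
      using gi[of "x - ?c" "y - ?c"] unfolding set_integrable_def
      by (subst lborel_integrable_real_affine_iff[of 1 "\<lambda>s. indicator {x - ?c..y - ?c} s *\<^sub>R g s" "- ?c"]) auto
    have i: "set_integrable lborel {x..y} k"
      unfolding set_integrable_def
      by (subst integrable_cong_AE[OF _ _ ae]) (use i0 in auto)
    have "(LINT s:{x..y}|lborel. k s) = (\<integral>s. indicator {x - ?c..y - ?c} (- ?c + 1 * s) *\<^sub>R g (- ?c + 1 * s) \<partial>lborel)"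
      unfolding set_lebesgue_integral_def by (intro integral_cong_AE ae) auto
    also have "\<dots> = (LINT s:{x - ?c..y - ?c}|lborel. g s)"
      unfolding set_lebesgue_integral_def
      using lborel_integral_real_affine[of 1 "\<lambda>s. indicator {x - ?c..y - ?c} s *\<^sub>R g s" "- ?c"] by simp
    also have "\<dots> = \<phi> (y - ?c) - \<phi> (x - ?c)" using that by (intro gF[symmetric]) (auto simp: algebra_simps)
    also have "\<dots> = \<phi> y - \<phi> x"
      using periodic_int[OF per, of "x - ?c" j] periodic_int[OF per, of "y - ?c" j] by (simp add: mult.commute)
    finally show ?thesis using i by simp
  qed
  have join: "set_integrable lborel {x..z} k \<and> \<phi> z - \<phi> x = (LINT s:{x..z}|lborel. k s)"
    if "x \<le> y" "y \<le> z" "set_integrable lborel {x..y} k \<and> \<phi> y - \<phi> x = (LINT s:{x..y}|lborel. k s)"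
      "set_integrable lborel {y..z} k \<and> \<phi> z - \<phi> y = (LINT s:{y..z}|lborel. k s)" for x y z
  proof -
    have e: "{x..z} = {x..y} \<union> {y..z}" using that by auto
    have "set_integrable lborel {x..z} k" unfolding e using that by (intro set_integrable_Un) auto
    moreover have "AE s in lborel. \<not> (s \<in> {x..y} \<and> s \<in> {y..z})"
      using AE_lborel_singleton[of y] by eventually_elim auto
    then have "(LINT s:{x..z}|lborel. k s) = (LINT s:{x..y}|lborel. k s) + (LINT s:{y..z}|lborel. k s)"
      unfolding e using that by (intro set_integral_Un_AE) auto
    moreover have "\<phi> z - \<phi> x = (\<phi> y - \<phi> x) + (\<phi> z - \<phi> y)" by simp
    ultimately show ?thesis using that(3,4) by metis
  qed
  have blocks: "set_integrable lborel {2 * pi * of_int j..2 * pi * (of_int j + real m)} k \<and>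
      \<phi> (2 * pi * (of_int j + real m)) - \<phi> (2 * pi * of_int j)
        = (LINT s:{2 * pi * of_int j..2 * pi * (of_int j + real m)}|lborel. k s)" for j m
  proof (induction m)
    case 0
    show ?case using cell[of "2 * pi * of_int j" "2 * pi * of_int j" j] by simp
  next
    case (Suc m)
    show ?case
    proof (rule join[OF _ _ Suc])
      show "set_integrable lborel {2 * pi * (of_int j + real m)..2 * pi * (of_int j + real (Suc m))} k \<and>
          \<phi> (2 * pi * (of_int j + real (Suc m))) - \<phi> (2 * pi * (of_int j + real m))
          = (LINT s:{2 * pi * (of_int j + real m)..2 * pi * (of_int j + real (Suc m))}|lborel. k s)"
        using cell[of "2 * pi * (of_int j + real m)" "2 * pi * (of_int j + real (Suc m))" "j + int m"]
        by (simp add: algebra_simps)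
    qed (auto intro: mult_left_mono)
  qed
  have all: "set_integrable lborel {x..y} k \<and> \<phi> y - \<phi> x = (LINT s:{x..y}|lborel. k s)" if xy: "x \<le> y" for x y
  proof -
    define j where "j = \<lfloor>x / (2 * pi)\<rfloor>"
    define m where "m = nat (\<lfloor>y / (2 * pi)\<rfloor> - j)"
    have "j \<le> \<lfloor>y / (2 * pi)\<rfloor>" unfolding j_def using xy by (intro floor_mono divide_right_mono) auto
    then have jm: "of_int j + real m = of_int \<lfloor>y / (2 * pi)\<rfloor>" by (simp add: m_def)
    have jx: "2 * pi * of_int j \<le> x" "x < 2 * pi * (of_int j + 1)"
      using floor_divide_lower[of "2*pi" x] floor_divide_upper[of "2*pi" x] by (auto simp: j_def mult.commute)
    have jy: "2 * pi * (of_int j + real m) \<le> y" "y < 2 * pi * (of_int j + real m + 1)"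
      using floor_divide_lower[of "2*pi" y] floor_divide_upper[of "2*pi" y] unfolding jm by (auto simp: mult.commute)
    have Y: "set_integrable lborel {2 * pi * of_int j..y} k \<and>
        \<phi> y - \<phi> (2 * pi * of_int j) = (LINT s:{2 * pi * of_int j..y}|lborel. k s)"
      using jy by (intro join[OF _ _ blocks[of j m] cell[of _ _ "j + int m"]]) (auto simp: mult_left_mono)
    have X: "\<phi> x - \<phi> (2 * pi * of_int j) = (LINT s:{2 * pi * of_int j..x}|lborel. k s)"
      "set_integrable lborel {2 * pi * of_int j..x} k"
      using cell[of "2 * pi * of_int j" x j] jx by auto
    have i: "set_integrable lborel {x..y} k"
      using Y jx by (intro set_integrable_subset[of lborel "{2 * pi * of_int j..y}" k "{x..y}"]) auto
    have "AE s in lborel. \<not> (s \<in> {2 * pi * of_int j..x} \<and> s \<in> {x..y})"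
      using AE_lborel_singleton[of x] by eventually_elim auto
    then have "(LINT s:{2 * pi * of_int j..x} \<union> {x..y}|lborel. k s)
        = (LINT s:{2 * pi * of_int j..x}|lborel. k s) + (LINT s:{x..y}|lborel. k s)"
      using X i by (intro set_integral_Un_AE) auto
    moreover have "{2 * pi * of_int j..x} \<union> {x..y} = {2 * pi * of_int j..y}" using jx xy by auto
    ultimately have "(LINT s:{2 * pi * of_int j..y}|lborel. k s)
        = (LINT s:{2 * pi * of_int j..x}|lborel. k s) + (LINT s:{x..y}|lborel. k s)" by simp
    moreover have "\<phi> y - \<phi> x = (\<phi> y - \<phi> (2 * pi * of_int j)) - (\<phi> x - \<phi> (2 * pi * of_int j))" by simp
    ultimately show ?thesis using X(1) Y i by simp
  qed
  have "set_integrable lborel {x..y} k" for x y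
    using all[of x y] by (cases "x \<le> y") (auto simp: set_integrable_def)
  then have "primitive \<phi> k" using all km kper per by (auto simp: primitive_def L1per_def)
  then show ?thesis by (intro exI[of _ k])
qed

text \<open>Right derivatives come from the Lebesgue differentiation theorem for shrinking right
  neighbourhoods; left derivatives from the same theorem applied to the reflected function.\<close>

lemma primitive_AE_derivative:
  assumes "primitive H h"
  shows "AE x in lebesgue. vector_derivative H (at x) = h x"
proof -
  have L: "L1per h" using assms by (simp add: primitive_def)
  have inth: "integral {a..b} h = H b - H a \<and> h integrable_on {a..b}" if "a \<le> b" for a b
    using set_borel_integral_eq_integral[OF L1perD(3)[OF L, of a b]] assms that by (auto simp: primitive_def)
  have hi: "h integrable_on cbox a b" for a b
    using inth[of a b] by (cases "a \<le> b") (auto simp: integrable_on_empty)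
  have hi2: "(\<lambda>x. h (- x)) integrable_on cbox a b" for a b
  proof -
    have "h integrable_on {- b..- a}" using hi[of "- b" "- a"] by simp
    then show ?thesis using Henstock_Kurzweil_Integration.integrable_reflect_real[where f = h and a = "- b" and b = "- a"] by simp
  qed
  obtain N1 where N1: "negligible N1" "\<And>x e. \<lbrakk>x \<notin> N1; 0 < e\<rbrakk> \<Longrightarrow>
      \<exists>d>0. \<forall>t. 0 < t \<and> t < d \<longrightarrow> norm (integral (cbox x (x + t *\<^sub>R One)) h /\<^sub>R t ^ DIM(real) - h x) < e"
    using integrable_ccontinuous_explicit[of h] hi by blast
  obtain N2 where N2: "negligible N2" "\<And>x e. \<lbrakk>x \<notin> N2; 0 < e\<rbrakk> \<Longrightarrow>
      \<exists>d>0. \<forall>t. 0 < t \<and> t < d \<longrightarrow> norm (integral (cbox x (x + t *\<^sub>R One)) (\<lambda>x. h (- x)) /\<^sub>R t ^ DIM(real) - h (- x)) < e"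
    using integrable_ccontinuous_explicit[of "\<lambda>x. h (- x)"] hi2 by blast
  have der: "vector_derivative H (at x) = h x" if x: "x \<notin> N1" "- x \<notin> N2" for x
  proof (rule vector_derivative_at)
    show "(H has_vector_derivative h x) (at x)"
      unfolding has_vector_derivative_def has_derivative_at
    proof (intro conjI)
      show "bounded_linear (\<lambda>t. t *\<^sub>R h x)" by (rule bounded_linear_scaleR_left)
      show "(\<lambda>t. norm (H (x + t) - H x - t *\<^sub>R h x) / norm t) \<midarrow>0\<rightarrow> 0"
      proof (rule LIM_I)
        fix e :: real assume e: "0 < e"
        obtain d1 where d1: "d1 > 0" "\<And>t. 0 < t \<Longrightarrow> t < d1 \<Longrightarrow> norm ((H (x + t) - H x) /\<^sub>R t - h x) < e"
          using N1(2)[OF x(1) e] inth[of x "x + t" for t] by (auto simp: less_imp_le)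
        obtain d2 where d2: "d2 > 0" "\<And>t. 0 < t \<Longrightarrow> t < d2 \<Longrightarrow> norm ((H x - H (x - t)) /\<^sub>R t - h x) < e"
        proof -
          have "integral {- x..- x + t} (\<lambda>s. h (- s)) = H x - H (x - t)" if "0 < t" for t
            using Henstock_Kurzweil_Integration.integral_reflect_real[of x "x - t" h] inth[of "x - t" x] that by (simp add: algebra_simps)
          then show ?thesis using N2(2)[OF x(2) e] that by auto
        qed
        have "norm (H (x + t) - H x - t *\<^sub>R h x) / norm t < e" if t: "t \<noteq> 0" "\<bar>t\<bar> < min d1 d2" for t
        proof (cases "0 < t")
          case True
          have "(H (x + t) - H x) /\<^sub>R t - h x = (H (x + t) - H x - t *\<^sub>R h x) /\<^sub>R t"
            using True by (simp add: scaleR_diff_right)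
          then show ?thesis using d1(2)[of t] True t by (simp add: divide_inverse mult.commute)
        next
          case False
          then have s: "0 < - t" using t by simp
          have "(H x - H (x - - t)) /\<^sub>R (- t) - h x = (H (x + t) - H x - t *\<^sub>R h x) /\<^sub>R t"
            using s by (simp add: scaleR_diff_right)
          then show ?thesis using d2(2)[of "- t"] s t by (simp add: divide_inverse mult.commute)
        qed
        then show "\<exists>s>0. \<forall>t. t \<noteq> 0 \<and> norm (t - 0) < s \<longrightarrow>
            norm (norm (H (x + t) - H x - t *\<^sub>R h x) / norm t - 0) < e"
          using d1(1) d2(1) by (intro exI[of _ "min d1 d2"]) auto
      qed
    qed
  qed
  have "negligible (N1 \<union> uminus ` N2)"
  proof (intro negligible_Un N1(1) negligible_locally_Lipschitz_image N2(1))
    fix x :: real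
    show "\<exists>T B. open T \<and> x \<in> T \<and> (\<forall>y\<in>N2 \<inter> T. norm (- y - - x) \<le> B * norm (y - x))"
      by (intro exI[of _ UNIV] exI[of _ 1]) (auto simp: norm_minus_commute)
  qed simp
  then have "AE x in lebesgue. x \<notin> N1 \<union> uminus ` N2"
    using AE_not_in unfolding negligible_iff_null_sets by blast
  then show ?thesis
    by eventually_elim (intro der, auto simp: image_iff)
qed

section \<open>Near-best approximants in the amalgam quantity\<close>

lemma ennreal_powr_liminf:
  assumes "0 < p" "0 \<le> x" "\<And>i. 0 \<le> y i" "ennreal x \<le> liminf (\<lambda>i. ennreal (y i))"
  shows "ennreal (x powr p) \<le> liminf (\<lambda>i. ennreal (y i powr p))"
  unfolding le_Liminf_iff
proof (intro allI impI)
  fix c assume c: "c < ennreal (x powr p)"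
  then obtain z where z: "c = ennreal z" "0 \<le> z"
    by (cases c) auto
  have zx: "z < x powr p" using c z by (simp add: ennreal_less_iff)
  have "z powr (1 / p) < (x powr p) powr (1 / p)"
    using assms(1) z zx by (intro powr_less_mono2) auto
  also have "\<dots> = x" using assms by (simp add: powr_powr)
  finally have "ennreal (z powr (1 / p)) < ennreal x" by (simp add: ennreal_less_iff)
  then have "\<forall>\<^sub>F i in sequentially. ennreal (z powr (1 / p)) < ennreal (y i)"
    using assms(4) unfolding le_Liminf_iff by blast
  then show "\<forall>\<^sub>F i in sequentially. c < ennreal (y i powr p)"
  proof eventually_elim
    case (elim i)
    then have "z powr (1 / p) < y i" by (simp add: ennreal_less_iff)
    then have "(z powr (1 / p)) powr p < y i powr p" using assms(1) by (intro powr_less_mono2) auto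
    then show ?case using assms(1) z by (simp add: powr_powr ennreal_less_iff)
  qed
qed

text \<open>Fatou's lemma for the integrals over windows and then for the outer integral. Windows that
  start in the first period end before \<open>4 * pi\<close>.\<close>

lemma amalgam_Fatou:
  assumes "0 < p" "h \<le> 2 * pi" "L1per w" "\<And>i. L1per (W i)"
    and conv: "AE y in lborel. y \<in> {0..<4*pi} \<longrightarrow> (\<lambda>i. W i y) \<longlonglongrightarrow> w y"
  shows "amalgam p h w \<le> liminf (\<lambda>i. amalgam p h (W i))"
proof -
  have [measurable]: "w \<in> borel_measurable borel" "W i \<in> borel_measurable borel" for i
    using assms L1perD(1) by auto
  have inner: "ennreal (absint w x (x + h)) \<le> liminf (\<lambda>i. ennreal (absint (W i) x (x + h)))"
    if x: "x \<in> {0..<2*pi}" for x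
  proof -
    have "ennreal (absint w x (x + h)) \<le> (\<integral>\<^sup>+s. liminf (\<lambda>i. ennreal (norm (W i s)) * indicator {x..x + h} s) \<partial>lborel)"
      unfolding ennreal_absint[OF assms(3)]
    proof (rule nn_integral_mono_AE, use conv in eventually_elim)
      case (elim s)
      show ?case
      proof (cases "s \<in> {x..x + h}")
        case True
        then have "(\<lambda>i. W i s) \<longlonglongrightarrow> w s" using elim x assms(2) by auto
        then have "(\<lambda>i. ennreal (norm (W i s)) * indicator {x..x + h} s) \<longlonglongrightarrow> ennreal (norm (w s)) * indicator {x..x + h} s"
          using True by (auto intro!: tendsto_intros tendsto_ennrealI)
        from lim_imp_Liminf[OF _ this] show ?thesis by simp
      qed simp
    qed
    also have "\<dots> \<le> liminf (\<lambda>i. \<integral>\<^sup>+s. ennreal (norm (W i s)) * indicator {x..x + h} s \<partial>lborel)"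
      by (intro nn_integral_liminf) measurable
    finally show ?thesis unfolding ennreal_absint[OF assms(4)] .
  qed
  have "amalgam p h w \<le> (\<integral>\<^sup>+x. liminf (\<lambda>i. ennreal (absint (W i) x (x + h) powr p) * indicator {0..<2*pi} x) \<partial>lborel)"
    unfolding amalgam_def circ_int_def
  proof (rule nn_integral_mono)
    fix x
    show "ennreal (absint w x (x + h) powr p) * indicator {0..<2*pi} x
        \<le> liminf (\<lambda>i. ennreal (absint (W i) x (x + h) powr p) * indicator {0..<2*pi} x)"
      using ennreal_powr_liminf[OF assms(1) absint_nonneg absint_nonneg inner, of x]
      by (cases "x \<in> {0..<2*pi}") auto
  qed
  also have "\<dots> \<le> liminf (\<lambda>i. amalgam p h (W i))"
    unfolding amalgam_def circ_int_def using assms by (intro nn_integral_liminf) auto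
  finally show ?thesis .
qed

text \<open>The sum of all \<open>\<bar>g - U i\<bar> powr p\<close> has a finite integral and is therefore finite almost
  everywhere, so that its terms tend to \<open>0\<close>.\<close>

lemma pint_summable_AE_tendsto:
  assumes "0 < p" "periodic g" and per: "\<And>i. periodic (U i)"
    and [measurable]: "g \<in> borel_measurable borel" "\<And>i. U i \<in> borel_measurable borel"
    and sum: "\<And>m. (\<Sum>i<m. pdist p g (U i)) \<le> ennreal B"
  shows "AE y in lborel. y \<in> {0..<4*pi} \<longrightarrow> (\<lambda>i. U i y) \<longlonglongrightarrow> g y"
proof -
  define \<psi> where "\<psi> y = (\<Sum>i. ennreal (norm (g y - U i y) powr p))" for y
  have [measurable]: "\<psi> \<in> borel_measurable borel" unfolding \<psi>_def by measurable
  have psiper: "\<psi> (y + 2 * pi) = \<psi> y" for y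
    using periodicD[OF assms(2)] periodicD[OF per] by (simp add: \<psi>_def)
  have "(\<integral>\<^sup>+y\<in>{0..<2*pi}. \<psi> y \<partial>lborel)
      = (\<integral>\<^sup>+y. (\<Sum>i. ennreal (norm (g y - U i y) powr p) * indicator {0..<2*pi} y) \<partial>lborel)"
    unfolding \<psi>_def by simp
  also have "\<dots> = (\<Sum>i. pdist p g (U i))"
    unfolding pint_def circ_int_def by (intro nn_integral_suminf) measurable
  also have "\<dots> \<le> ennreal B"
    using sum by (intro suminf_le_const) auto
  finally have fin: "(\<integral>\<^sup>+y\<in>{0..<2*pi}. \<psi> y \<partial>lborel) < \<infinity>" by (simp add: le_less_trans)
  have "(\<integral>\<^sup>+y\<in>{2*pi..<4*pi}. \<psi> y \<partial>lborel)
      = (\<integral>\<^sup>+y. (\<lambda>y. \<psi> y * indicator {2*pi..<4*pi} y) (y + 2 * pi) \<partial>lborel)"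
    by (rule nn_integral_shift[symmetric]) measurable
  also have "\<dots> = (\<integral>\<^sup>+y\<in>{0..<2*pi}. \<psi> y \<partial>lborel)"
    by (intro nn_integral_cong) (auto simp: indicator_def psiper)
  finally have fin2: "(\<integral>\<^sup>+y\<in>{2*pi..<4*pi}. \<psi> y \<partial>lborel) < \<infinity>" using fin by simp
  have "AE y in lborel. \<psi> y * indicator {0..<2*pi} y \<noteq> \<infinity>"
    using fin by (intro nn_integral_noteq_infinite) auto
  moreover have "AE y in lborel. \<psi> y * indicator {2*pi..<4*pi} y \<noteq> \<infinity>"
    using fin2 by (intro nn_integral_noteq_infinite) auto
  ultimately show ?thesis
  proof eventually_elim
    case (elim y)
    show ?case
    proof
      assume "y \<in> {0..<4*pi}"
      then have "\<psi> y \<noteq> \<infinity>" using elim by (cases "y < 2 * pi") (auto simp: indicator_def)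
      then have "summable (\<lambda>i. norm (g y - U i y) powr p)"
        unfolding \<psi>_def by (intro summable_suminf_not_top) auto
      then have "(\<lambda>i. norm (g y - U i y) powr p) \<longlonglongrightarrow> 0" by (rule summable_LIMSEQ_zero)
      then have "(\<lambda>i. (norm (g y - U i y) powr p) powr (1 / p)) \<longlonglongrightarrow> 0 powr (1 / p)"
        using assms(1) by (intro tendsto_powr2) auto
      then have "(\<lambda>i. norm (g y - U i y)) \<longlonglongrightarrow> 0" using assms(1) by (simp add: powr_powr)
      then show "(\<lambda>i. U i y) \<longlonglongrightarrow> g y"
        by (simp add: tendsto_norm_zero_iff LIM_zero_iff norm_minus_commute tendsto_iff dist_norm)
    qed
  qed
qed

text \<open>Windows of length \<open>1 / n\<close> are unions of \<open>k\<close> windows adapted to the degree \<open>k * n\<close>.\<close>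

lemma amalgam_trig_coarse:
  assumes "0 < p" "p \<le> 1"
  shows "\<exists>C>0. \<forall>n\<ge>1. \<forall>k\<ge>1. \<forall>T\<in>trig_polys (k * n).
    amalgam p (1 / real n) T \<le> ennreal (C * real n powr (- p) * real k powr (1 - p)) * pint p T"
proof -
  obtain C where C: "0 < C" and T:
    "\<forall>n\<ge>1. \<forall>T\<in>trig_polys n. amalgam p (1 / real n) T \<le> ennreal (C * real n powr (- p)) * pint p T"
    using amalgam_trig_le[OF assms] by blast
  show ?thesis
  proof (intro exI[of _ C] conjI C allI ballI impI)
    fix n k :: nat and S assume n: "1 \<le> n" and k: "1 \<le> k" and S: "S \<in> trig_polys (k * n)"
    have kn: "1 \<le> k * n" using n k by simp
    have "real k * (1 / real (k * n)) = 1 / real n" using k by simp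
    then have "amalgam p (1 / real n) S \<le> ennreal (real k) * amalgam p (1 / real (k * n)) S"
      using amalgam_multiple[OF assms L1per_trig[OF S], of "1 / real (k * n)" k] by simp
    also have "\<dots> \<le> ennreal (real k) * (ennreal (C * real (k * n) powr (- p)) * pint p S)"
      using T[rule_format, OF kn S] by (intro mult_left_mono) simp_all
    also have "\<dots> = ennreal (real k * (C * real (k * n) powr (- p))) * pint p S"
      by (rule ennreal_mult_assoc) simp
    also have "real k * (C * real (k * n) powr (- p)) = C * real n powr (- p) * (real k powr 1 * real k powr (- p))"
      using k by (simp add: powr_mult mult_ac)
    also have "real k powr 1 * real k powr (- p) = real k powr (1 - p)"
      by (simp only: powr_add[symmetric]) simp
    finally show "amalgam p (1 / real n) S \<le> ennreal (C * real n powr (- p) * real k powr (1 - p)) * pint p S" .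
  qed
qed

text \<open>Dyadic condensation: the block of indices from \<open>2 ^ j * n + 1\<close> to \<open>2 ^ Suc j * n\<close> has
  \<open>2 ^ j * n\<close> elements, and both \<open>\<nu> powr (- p)\<close> and \<open>e \<nu>\<close> are smallest at its end.\<close>

lemma dyadic_sum_le:
  fixes e :: "nat \<Rightarrow> real"
  assumes p: "0 < p" "p \<le> 1" and n: "1 \<le> n" and e0: "\<And>k. 0 \<le> e k"
    and dec: "\<And>k l. k \<le> l \<Longrightarrow> e l \<le> e k"
    and sum: "summable (\<lambda>k. real (k + 1) powr (- p) * e (k + 1))"
  shows "(\<Sum>j<m. (2 powr (1 - p)) ^ j * e (2 ^ j * n))
    \<le> e n + 2 * real n powr (p - 1) * (\<Sum>k. real (n + 1 + k) powr (- p) * e (n + 1 + k))"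
proof -
  define f where "f \<nu> = real \<nu> powr (- p) * e \<nu>" for \<nu>
  have f0: "0 \<le> f \<nu>" for \<nu> using e0 by (simp add: f_def)
  define w where "w = (2::real) powr (1 - p)"
  have w: "0 < w" by (simp add: w_def)
  have wj: "w ^ j = (2 ^ j) powr (1 - p)" for j
    by (simp add: w_def powr_powr powr_realpow[symmetric] mult.commute)
  have block: "w ^ Suc j * e (2 ^ Suc j * n) \<le> 2 * real n powr (p - 1) * (\<Sum>\<nu>\<in>{2 ^ j * n<..2 ^ Suc j * n}. f \<nu>)" for j
  proof -
    define M where "M = 2 ^ Suc j * n"
    have M: "1 \<le> M" using n by (simp add: M_def)
    have "(\<Sum>\<nu>\<in>{2 ^ j * n<..M}. real M powr (- p) * e M) \<le> (\<Sum>\<nu>\<in>{2 ^ j * n<..M}. f \<nu>)"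
      unfolding f_def using p e0 M n
      by (intro sum_mono mult_mono powr_mono2' dec) auto
    moreover have "card {2 ^ j * n<..M} = 2 ^ j * n" by (simp add: M_def)
    ultimately have le: "real (2 ^ j * n) * (real M powr (- p) * e M) \<le> (\<Sum>\<nu>\<in>{2 ^ j * n<..M}. f \<nu>)"
      by (simp only: sum_constant)
    have "real n powr (p - 1) * real n powr (1 - p) = 1" using n by (simp add: powr_add[symmetric])
    have "real M = 2 ^ Suc j * real n" by (simp add: M_def)
    then have "w ^ Suc j = real n powr (p - 1) * real M powr (1 - p)"
      using n \<open>real n powr (p - 1) * real n powr (1 - p) = 1\<close>
      unfolding wj by (simp add: powr_mult mult_ac)
    also have "real M powr (1 - p) = real M powr 1 * real M powr (- p)"
      by (simp only: powr_add[symmetric]) simp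
    also have "real M powr 1 = 2 * real (2 ^ j * n)" using M by (simp add: M_def)
    finally have "w ^ Suc j * e M = 2 * real n powr (p - 1) * (real (2 ^ j * n) * (real M powr (- p) * e M))"
      by simp
    also have "\<dots> \<le> 2 * real n powr (p - 1) * (\<Sum>\<nu>\<in>{2 ^ j * n<..M}. f \<nu>)"
      by (intro mult_left_mono le) auto
    finally show ?thesis by (simp only: M_def)
  qed
  have part: "(\<Sum>j<Suc m. w ^ j * e (2 ^ j * n)) \<le> e n + 2 * real n powr (p - 1) * (\<Sum>\<nu>\<in>{n<..2 ^ m * n}. f \<nu>)" for m
  proof (induction m)
    case 0
    show ?case by simp
  next
    case (Suc m)
    have "n \<le> 2 ^ m * n" "2 ^ m * n \<le> 2 ^ Suc m * n" by auto
    moreover have "{a<..c} = {a<..b} \<union> {b<..c}" if "a \<le> b" "b \<le> c" for a b c :: nat using that by auto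
    ultimately have "{n<..2 ^ Suc m * n} = {n<..2 ^ m * n} \<union> {2 ^ m * n<..2 ^ Suc m * n}" by blast
    then have "(\<Sum>\<nu>\<in>{n<..2 ^ Suc m * n}. f \<nu>) = (\<Sum>\<nu>\<in>{n<..2 ^ m * n}. f \<nu>) + (\<Sum>\<nu>\<in>{2 ^ m * n<..2 ^ Suc m * n}. f \<nu>)"
      by (simp only:) (intro sum.union_disjoint, auto)
    then show ?case using Suc block[of m] by (simp only: sum.lessThan_Suc[of _ "Suc m"] distrib_left)
  qed
  have summ: "summable (\<lambda>k. f (n + 1 + k))"
    using summable_ignore_initial_segment[OF sum, of n] by (simp add: f_def add_ac)
  have tail: "(\<Sum>\<nu>\<in>{n<..M}. f \<nu>) \<le> (\<Sum>k. f (n + 1 + k))" for M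
  proof -
    have "(\<Sum>\<nu>\<in>{n<..M}. f \<nu>) = (\<Sum>k<M - n. f (n + 1 + k))"
      by (rule sum.reindex_bij_witness[of _ "\<lambda>k. n + 1 + k" "\<lambda>\<nu>. \<nu> - (n + 1)"]) auto
    also have "\<dots> \<le> (\<Sum>k. f (n + 1 + k))" using f0 summ by (intro sum_le_suminf) auto
    finally show ?thesis .
  qed
  have "(\<Sum>j<m. w ^ j * e (2 ^ j * n)) \<le> (\<Sum>j<Suc m. w ^ j * e (2 ^ j * n))"
    using w e0 by simp
  also have "\<dots> \<le> e n + 2 * real n powr (p - 1) * (\<Sum>\<nu>\<in>{n<..2 ^ m * n}. f \<nu>)" by (rule part)
  also have "\<dots> \<le> e n + 2 * real n powr (p - 1) * (\<Sum>k. f (n + 1 + k))"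
    by (intro add_left_mono mult_left_mono tail) auto
  finally show ?thesis by (simp add: w_def f_def)
qed

text \<open>Choose near-best approximants \<open>U j\<close> of degree \<open>2 ^ j * n\<close>. Their differences are polynomials,
  so \<open>amalgam_trig_coarse\<close> bounds the amalgam of \<open>U m - U 0\<close> by a dyadic sum, uniformly in \<open>m\<close>. As the
  errors are summable, \<open>U m\<close> tends to \<open>g\<close> almost everywhere, and \<open>amalgam_Fatou\<close> passes to the limit.
  The sequence \<open>e\<close> stands for the \<open>p\<close>-th powers of the best approximations.\<close>

lemma near_best_amalgam:
  assumes "0 < p" "p \<le> 1"
  shows "\<exists>C>0. \<forall>n\<ge>1. \<forall>g e \<epsilon>. L1per g \<longrightarrow> (\<forall>k. 0 \<le> e k) \<longrightarrow> (\<forall>k l. k \<le> l \<longrightarrow> e l \<le> e k) \<longrightarrow>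
    (\<forall>\<nu> \<eta>. 0 < \<eta> \<longrightarrow> (\<exists>U\<in>trig_polys \<nu>. pdist p g U \<le> ennreal (e \<nu> + \<eta>))) \<longrightarrow>
    summable (\<lambda>k. real (k + 1) powr (- p) * e (k + 1)) \<longrightarrow> 0 < \<epsilon> \<longrightarrow>
    (\<exists>U\<in>trig_polys n. pdist p g U \<le> ennreal (e n + \<epsilon>) \<and>
      adist p n g U \<le> ennreal (C * real n powr (- p) * (e n
        + real n powr (p - 1) * (\<Sum>k. real (n + 1 + k) powr (- p) * e (n + 1 + k)) + \<epsilon>)))"
proof -
  obtain C where C: "0 < C" and coarse: "\<forall>n\<ge>1. \<forall>k\<ge>1. \<forall>T\<in>trig_polys (k * n).
    amalgam p (1 / real n) T \<le> ennreal (C * real n powr (- p) * real k powr (1 - p)) * pint p T"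
    using amalgam_trig_coarse[OF assms] by blast
  show ?thesis
  proof (intro exI[of _ "8 * C"] conjI allI impI)
    show "0 < 8 * C" using C by simp
    fix n :: nat and g :: "real \<Rightarrow> complex" and e :: "nat \<Rightarrow> real" and \<epsilon> :: real
    assume n: "1 \<le> n" and g: "L1per g" and e0: "\<forall>k. 0 \<le> e k" and dec: "\<forall>k l. k \<le> l \<longrightarrow> e l \<le> e k"
      and near: "\<forall>\<nu> \<eta>. 0 < \<eta> \<longrightarrow> (\<exists>U\<in>trig_polys \<nu>. pdist p g U \<le> ennreal (e \<nu> + \<eta>))"
      and sum: "summable (\<lambda>k. real (k + 1) powr (- p) * e (k + 1))" and \<epsilon>: "0 < \<epsilon>"
    define S where "S = (\<Sum>k. real (n + 1 + k) powr (- p) * e (n + 1 + k))"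
    (* The tolerances decay faster than the weights w ^ j <= 2 ^ j of the dyadic sum grow. *)
    define a where "a j = e (2 ^ j * n) + \<epsilon> / 4 ^ j" for j
    have a0: "0 \<le> a j" for j using e0 \<epsilon> by (simp add: a_def)
    have adec: "a (Suc j) \<le> a j" for j
    proof -
      have "\<epsilon> / 4 ^ Suc j \<le> \<epsilon> / 4 ^ j" using \<epsilon> by (simp add: field_simps)
      then show ?thesis using dec by (simp add: a_def add_mono)
    qed
    define w where "w = (2::real) powr (1 - p)"
    have w1: "1 \<le> w" using assms by (simp add: w_def ge_one_powr_ge_zero)
    have w2: "w \<le> 2" using powr_mono[of "1 - p" 1 2] assms by (simp add: w_def)
    have "\<exists>U\<in>trig_polys (2 ^ j * n). pdist p g U \<le> ennreal (a j)" for j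
      using near[rule_format, of "\<epsilon> / 4 ^ j" "2 ^ j * n"] \<epsilon> by (simp add: a_def)
    then obtain U where U: "\<And>j. U j \<in> trig_polys (2 ^ j * n)" "\<And>j. pdist p g (U j) \<le> ennreal (a j)"
      by metis
    have gm [measurable]: "g \<in> borel_measurable borel" by (rule L1perD[OF g])
    have Um [measurable]: "U j \<in> borel_measurable borel" for j by (rule trig_poly_measurable[OF U(1)])
    have UL: "L1per (U j)" for j by (rule L1per_trig[OF U(1)])
    define B where "B = e n + real n powr (p - 1) * S + \<epsilon>"
    have S0: "0 \<le> S"
      unfolding S_def using e0 summable_ignore_initial_segment[OF sum, of n]
      by (intro suminf_nonneg) (auto simp: add_ac)
    have suma: "(\<Sum>j<m. w ^ j * a j) \<le> 2 * B" for m
    proof -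
      have "(\<Sum>j<m. w ^ j * a j) = (\<Sum>j<m. w ^ j * e (2 ^ j * n)) + (\<Sum>j<m. w ^ j * (\<epsilon> / 4 ^ j))"
        by (simp add: a_def distrib_left sum.distrib)
      also have "(\<Sum>j<m. w ^ j * (\<epsilon> / 4 ^ j)) \<le> (\<Sum>j<m. \<epsilon> * (1/2) ^ j)"
      proof (intro sum_mono)
        fix j
        have "w ^ j \<le> 2 ^ j" using w1 w2 by (intro power_mono) auto
        then have "w ^ j * (\<epsilon> / 4 ^ j) \<le> 2 ^ j * (\<epsilon> / 4 ^ j)" using \<epsilon> by (intro mult_right_mono) auto
        also have "\<dots> = \<epsilon> * (2 / 4) ^ j" by (simp only: power_divide times_divide_eq_right mult.commute)
        finally show "w ^ j * (\<epsilon> / 4 ^ j) \<le> \<epsilon> * (1/2) ^ j" by simp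
      qed
      also have "(\<Sum>j<m. \<epsilon> * (1/2) ^ j) \<le> 2 * \<epsilon>"
        unfolding sum_distrib_left[symmetric] using sum_gp_strict[of "1/2::real" m] \<epsilon> by simp
      also have "(\<Sum>j<m. w ^ j * e (2 ^ j * n)) \<le> e n + 2 * real n powr (p - 1) * S"
        unfolding w_def S_def using e0 dec by (intro dyadic_sum_le assms n sum) auto
      finally show ?thesis using e0[rule_format, of n] by (simp add: B_def algebra_simps)
    qed
    have B0: "0 \<le> B" using e0 S0 \<epsilon> by (simp add: B_def)
    have D: "adist p n (U (Suc j)) (U j) \<le> ennreal (4 * C * real n powr (- p) * (w ^ j * a j))" for j
    proof -
      have tr: "(\<lambda>x. U (Suc j) x - U j x) \<in> trig_polys (2 ^ Suc j * n)"
        by (intro trig_poly_diff U(1) trig_poly_mono[OF U(1)[of j]]) simp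
      have "real (2 ^ Suc j) powr (1 - p) = w ^ Suc j"
        by (simp add: w_def powr_mult powr_powr powr_realpow[symmetric] mult.commute)
      then have "adist p n (U (Suc j)) (U j)
          \<le> ennreal (C * real n powr (- p) * w ^ Suc j) * pdist p (U (Suc j)) (U j)"
        using coarse[rule_format, OF n _ tr] by simp
      also have "\<dots> \<le> ennreal (C * real n powr (- p) * w ^ Suc j) * ennreal (2 * a j)"
      proof (intro mult_left_mono)
        have "pdist p (U (Suc j)) (U j) \<le> pdist p (U (Suc j)) g + pdist p g (U j)"
          by (intro pint_diff_le assms) measurable
        also have "\<dots> \<le> ennreal (a (Suc j)) + ennreal (a j)"
          unfolding pint_commute[of p "U (Suc j)"] by (intro add_mono U(2))
        also have "\<dots> \<le> ennreal (2 * a j)"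
          using a0[of j] a0[of "Suc j"] adec[of j] by (simp add: ennreal_plus[symmetric] ennreal_leI del: ennreal_plus)
        finally show "pdist p (U (Suc j)) (U j) \<le> ennreal (2 * a j)" .
      qed simp
      also have "\<dots> = ennreal (C * real n powr (- p) * w ^ Suc j * (2 * a j))"
        using a0[of j] by (subst ennreal_mult''[symmetric]) auto
      also have "\<dots> \<le> ennreal (4 * C * real n powr (- p) * (w ^ j * a j))"
      proof (intro ennreal_leI)
        have "w * (2 * (C * real n powr (- p) * (w ^ j * a j))) \<le> 2 * (2 * (C * real n powr (- p) * (w ^ j * a j)))"
          using w1 w2 C a0[of j] by (intro mult_right_mono) auto
        then show "C * real n powr (- p) * w ^ Suc j * (2 * a j) \<le> 4 * C * real n powr (- p) * (w ^ j * a j)"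
          by (simp add: mult_ac)
      qed
      finally show ?thesis .
    qed
    have tele: "adist p n (U m) (U 0) \<le> ennreal (4 * C * real n powr (- p) * (\<Sum>j<m. w ^ j * a j))" for m
    proof (induction m)
      case 0
      show ?case using amalgam_cmult[OF UL[of 0], of p "1 / real n" 0] assms by simp
    next
      case (Suc m)
      have "adist p n (U (Suc m)) (U 0)
          \<le> adist p n (U (Suc m)) (U m) + adist p n (U m) (U 0)"
        by (intro amalgam_diff_le assms UL)
      also have "\<dots> \<le> ennreal (4 * C * real n powr (- p) * (w ^ m * a m))
          + ennreal (4 * C * real n powr (- p) * (\<Sum>j<m. w ^ j * a j))"
        by (intro add_mono D Suc)
      also have "\<dots> = ennreal (4 * C * real n powr (- p) * (\<Sum>j<Suc m. w ^ j * a j))"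
        using C w1 a0 by (subst ennreal_plus[symmetric]) (auto simp: algebra_simps intro!: mult_nonneg_nonneg sum_nonneg)
      finally show ?case .
    qed
    have conv: "AE y in lborel. y \<in> {0..<4*pi} \<longrightarrow> (\<lambda>j. U j y) \<longlonglongrightarrow> g y"
    proof (rule pint_summable_AE_tendsto[OF assms(1) L1perD(2)[OF g] L1perD(2)[OF UL]])
      fix m
      have "(\<Sum>i<m. pdist p g (U i)) \<le> (\<Sum>i<m. ennreal (w ^ i * a i))"
      proof (intro sum_mono order_trans[OF U(2)] ennreal_leI)
        fix i
        have "1 * a i \<le> w ^ i * a i" using w1 a0 by (intro mult_right_mono one_le_power) auto
        then show "a i \<le> w ^ i * a i" by simp
      qed
      also have "\<dots> = ennreal (\<Sum>i<m. w ^ i * a i)" using w1 a0 by (intro sum_ennreal) auto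
      also have "\<dots> \<le> ennreal (2 * B)" by (intro ennreal_leI suma)
      finally show "(\<Sum>i<m. pdist p g (U i)) \<le> ennreal (2 * B)" .
    qed measurable
    have "adist p n g (U 0) \<le> liminf (\<lambda>j. adist p n (U j) (U 0))"
    proof (rule amalgam_Fatou[OF assms(1) _ L1per_diff[OF g UL] L1per_diff[OF UL UL]])
      have "1 / real n \<le> 1" using n by simp
      then show "1 / real n \<le> 2 * pi" using pi_gt3 by linarith
      show "AE y in lborel. y \<in> {0..<4*pi} \<longrightarrow> (\<lambda>j. U j y - U 0 y) \<longlonglongrightarrow> g y - U 0 y"
        using conv by eventually_elim (auto intro: tendsto_diff)
    qed
    also have "\<dots> \<le> ennreal (8 * C * real n powr (- p) * B)"
    proof (intro Liminf_le always_eventually allI order_trans[OF tele] ennreal_leI)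
      fix m
      have "4 * C * real n powr (- p) * (\<Sum>j<m. w ^ j * a j) \<le> 4 * C * real n powr (- p) * (2 * B)"
        using C by (intro mult_left_mono suma) auto
      then show "4 * C * real n powr (- p) * (\<Sum>j<m. w ^ j * a j) \<le> 8 * C * real n powr (- p) * B" by simp
    qed simp
    finally have "adist p n g (U 0) \<le> ennreal (8 * C * real n powr (- p) * B)" .
    moreover have "U 0 \<in> trig_polys n" "pdist p g (U 0) \<le> ennreal (e n + \<epsilon>)"
      using U(1)[of 0] U(2)[of 0] by (auto simp: a_def)
    ultimately show "\<exists>U\<in>trig_polys n. pdist p g U \<le> ennreal (e n + \<epsilon>) \<and>
      adist p n g U \<le> ennreal (8 * C * real n powr (- p) * (e n
        + real n powr (p - 1) * (\<Sum>k. real (n + 1 + k) powr (- p) * e (n + 1 + k)) + \<epsilon>))"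
      unfolding B_def S_def by blast
  qed
qed

section \<open>Iterated derivatives and best approximations\<close>

lemma periodic_has_vector_derivative_shift:
  assumes "periodic H"
  shows "(H has_vector_derivative d) (at (x + 2 * pi)) \<longleftrightarrow> (H has_vector_derivative d) (at x)"
proof -
  have shift: "(H has_vector_derivative d) (at y)"
    if "(H has_vector_derivative d) (at (y + a))" "\<And>t. H (t + a) = H t" for a y
  proof -
    have "((\<lambda>t. t + a) has_vector_derivative 1) (at y)"
      by (auto simp: has_vector_derivative_def intro!: derivative_eq_intros)
    from vector_diff_chain_at[OF this, of H d] that show ?thesis by (simp add: o_def)
  qed
  have "H (t + - (2 * pi)) = H t" for t using periodicD[OF assms, of "t - 2 * pi"] by simp
  then show ?thesis
    using shift[of x "2 * pi"] shift[of "x + 2 * pi" "- (2 * pi)"] periodicD[OF assms] by auto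
qed

lemma periodic_dv:
  assumes "periodic H"
  shows "periodic (dv H)"
  unfolding periodic_def dv_def vector_derivative_def
  by (simp add: periodic_has_vector_derivative_shift[OF assms])

text \<open>By downward induction: a derivative that is a primitive of a locally integrable function is
  itself locally integrable, and an everywhere differentiable function is the integral of its derivative as soon
  as the latter is integrable.\<close>

lemma deriv_in_AC_chain:
  assumes "circle_fun f" "deriv_in_AC m f"
  shows "\<exists>g. primitive ((dv ^^ m) f) g \<and> (\<forall>j<m. primitive ((dv ^^ j) f) ((dv ^^ Suc j) f))"
proof -
  have AC: "(dv ^^ m) f \<in> AC_circle" and diff: "\<And>j x. j < m \<Longrightarrow> (dv ^^ j) f differentiable at x"
    using assms(2) by (auto simp: deriv_in_AC_def nderiv_dv)
  obtain g where g: "primitive ((dv ^^ m) f) g" using AC_circle_primitive[OF AC] by blast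
  have per: "periodic ((dv ^^ j) f)" for j
  proof (induction j)
    case 0
    show ?case using assms(1) by (simp add: circle_fun_eq)
  next
    case (Suc j)
    then show ?case by (simp add: periodic_dv)
  qed
  have step: "primitive ((dv ^^ j) f) ((dv ^^ Suc j) f)" if "j < m" "L1per ((dv ^^ Suc j) f)" for j
    using diff[OF that(1)] that(2)
    by (intro primitive_derivative per) (auto simp: dv_def vector_derivative_works)
  have L: "L1per ((dv ^^ (m - i)) f)" if "i \<le> m" for i
    using that
  proof (induction i)
    case 0
    show ?case using primitive_L1per[OF g] by simp
  next
    case (Suc i)
    have e: "Suc (m - Suc i) = m - i" using Suc.prems by simp
    have L': "L1per ((dv ^^ Suc (m - Suc i)) f)" unfolding e using Suc by simp
    have "primitive ((dv ^^ (m - Suc i)) f) ((dv ^^ Suc (m - Suc i)) f)"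
      by (rule step[OF _ L']) (use Suc.prems in simp)
    then show ?case by (rule primitive_L1per)
  qed
  have "primitive ((dv ^^ j) f) ((dv ^^ Suc j) f)" if "j < m" for j
    using L[of "m - Suc j"] that by (intro step) auto
  with g show ?thesis by blast
qed

lemma pint_finite:
  assumes "0 < p" "p \<le> 1" "L1per w"
  shows "pint p w < \<infinity>"
proof -
  have [measurable]: "w \<in> borel_measurable borel" by (rule L1perD[OF assms(3)])
  have le: "t powr p \<le> 1 + t" if "0 \<le> t" for t :: real
  proof (cases "t \<le> 1")
    case True
    then have "t powr p \<le> 1 powr p" using that assms by (intro powr_mono2) auto
    then show ?thesis using that by simp
  next
    case False
    then show ?thesis using powr_mono[of p 1 t] assms by simp
  qed
  have "pint p w \<le> circ_int (\<lambda>x. 1 + norm (w x))"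
    unfolding pint_def by (intro circ_int_mono le) auto
  also have "\<dots> = circ_int (\<lambda>x. 1) + circ_int (\<lambda>x. norm (w x))" by (intro circ_int_add) auto
  also have "circ_int (\<lambda>x. norm (w x)) \<le> ennreal (absint w 0 (2 * pi))"
    unfolding ennreal_absint[OF assms(3)] circ_int_def by (intro nn_integral_mono) (auto simp: indicator_def)
  then have "circ_int (\<lambda>x. 1) + circ_int (\<lambda>x. norm (w x)) \<le> ennreal (2 * pi * 1) + ennreal (absint w 0 (2 * pi))"
    by (intro add_mono) (simp_all add: circ_int_const)
  also have "\<dots> < \<infinity>" by simp
  finally show ?thesis .
qed

text \<open>The derivative of order \<open>r\<close> is only known to agree almost everywhere with a Borel function;
  for an integral over the complete measure this suffices.\<close>

lemma Lp_norm_pint: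
  assumes "0 < p" and w: "w \<in> borel_measurable borel" and ae: "AE x in lebesgue. W x = w x"
  shows "Lp_norm p W = enn2real (pint p w) powr (1 / p)"
proof -
  note [measurable] = w
  have wl: "w \<in> borel_measurable lebesgue" using w by (intro measurable_completion) simp
  have Wl: "W \<in> borel_measurable lebesgue"
    using ae by (intro borel_measurable_AE[OF wl]) (auto elim: eventually_mono)
  have "(LINT x:{0..<2*pi}|lebesgue. norm (W x) powr p) = (LINT x:{0..<2*pi}|lebesgue. norm (w x) powr p)"
    unfolding set_lebesgue_integral_def
  proof (rule integral_cong_AE)
    note [measurable] = wl Wl
    have [measurable]: "{0..<2*pi} \<in> sets lebesgue" by auto
    show "(\<lambda>x. indicator {0..<2*pi} x *\<^sub>R (norm (W x) powr p)) \<in> borel_measurable lebesgue"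
      "(\<lambda>x. indicator {0..<2*pi} x *\<^sub>R (norm (w x) powr p)) \<in> borel_measurable lebesgue"
      by measurable
    show "AE x in lebesgue. indicator {0..<2*pi} x *\<^sub>R (norm (W x) powr p) = indicator {0..<2*pi} x *\<^sub>R (norm (w x) powr p)"
      using ae by eventually_elim simp
  qed
  also have "\<dots> = (LINT x:{0..<2*pi}|lborel. norm (w x) powr p)"
    unfolding set_lebesgue_integral_def by (rule integral_completion) measurable
  also have "\<dots> = enn2real (\<integral>\<^sup>+x. ennreal (indicator {0..<2*pi} x *\<^sub>R (norm (w x) powr p)) \<partial>lborel)"
    unfolding set_lebesgue_integral_def by (rule integral_eq_nn_integral) auto
  also have "(\<integral>\<^sup>+x. ennreal (indicator {0..<2*pi} x *\<^sub>R (norm (w x) powr p)) \<partial>lborel) = pint p w"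
    unfolding pint_def circ_int_def by (intro nn_integral_cong) (auto simp: indicator_def)
  finally show ?thesis by (simp add: Lp_norm_def)
qed

lemma best_approx_props:
  assumes "0 < p" "p \<le> 1" "L1per g" "AE x in lebesgue. F x = g x"
  shows "0 \<le> best_approx n p F"
    and "T \<in> trig_polys n \<Longrightarrow> best_approx n p F \<le> Lp_norm p (\<lambda>x. F x - T x)"
    and "m \<le> n \<Longrightarrow> best_approx n p F \<le> best_approx m p F"
    and "0 < \<eta> \<Longrightarrow> \<exists>U\<in>trig_polys n. pdist p g U \<le> ennreal (best_approx n p F powr p + \<eta>)"
proof -
  have ne: "trig_polys n \<noteq> {}" for n using trig_poly_const by blast
  have nn: "0 \<le> Lp_norm p w" for w by (simp add: Lp_norm_def)
  have bdd: "bdd_below ((\<lambda>T. Lp_norm p (\<lambda>x. F x - T x)) ` A)" for A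
    using nn by (intro bdd_belowI[of _ 0]) auto
  show b0: "0 \<le> best_approx n p F"
    unfolding best_approx_def by (intro cINF_greatest ne nn)
  show "best_approx n p F \<le> Lp_norm p (\<lambda>x. F x - T x)" if "T \<in> trig_polys n"
    unfolding best_approx_def using that by (intro cINF_lower bdd)
  show "best_approx n p F \<le> best_approx m p F" if "m \<le> n"
    unfolding best_approx_def using that trig_poly_mono by (intro cINF_superset_mono ne bdd) auto
  show "\<exists>U\<in>trig_polys n. pdist p g U \<le> ennreal (best_approx n p F powr p + \<eta>)" if "0 < \<eta>"
  proof -
    define \<delta> where "\<delta> = \<eta> powr (1 / p)"
    have \<delta>: "0 < \<delta>" "\<delta> powr p = \<eta>" using that assms(1) by (auto simp: \<delta>_def powr_powr)
    have "best_approx n p F < best_approx n p F + \<delta>" using \<delta> by simp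
    then obtain U where U: "U \<in> trig_polys n" "Lp_norm p (\<lambda>x. F x - U x) < best_approx n p F + \<delta>"
      unfolding best_approx_def[of n p F] using cINF_less_iff[OF ne[of n] bdd] by blast
    have LU: "L1per (\<lambda>x. g x - U x)" by (intro L1per_diff assms L1per_trig[OF U(1)])
    have "Lp_norm p (\<lambda>x. F x - U x) = enn2real (pdist p g U) powr (1 / p)"
      using assms(4) by (intro Lp_norm_pint assms(1) L1perD(1)[OF LU]) (auto elim: eventually_mono)
    then have "Lp_norm p (\<lambda>x. F x - U x) powr p = enn2real (pdist p g U)"
      using assms(1) by (simp add: powr_powr)
    then have "pdist p g U = ennreal (Lp_norm p (\<lambda>x. F x - U x) powr p)"
      using pint_finite[OF assms(1,2) LU] by simp
    also have "\<dots> \<le> ennreal ((best_approx n p F + \<delta>) powr p)"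
      using U(2) nn assms(1) by (intro ennreal_leI powr_mono2) auto
    also have "\<dots> \<le> ennreal (best_approx n p F powr p + \<delta> powr p)"
      using b0 \<delta> assms by (intro ennreal_leI powr_add_le) auto
    finally show ?thesis using U(1) \<delta> by auto
  qed
qed

section \<open>Error of the derivatives of best approximants\<close>

text \<open>Let \<open>U\<close> be near-best for \<open>\<phi> r\<close> and let \<open>V\<close> belong to it by \<open>simultaneous_approx\<close>. Then
  \<open>\<phi> r - U\<close> and \<open>U - (dv ^^ r) V\<close> are under control, and since \<open>T\<close> is at least as good as \<open>V\<close>,
  \<open>V - T\<close> is at most twice as large as \<open>\<phi> 0 - V\<close>; Bernstein's inequality handles its derivative.\<close>

lemma derivative_error_pint:
  assumes "0 < p" "p \<le> 1" "1 \<le> r"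
  shows "\<exists>K>0. \<forall>n\<ge>1. \<forall>\<phi> T e. (\<forall>j<r. primitive (\<phi> j) (\<phi> (Suc j))) \<longrightarrow> T \<in> trig_polys n \<longrightarrow>
    (\<forall>V\<in>trig_polys n. pdist p (\<phi> 0) T \<le> pdist p (\<phi> 0) V) \<longrightarrow>
    (\<forall>k. 0 \<le> e k) \<longrightarrow> (\<forall>k l. k \<le> l \<longrightarrow> e l \<le> e k) \<longrightarrow>
    (\<forall>\<nu> \<eta>. 0 < \<eta> \<longrightarrow> (\<exists>U\<in>trig_polys \<nu>. pdist p (\<phi> r) U \<le> ennreal (e \<nu> + \<eta>))) \<longrightarrow>
    summable (\<lambda>k. real (k + 1) powr (- p) * e (k + 1)) \<longrightarrow>
    pdist p (\<phi> r) ((dv ^^ r) T)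
      \<le> ennreal (K * (e n + real n powr (p - 1) * (\<Sum>k. real (n + 1 + k) powr (- p) * e (n + 1 + k))))"
proof -
  obtain C where C: "0 < C" and sim: "\<forall>n\<ge>1. \<forall>\<phi> U. (\<forall>j<r. primitive (\<phi> j) (\<phi> (Suc j))) \<longrightarrow> U \<in> trig_polys n \<longrightarrow>
    (\<exists>V\<in>trig_polys n. approx_bounds p r C n (\<phi> 0) (\<phi> r) U V)"
    using simultaneous_approx[OF assms] by blast
  obtain B where B: "0 < B" and bern:
    "\<forall>n\<ge>1. \<forall>T\<in>trig_polys n. \<forall>k. pint p ((dv ^^ k) T) \<le> ennreal ((B * real n powr p) ^ k) * pint p T"
    using bernstein_iter[OF assms(1,2)] by blast
  obtain A where A: "0 < A" and near: "\<forall>n\<ge>1. \<forall>g e \<epsilon>. L1per g \<longrightarrow> (\<forall>k. 0 \<le> e k) \<longrightarrow> (\<forall>k l. k \<le> l \<longrightarrow> e l \<le> e k) \<longrightarrow>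
    (\<forall>\<nu> \<eta>. 0 < \<eta> \<longrightarrow> (\<exists>U\<in>trig_polys \<nu>. pdist p g U \<le> ennreal (e \<nu> + \<eta>))) \<longrightarrow>
    summable (\<lambda>k. real (k + 1) powr (- p) * e (k + 1)) \<longrightarrow> 0 < \<epsilon> \<longrightarrow>
    (\<exists>U\<in>trig_polys n. pdist p g U \<le> ennreal (e n + \<epsilon>) \<and>
      adist p n g U \<le> ennreal (A * real n powr (- p) * (e n
        + real n powr (p - 1) * (\<Sum>k. real (n + 1 + k) powr (- p) * e (n + 1 + k)) + \<epsilon>)))"
    using near_best_amalgam[OF assms(1,2)] by blast
  define K where "K = 1 + (C * A + 2 * B ^ r * C * A)"
  have K: "0 < K" using A B C by (auto simp: K_def add_pos_pos)
  show ?thesis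
  proof (intro exI[of _ K] conjI K allI impI)
    fix n \<phi> T e
    assume n: "1 \<le> (n::nat)" and \<phi>: "\<forall>j<r. primitive (\<phi> j) (\<phi> (Suc j))" and T: "T \<in> trig_polys n"
      and best: "\<forall>V\<in>trig_polys n. pdist p (\<phi> 0) T \<le> pdist p (\<phi> 0) V"
      and e0: "\<forall>k. 0 \<le> (e k :: real)" and dec: "\<forall>k l. k \<le> l \<longrightarrow> e l \<le> e k"
      and nb: "\<forall>\<nu> \<eta>. 0 < \<eta> \<longrightarrow> (\<exists>U\<in>trig_polys \<nu>. pdist p (\<phi> r) U \<le> ennreal (e \<nu> + \<eta>))"
      and sum: "summable (\<lambda>k. real (k + 1) powr (- p) * e (k + 1))"
    define R where "R = e n + real n powr (p - 1) * (\<Sum>k. real (n + 1 + k) powr (- p) * e (n + 1 + k))"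
    have "0 \<le> (\<Sum>k. real (n + 1 + k) powr (- p) * e (n + 1 + k))"
      using e0 summable_ignore_initial_segment[OF sum, of n] by (intro suminf_nonneg) (auto simp: add_ac)
    then have R0: "0 \<le> R" using e0 by (simp add: R_def)
    define q where "q = real n powr p"
    have q: "0 < q" using n by (simp add: q_def)
    have "primitive (\<phi> (r - 1)) (\<phi> (Suc (r - 1)))" using assms(3) by (intro \<phi>[rule_format]) simp
    then have Lg: "L1per (\<phi> r)" using assms(3) by (simp add: primitive_def)
    have "primitive (\<phi> 0) (\<phi> (Suc 0))" using assms(3) by (intro \<phi>[rule_format]) simp
    then have L0: "L1per (\<phi> 0)" by (rule primitive_L1per)
    have gm: "\<phi> r \<in> borel_measurable borel" "\<phi> 0 \<in> borel_measurable borel" using Lg L0 L1perD(1) by auto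
    have Tr: "(dv ^^ r) T \<in> trig_polys n" by (rule trig_poly_dv_iter[OF T])
    have main: "pdist p (\<phi> r) ((dv ^^ r) T) \<le> ennreal (K * (R + \<epsilon>))" if \<epsilon>: "0 < \<epsilon>" for \<epsilon>
    proof -
      obtain U where U: "U \<in> trig_polys n" "pdist p (\<phi> r) U \<le> ennreal (e n + \<epsilon>)"
        "adist p n (\<phi> r) U \<le> ennreal (A * real n powr (- p) * (R + \<epsilon>))"
        using near[rule_format, OF n Lg e0[rule_format] dec[rule_format] nb[rule_format] sum \<epsilon>]
        unfolding R_def by blast
      let ?A = "adist p n (\<phi> r) U"
      have qA: "ennreal (c * q) * ?A \<le> ennreal (c * A * (R + \<epsilon>))" if "0 \<le> c" for c
      proof -
        have "ennreal (c * q) * ?A \<le> ennreal (c * q) * ennreal (A * real n powr (- p) * (R + \<epsilon>))"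
          by (intro mult_left_mono U(3)) auto
        also have "\<dots> = ennreal (c * q * (A * real n powr (- p) * (R + \<epsilon>)))"
          using that q by (simp add: ennreal_mult'[symmetric])
        also have "c * q * (A * real n powr (- p) * (R + \<epsilon>)) = c * A * (R + \<epsilon>) * (q * real n powr (- p))"
          by (simp only: mult_ac)
        also have "q * real n powr (- p) = 1" using n by (simp add: q_def powr_add[symmetric])
        finally show ?thesis by simp
      qed
      obtain V where V: "V \<in> trig_polys n" "pdist p (\<phi> 0) V \<le> ennreal (C * q / q ^ r) * ?A"
        "pdist p ((dv ^^ r) V) U \<le> ennreal (C * q) * ?A"
        using sim n \<phi> U(1) unfolding approx_bounds_def q_def by blast
      have Vr: "(dv ^^ r) V \<in> trig_polys n" by (rule trig_poly_dv_iter[OF V(1)])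
      have VU: "pdist p U ((dv ^^ r) V) \<le> ennreal (C * A * (R + \<epsilon>))"
        using V(3) qA[of C] C unfolding pint_commute[of p U] by (meson less_imp_le order_trans)
      have VT: "pdist p ((dv ^^ r) V) ((dv ^^ r) T) \<le> ennreal (2 * B ^ r * C * A * (R + \<epsilon>))"
      proof -
        have "pdist p V T \<le> pdist p V (\<phi> 0) + pdist p (\<phi> 0) T"
          by (intro pint_diff_le assms(1,2) gm trig_poly_measurable[OF V(1)] trig_poly_measurable[OF T])
        also have "\<dots> \<le> ennreal (C * q / q ^ r) * ?A + ennreal (C * q / q ^ r) * ?A"
          unfolding pint_commute[of p V] using best V by (intro add_mono) (auto intro: order_trans)
        also have "\<dots> = ennreal (2 * (C * q / q ^ r)) * ?A"
          using C q by (subst distrib_right[symmetric], subst ennreal_plus[symmetric]) auto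
        finally have d: "pdist p V T \<le> ennreal (2 * (C * q / q ^ r)) * ?A" .
        have "pdist p ((dv ^^ r) V) ((dv ^^ r) T) \<le> ennreal ((B * q) ^ r) * pdist p V T"
          using bern n trig_poly_diff[OF V(1) T] unfolding dv_iter_trig_diff[OF V(1) T, symmetric] q_def by blast
        also have "\<dots> \<le> ennreal ((B * q) ^ r) * (ennreal (2 * (C * q / q ^ r)) * ?A)"
          by (intro mult_left_mono d) auto
        also have "\<dots> = ennreal ((B * q) ^ r * (2 * (C * q / q ^ r))) * ?A"
          using B q by (intro ennreal_mult_assoc) auto
        also have "(B * q) ^ r * (2 * (C * q / q ^ r)) = 2 * B ^ r * C * q"
          using q by (simp add: power_mult_distrib field_simps)
        also have "ennreal (2 * B ^ r * C * q) * ?A \<le> ennreal (2 * B ^ r * C * A * (R + \<epsilon>))"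
          using B C by (intro qA) auto
        finally show ?thesis .
      qed
      have gU: "pdist p (\<phi> r) U \<le> ennreal (R + \<epsilon>)"
      proof (rule order_trans[OF U(2)], intro ennreal_leI add_right_mono)
        show "e n \<le> R" using \<open>0 \<le> (\<Sum>k. real (n + 1 + k) powr (- p) * e (n + 1 + k))\<close> by (simp add: R_def)
      qed
      have "pdist p (\<phi> r) ((dv ^^ r) T) \<le> pdist p (\<phi> r) U + pdist p U ((dv ^^ r) T)"
        by (intro pint_diff_le assms(1,2) gm trig_poly_measurable[OF U(1)] trig_poly_measurable[OF Tr])
      also have "pdist p U ((dv ^^ r) T)
          \<le> pdist p U ((dv ^^ r) V) + pdist p ((dv ^^ r) V) ((dv ^^ r) T)"
        by (intro pint_diff_le assms(1,2) trig_poly_measurable[OF U(1)] trig_poly_measurable[OF Vr] trig_poly_measurable[OF Tr])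
      finally have "pdist p (\<phi> r) ((dv ^^ r) T) \<le> pdist p (\<phi> r) U
          + (pdist p U ((dv ^^ r) V) + pdist p ((dv ^^ r) V) ((dv ^^ r) T))"
        by (simp add: add_left_mono)
      also have "\<dots> \<le> ennreal (R + \<epsilon>) + (ennreal (C * A * (R + \<epsilon>)) + ennreal (2 * B ^ r * C * A * (R + \<epsilon>)))"
        by (intro add_mono gU VU VT)
      also have "\<dots> = ennreal (K * (R + \<epsilon>))"
        using A B C R0 \<epsilon> by (subst ennreal_plus[symmetric], simp, simp, subst ennreal_plus[symmetric])
          (auto simp: K_def algebra_simps)
      finally show ?thesis .
    qed
    have "pdist p (\<phi> r) ((dv ^^ r) T) \<le> ennreal (K * R)"
    proof (rule ennreal_le_epsilon)
      fix d :: real assume d: "0 < d"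
      have "pdist p (\<phi> r) ((dv ^^ r) T) \<le> ennreal (K * (R + d / K))"
        using d K by (intro main) simp
      also have "K * (R + d / K) = K * R + d" using K by (simp add: distrib_left)
      finally show "pdist p (\<phi> r) ((dv ^^ r) T) \<le> ennreal (K * R) + ennreal d"
        using K R0 d by simp
    qed
    then show "pdist p (\<phi> r) ((dv ^^ r) T)
      \<le> ennreal (K * (e n + real n powr (p - 1) * (\<Sum>k. real (n + 1 + k) powr (- p) * e (n + 1 + k))))"
      by (simp only: R_def)
  qed
qed

lemma powr_inverse_add_le:
  assumes "0 < (p::real)" "0 \<le> a" "0 \<le> b"
  shows "(a + b) powr (1 / p) \<le> 2 powr (1 / p) * (a powr (1 / p) + b powr (1 / p))"
proof -
  have "(a + b) powr (1 / p) \<le> (2 * max a b) powr (1 / p)"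
    using assms by (intro powr_mono2) auto
  also have "\<dots> = 2 powr (1 / p) * max a b powr (1 / p)" using assms by (simp add: powr_mult)
  also have "\<dots> \<le> 2 powr (1 / p) * (a powr (1 / p) + b powr (1 / p))"
    by (intro mult_left_mono) (auto simp: max_def)
  finally show ?thesis .
qed

theorem theorem2p3:
  fixes p :: real and r :: nat
  assumes "0 < p" and "p < 1" and "1 \<le> r"
  shows "\<exists>C>0. \<forall>(f :: real \<Rightarrow> complex) (T :: nat \<Rightarrow> real \<Rightarrow> complex).
    circle_fun f \<longrightarrow>
    deriv_in_AC (r - 1) f \<longrightarrow>
    summable (\<lambda>k. real (k + 1) powr (- p) * best_approx (k + 1) p (nderiv r f) powr p) \<longrightarrow>
    (\<forall>n\<ge>1. T n \<in> trig_polys n \<and> Lp_norm p (\<lambda>x. f x - T n x) = best_approx n p f) \<longrightarrow>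
    (\<forall>n\<ge>1. Lp_norm p (\<lambda>x. nderiv r f x - nderiv r (T n) x)
       \<le> C * (best_approx n p (nderiv r f)
            + real n powr (1 - 1 / p)
              * (\<Sum>k. real (n + 1 + k) powr (- p) * best_approx (n + 1 + k) p (nderiv r f) powr p)
                  powr (1 / p)))"
proof -
  have p1: "p \<le> 1" using assms by simp
  obtain K where K: "0 < K" and err: "\<forall>n\<ge>1. \<forall>\<phi> T e. (\<forall>j<r. primitive (\<phi> j) (\<phi> (Suc j))) \<longrightarrow> T \<in> trig_polys n \<longrightarrow>
    (\<forall>V\<in>trig_polys n. pdist p (\<phi> 0) T \<le> pdist p (\<phi> 0) V) \<longrightarrow>
    (\<forall>k. 0 \<le> e k) \<longrightarrow> (\<forall>k l. k \<le> l \<longrightarrow> e l \<le> e k) \<longrightarrow>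
    (\<forall>\<nu> \<eta>. 0 < \<eta> \<longrightarrow> (\<exists>U\<in>trig_polys \<nu>. pdist p (\<phi> r) U \<le> ennreal (e \<nu> + \<eta>))) \<longrightarrow>
    summable (\<lambda>k. real (k + 1) powr (- p) * e (k + 1)) \<longrightarrow>
    pdist p (\<phi> r) ((dv ^^ r) T)
      \<le> ennreal (K * (e n + real n powr (p - 1) * (\<Sum>k. real (n + 1 + k) powr (- p) * e (n + 1 + k))))"
    using derivative_error_pint[OF assms(1) p1 assms(3)] by blast
  define C where "C = K powr (1 / p) * 2 powr (1 / p)"
  have C: "0 < C" using K by (simp add: C_def)
  show ?thesis
  proof (intro exI[of _ C] conjI C allI impI)
    fix f :: "real \<Rightarrow> complex" and T :: "nat \<Rightarrow> real \<Rightarrow> complex" and n :: nat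
    assume f: "circle_fun f" "deriv_in_AC (r - 1) f"
      and sum: "summable (\<lambda>k. real (k + 1) powr (- p) * best_approx (k + 1) p (nderiv r f) powr p)"
      and T: "\<forall>n\<ge>1. T n \<in> trig_polys n \<and> Lp_norm p (\<lambda>x. f x - T n x) = best_approx n p f"
      and n: "1 \<le> n"
    have Tn: "T n \<in> trig_polys n" "Lp_norm p (\<lambda>x. f x - T n x) = best_approx n p f"
      using T n by auto
    obtain g where g: "primitive ((dv ^^ (r - 1)) f) g"
      and chain: "\<forall>j<r - 1. primitive ((dv ^^ j) f) ((dv ^^ Suc j) f)"
      using deriv_in_AC_chain[OF f] by blast
    have r: "Suc (r - 1) = r" using assms(3) by simp
    have F: "nderiv r f = dv ((dv ^^ (r - 1)) f)"
      unfolding nderiv_dv by (subst r[symmetric]) simp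
    have ae: "AE x in lebesgue. nderiv r f x = g x"
      using primitive_AE_derivative[OF g] unfolding F dv_def .
    have Lg: "L1per g" using g by (simp add: primitive_def)
    define \<phi> where "\<phi> j = (if j = r then g else (dv ^^ j) f)" for j
    have \<phi>: "\<forall>j<r. primitive (\<phi> j) (\<phi> (Suc j))"
    proof (intro allI impI)
      fix j assume j: "j < r"
      show "primitive (\<phi> j) (\<phi> (Suc j))"
      proof (cases "Suc j = r")
        case True
        then have "j = r - 1" by simp
        then show ?thesis using g j True by (simp add: \<phi>_def)
      next
        case False
        then have "j < r - 1" using j by simp
        then show ?thesis using chain j False by (simp add: \<phi>_def)
      qed
    qed
    have \<phi>0: "\<phi> 0 = f" using assms(3) by (simp add: \<phi>_def)
    have \<phi>r: "\<phi> r = g" by (simp add: \<phi>_def)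
    have "primitive (\<phi> 0) (\<phi> (Suc 0))" using assms(3) by (intro \<phi>[rule_format]) simp
    then have Lf: "L1per f" unfolding \<phi>0 by (rule primitive_L1per)
    note bg = best_approx_props[OF assms(1) p1 Lg ae]
    have bf: "best_approx n p f \<le> Lp_norm p (\<lambda>x. f x - V x)" if "V \<in> trig_polys n" for V
      by (rule best_approx_props(2)[OF assms(1) p1 Lf _ that]) simp
    have opt: "pdist p f (T n) \<le> pdist p f V" if V: "V \<in> trig_polys n" for V
    proof -
      have LT: "L1per (\<lambda>x. f x - T n x)" by (intro L1per_diff Lf L1per_trig[OF Tn(1)])
      have LV: "L1per (\<lambda>x. f x - V x)" by (intro L1per_diff Lf L1per_trig[OF V])
      have "enn2real (pdist p f (T n)) powr (1 / p) \<le> enn2real (pdist p f V) powr (1 / p)"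
        using bf[OF V] Tn(2) Lp_norm_pint[OF assms(1) L1perD(1)[OF LT], of "\<lambda>x. f x - T n x"]
          Lp_norm_pint[OF assms(1) L1perD(1)[OF LV], of "\<lambda>x. f x - V x"] by simp
      with powr_ge_zero have le: "(enn2real (pdist p f (T n)) powr (1 / p)) powr p
          \<le> (enn2real (pdist p f V) powr (1 / p)) powr p"
        by (rule powr_mono2[OF less_imp_le[OF assms(1)]])
      have root: "(enn2real y powr (1 / p)) powr p = enn2real y" for y
        using assms(1) by (simp add: powr_powr)
      have "enn2real (pdist p f (T n)) \<le> enn2real (pdist p f V)"
        using le unfolding root .
      then have "ennreal (enn2real (pdist p f (T n))) \<le> ennreal (enn2real (pdist p f V))"
        by (rule ennreal_leI)
      moreover have "ennreal (enn2real (pint p w)) = pint p w" if "L1per w" for w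
        using pint_finite[OF assms(1) p1 that] by simp
      ultimately show ?thesis using LT LV by metis
    qed
    define e where "e k = best_approx k p (nderiv r f) powr p" for k
    define S where "S = (\<Sum>k. real (n + 1 + k) powr (- p) * e (n + 1 + k))"
    have sume: "summable (\<lambda>k. real (k + 1) powr (- p) * e (k + 1))" using sum by (simp add: e_def)
    have S0: "0 \<le> S"
      unfolding S_def using summable_ignore_initial_segment[OF sume, of n]
      by (intro suminf_nonneg) (auto simp: add_ac e_def)
    have edec: "e l \<le> e k" if "k \<le> l" for k l
      unfolding e_def using bg(1,3) that assms(1) by (intro powr_mono2) auto
    have Lr: "L1per (\<lambda>x. g x - (dv ^^ r) (T n) x)"
      by (intro L1per_diff Lg L1per_trig[OF trig_poly_dv_iter[OF Tn(1)]])
    have main: "pint p (\<lambda>x. g x - (dv ^^ r) (T n) x) \<le> ennreal (K * (e n + real n powr (p - 1) * S))"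
      using err[rule_format, of n \<phi> "T n" e] n \<phi> Tn(1) opt edec bg(4) sume
      unfolding S_def \<phi>0 \<phi>r by (simp add: e_def)
    have "Lp_norm p (\<lambda>x. nderiv r f x - nderiv r (T n) x)
        = enn2real (pint p (\<lambda>x. g x - (dv ^^ r) (T n) x)) powr (1 / p)"
      using ae by (intro Lp_norm_pint assms(1) L1perD(1)[OF Lr]) (auto simp: nderiv_dv[of r "T n"] elim: eventually_mono)
    also have "\<dots> \<le> (K * (e n + real n powr (p - 1) * S)) powr (1 / p)"
      using main K S0 assms(1) by (intro powr_mono2 enn2real_leI) (auto simp: e_def)
    also have "\<dots> = K powr (1 / p) * (e n + real n powr (p - 1) * S) powr (1 / p)"
      using K S0 by (simp add: powr_mult e_def)
    also have "\<dots> \<le> K powr (1 / p) * (2 powr (1 / p) * (e n powr (1 / p) + (real n powr (p - 1) * S) powr (1 / p)))"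
      using assms(1) S0 by (intro mult_left_mono powr_inverse_add_le) (auto simp: e_def)
    also have "e n powr (1 / p) = best_approx n p (nderiv r f)"
      using assms(1) bg(1)[of n] by (simp add: e_def powr_powr)
    also have "(real n powr (p - 1) * S) powr (1 / p) = real n powr (1 - 1 / p) * S powr (1 / p)"
      using assms(1) S0 by (simp add: powr_mult powr_powr diff_divide_distrib)
    finally show "Lp_norm p (\<lambda>x. nderiv r f x - nderiv r (T n) x)
       \<le> C * (best_approx n p (nderiv r f)
            + real n powr (1 - 1 / p)
              * (\<Sum>k. real (n + 1 + k) powr (- p) * best_approx (n + 1 + k) p (nderiv r f) powr p)
                  powr (1 / p))"
      by (simp add: C_def S_def e_def mult.assoc)
  qed
qed

end
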